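(* Let $d\ge 2$, let $\beta\in(0,2]$, and let $B(|v-v_*|,\cos\theta)=|v-v_*|^\beta\, b(\cos\theta)$, where $b\ge 0$ is not almost everywhere zero and $b\in L^1\big([-1,1],(1-z^2)^{\frac{d-3}{2}}\,\mathrm{d}z\big)$. Let $f$ be an energy-conserving solution on $[0,+\infty)$ to the spatially homogeneous Boltzmann equation $\partial_t f=Q(f,f)$ with collision kernel $B$ and initial data $f(0,\cdot)=f_0\ge 0$ satisfying $f_0\in L^1(\mathbb{R}^d,(1+|v|^2)\,\mathrm{d}v)$. Then there are constants $C,a>0$, depending only on $b$, $\beta$, the initial mass $\int_{\mathbb{R}^d} f_0(v)\,\mathrm{d}v$ and the initial energy $\int_{\mathbb{R}^d}|v|^2 f_0(v)\,\mathrm{d}v$, such that $$\int_{\mathbb{R}^d} f(t,v)\,\exp\big(a\min\{t,1\}\,|v|^\beta\big)\,\mathrm{d}v\le C\qquad\text{for all } t\ge 0.$$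
   Context: The dimension $d\ge2$ is fixed. For a nonnegative function $f=f(v)$ on $\mathbb{R}^d$, the collision operator is $$Q(f,f)(v):=\int_{\mathbb{R}^d\times\mathbb{S}^{d-1}}B(|v-v_*|,\cos\theta)\,\big(f(v'_* )f(v')-f(v_* )f(v)\big)\,\mathrm{d}v_*\,\mathrm{d}\sigma,$$ where $$v'=\frac{v+v_*}{2}+\frac{|v-v_*|}{2}\sigma,\qquad v'_*=\frac{v+v_*}{2}-\frac{|v-v_*|}{2}\sigma,\qquad \cos\theta=\frac{v-v_*}{|v-v_*|}\cdot\sigma .$$ A solution on $[0,+\infty)$ with initial data $f_0$ is a nonnegative measurable $f=f(t,v)$ with $f\in C([0,\infty);L^1(\mathbb{R}^d))\cap L^\infty_{\mathrm{loc}}([0,\infty);L^1((1+|v|^2)\,\mathrm{d}v))$ such that $f(t,\cdot)=f_0+\int_0^t Q(f,f)(\tau,\cdot)\,\mathrm{d}\tau$ in $L^1(\mathbb{R}^d)$ for all $t\ge0$. It is energy-conserving if $\int_{\mathbb{R}^d}|v|^2f(t,v)\,\mathrm{d}v=\int_{\mathbb{R}^d}|v|^2f_0(v)\,\mathrm{d}v$ for all $t\ge 0$. *)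

theory Defs
  imports "HOL-Analysis.Analysis"
begin

(* Surface measure on the unit sphere, normalised by polar coordinates:
   the measure of A is DIM('a) times the Lebesgue measure of the open cone
   {r x | 0 < r < 1, x in A}; its total mass is DIM('a) times the volume of the unit ball. *)
definition sphere_measure :: "'a::euclidean_space measure" where
  "sphere_measure =
     scale_measure (of_nat DIM('a))
       (distr (restrict_space lborel (ball 0 1 - {0})) (restrict_space borel (sphere 0 1))
         (\<lambda>x. x /\<^sub>R norm x))"

lemma emeasure_sphere_measure:
  fixes A :: "'a::euclidean_space set"
  assumes "A \<in> sets borel" "A \<subseteq> sphere 0 1"
  shows "emeasure sphere_measure A =
           of_nat DIM('a) * emeasure lborel {x \<in> ball 0 1 - {0}. x /\<^sub>R norm x \<in> A}"
proof -
  have [measurable]: "(\<lambda>x. x /\<^sub>R norm x) \<in> restrict_space lborel (ball 0 1 - {0})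
                        \<rightarrow>\<^sub>M restrict_space borel (sphere (0::'a) 1)"
    by (rule measurable_restrict_space2)
       (auto simp: space_restrict_space intro!: measurable_restrict_space1)
  have A: "A \<in> sets (restrict_space borel (sphere 0 1))"
    using assms by (auto simp: sets_restrict_space)
  have eq: "(\<lambda>x. x /\<^sub>R norm x) -` A \<inter> (ball 0 1 - {0}) =
              {x \<in> ball 0 1 - {0}. x /\<^sub>R norm x \<in> A}"
    by blast
  let ?C = "{x \<in> ball 0 1 - {0}. x /\<^sub>R norm x \<in> A}"
  have "emeasure (restrict_space lborel (ball 0 1 - {0})) ?C = emeasure lborel ?C"
    by (rule emeasure_restrict_space) auto
  then show ?thesis
    unfolding sphere_measure_def using A
    by (simp add: emeasure_distr space_restrict_space eq del: mem_ball_0)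
qed

definition post_v :: "'a::euclidean_space \<Rightarrow> 'a \<Rightarrow> 'a \<Rightarrow> 'a" where
  "post_v v w \<sigma> = (v + w) /\<^sub>R 2 + (norm (v - w) / 2) *\<^sub>R \<sigma>"

definition post_v_star :: "'a::euclidean_space \<Rightarrow> 'a \<Rightarrow> 'a \<Rightarrow> 'a" where
  "post_v_star v w \<sigma> = (v + w) /\<^sub>R 2 - (norm (v - w) / 2) *\<^sub>R \<sigma>"

definition cos_theta :: "'a::euclidean_space \<Rightarrow> 'a \<Rightarrow> 'a \<Rightarrow> real" where
  "cos_theta v w \<sigma> = ((v - w) /\<^sub>R norm (v - w)) \<bullet> \<sigma>"

definition collision_op ::
    "(real \<Rightarrow> real \<Rightarrow> real) \<Rightarrow> ('a::euclidean_space \<Rightarrow> real) \<Rightarrow> 'a \<Rightarrow> real" where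
  "collision_op B f v =
     (\<integral>(w, \<sigma>). B (norm (v - w)) (cos_theta v w \<sigma>) *
                (f (post_v_star v w \<sigma>) * f (post_v v w \<sigma>) - f w * f v)
        \<partial>(lborel \<Otimes>\<^sub>M sphere_measure))"

(* Elements of L^1 are represented by Borel functions. The last two conjuncts express the
   identity f(t) = f0 + (integral over [0,t] of Q(f,f)) between elements of L^1: the first
   is the integrability of Q(f,f) as an L^1-valued map on [0,t], which makes its
   L^1-valued integral the function obtained by integrating in time for almost every v. *)
definition boltzmann_solution ::
    "(real \<Rightarrow> real \<Rightarrow> real) \<Rightarrow> ('a::euclidean_space \<Rightarrow> real) \<Rightarrow> (real \<Rightarrow> 'a \<Rightarrow> real) \<Rightarrow> bool" where
  "boltzmann_solution B f0 f \<longleftrightarrow>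
     (\<forall>t\<ge>0. \<forall>v. 0 \<le> f t v) \<and>
     (\<lambda>(t, v). f t v) \<in> borel_measurable (restrict_space borel {0..} \<Otimes>\<^sub>M borel) \<and>
     (\<forall>t\<ge>0. integrable lborel (f t)) \<and>
     (\<forall>t\<ge>0. ((\<lambda>s. \<integral>v. \<bar>f s v - f t v\<bar> \<partial>lborel) \<longlongrightarrow> 0) (at t within {0..})) \<and>
     (\<forall>T\<ge>0. \<exists>K::real. AE t\<in>{0..T} in lborel.
        (\<integral>\<^sup>+v. ennreal ((1 + (norm v)\<^sup>2) * f t v) \<partial>lborel) \<le> ennreal K) \<and>
     (\<forall>t\<ge>0. integrable (restrict_space lborel {0..t} \<Otimes>\<^sub>M lborel)
               (\<lambda>(\<tau>, v). collision_op B (f \<tau>) v)) \<and>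
     (\<forall>t\<ge>0. AE v in lborel.
        f t v = f0 v + (\<integral>\<tau>\<in>{0..t}. collision_op B (f \<tau>) v \<partial>lborel))"

definition energy_conserving ::
    "('a::euclidean_space \<Rightarrow> real) \<Rightarrow> (real \<Rightarrow> 'a \<Rightarrow> real) \<Rightarrow> bool" where
  "energy_conserving f0 f \<longleftrightarrow>
     (\<forall>t\<ge>0. (\<integral>\<^sup>+v. ennreal ((norm v)\<^sup>2 * f t v) \<partial>lborel) =
            (\<integral>\<^sup>+v. ennreal ((norm v)\<^sup>2 * f0 v) \<partial>lborel))"

end

theory Submission imports Defs begin

text \<open>
  Tested against a weight \<open>\<phi>\<close>, the equation balances \<open>\<integral> f \<phi>\<close> with a gain and a loss term, in
  \<^typ>\<open>ennreal\<close> and for every measurable \<open>\<phi> \<ge> 0\<close>.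

  Appearance of moments: since the energy is conserved, the excess energies
  \<open>A(n) = \<integral> f * max 0 (\<bar>v\<bar>\<^sup>2 - n)\<close> can be followed with the bounded concave weight \<open>min (\<bar>v\<bar>\<^sup>2) n\<close>. A collision
  of a fast particle with a slow one produces with positive probability two particles of energy above
  \<open>n\<close>, so \<open>A(n)\<close> dissipates \<open>n \<integral> f \<bar>v\<bar>\<^bsup>\<beta>\<^esup>\<close> over \<open>\<bar>v\<bar>\<^sup>2 \<ge> K n\<close>, up to an error of lower order. Iterating gives
  arbitrary polynomial decay of \<open>A(n)\<close> at every positive time.

  Exponential moments: fix \<open>t0 > 0\<close>, \<open>s = a (t - t0)\<close>, and let \<open>\<phi>\<close> be the part of the exponential series of
  \<open>s \<bar>v\<bar>\<^bsup>\<beta>\<^esup>\<close> between the orders \<open>p0\<close> and \<open>N\<close>. Since \<open>(x + y) powr (\<beta>/2) \<le> x powr (\<beta>/2) + y powr (\<beta>/2)\<close>,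
  the post-collisional \<open>\<phi>\<close> is at most the product of the pre-collisional exponential sums times an
  angular factor whose average is small when \<open>p0\<close> is large. Hence, as long as \<open>\<integral> f exp\<close> stays below four
  times the mass, the loss term absorbs both the gain and the time derivative of \<open>\<phi>\<close>, up to a constant
  that depends neither on \<open>N\<close> nor on \<open>t0\<close>; by continuity the exponential sums stay below twice the mass
  for a time independent of \<open>N\<close> and \<open>t0\<close>.
\<close>

text \<open>Only mass and energy are finite at time 0, so no higher moment can be propagated from
  there. The polynomial decay is purely qualitative: its constants may depend on the solution, on
  \<open>t0\<close> and on the time horizon, and serve only to make truncated exponential sums
  finite and continuous and the loss integrals cancellable. Every quantitative constant comes from
  the exponential stage and is built from \<open>\<Lambda>\<close>, \<open>p0\<close>,
  \<open>C0\<close>, mass and energy, which makes \<open>C\<close> and \<open>a\<close> common to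
  all solutions. Working in \<open>ennreal\<close> avoids integrability hypotheses but forbids
  subtraction. A loss term can be cancelled only once it is known to be finite, which is why the
  tail estimate uses bounded weights. The tail dissipation carries a factor \<open>n\<close> that
  its error lacks. Time integration turns this into a better decay of the flux, and a well-chosen
  instant turns that into decay of \<open>A(n)\<close> from then on. Since \<open>b\<close> is
  merely integrable, smallness of the angular average cannot come from a supremum; \<open>b\<close>
  is split at a high level before \<open>p0\<close> is chosen. Large times need nothing extra: mass
  and energy are conserved, so the argument restarts shortly before each \<open>t\<close>.\<close>

section \<open>Polar coordinates\<close>

lemma ball_in_sets_borel[measurable]: "ball (x::'a::euclidean_space) r \<in> sets borel"
  by simp

section \<open>Invariance of the Lebesgue integral under affine maps and isometries\<close>

lemma nn_integral_lborel_translate: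
  fixes f :: "'a::euclidean_space \<Rightarrow> ennreal"
  assumes [measurable]: "f \<in> borel_measurable borel"
  shows "(\<integral>\<^sup>+x. f (x + c) \<partial>lborel) = (\<integral>\<^sup>+x. f x \<partial>lborel)"
proof -
  have "(\<integral>\<^sup>+x. f x \<partial>lborel) = (\<integral>\<^sup>+x. f x \<partial>distr lborel borel ((+) c))"
    by (simp add: lborel_distr_plus)
  also have "\<dots> = (\<integral>\<^sup>+x. f (x + c) \<partial>lborel)"
    by (simp add: nn_integral_distr add.commute)
  finally show ?thesis ..
qed

lemma nn_integral_lborel_scale:
  fixes f :: "'a::euclidean_space \<Rightarrow> ennreal"
  assumes [measurable]: "f \<in> borel_measurable borel" and "c \<noteq> 0"
  shows "(\<integral>\<^sup>+x. f x \<partial>lborel) = ennreal (\<bar>c\<bar> ^ DIM('a)) * (\<integral>\<^sup>+x. f (c *\<^sub>R x) \<partial>lborel)"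
proof -
  have "(\<integral>\<^sup>+x. f x \<partial>lborel)
    = (\<integral>\<^sup>+x. f x \<partial>density (distr lborel borel (\<lambda>x. 0 + c *\<^sub>R x)) (\<lambda>_. \<bar>c\<bar>^DIM('a)))"
    using lborel_affine[OF assms(2), where t="0::'a"] by simp
  also have "\<dots> = ennreal (\<bar>c\<bar> ^ DIM('a)) * (\<integral>\<^sup>+x. f (c *\<^sub>R x) \<partial>lborel)"
    by (simp add: nn_integral_density nn_integral_distr nn_integral_cmult)
  finally show ?thesis .
qed

lemma nn_integral_lborel_uminus:
  fixes f :: "'a::euclidean_space \<Rightarrow> ennreal"
  assumes [measurable]: "f \<in> borel_measurable borel"
  shows "(\<integral>\<^sup>+x. f (- x) \<partial>lborel) = (\<integral>\<^sup>+x. f x \<partial>lborel)"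
  using nn_integral_lborel_scale[OF assms, of "-1"] by simp

lemma nn_integral_lborel_minus_left:
  fixes f :: "'a::euclidean_space \<Rightarrow> ennreal"
  assumes [measurable]: "f \<in> borel_measurable borel"
  shows "(\<integral>\<^sup>+x. f (c - x) \<partial>lborel) = (\<integral>\<^sup>+x. f x \<partial>lborel)"
  using nn_integral_lborel_translate[of "\<lambda>x. f (- x)" "- c"] nn_integral_lborel_uminus[OF assms]
  by simp

text \<open>Exchanging the order of integration in \<open>\<integral>\<integral> f (T x) * indicator B y\<close>, with translations in
  between, moves \<open>T\<close> from \<open>f\<close> to the indicator of the unit ball \<open>B\<close>, which \<open>T\<close> preserves.\<close>
lemma nn_integral_linear_isometry:
  fixes T :: "'a::euclidean_space \<Rightarrow> 'a"
  assumes T: "linear T" "\<And>x. norm (T x) = norm x"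
    and f[measurable]: "f \<in> borel_measurable borel"
  shows "(\<integral>\<^sup>+x. f (T x) \<partial>lborel) = (\<integral>\<^sup>+x. f x \<partial>lborel)"
proof -
  have [measurable]: "T \<in> borel_measurable borel"
    using T by (intro borel_measurable_continuous_onI linear_continuous_on)
      (simp add: linear_conv_bounded_linear)
  have "inj T"
    using T by (metis linear_injective_0 norm_eq_zero)
  then have "surj T"
    using T(1) linear_inj_imp_surj by blast
  define B :: "'a set" where "B = ball 0 1"
  have [measurable]: "B \<in> sets borel" by (simp add: B_def)
  have shift: "(\<integral>\<^sup>+x. f (T x - y) * indicator B (T x) \<partial>lborel)
             = (\<integral>\<^sup>+x. f (T x) * indicator B (T x + y) \<partial>lborel)" for y
  proof -
    obtain z where z: "T z = y" using \<open>surj T\<close> by (metis surjD)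
    show ?thesis
      using nn_integral_lborel_translate[of "\<lambda>x. f (T x - y) * indicator B (T x)" z] z
      by (simp add: linear_add[OF T(1)])
  qed
  have BT: "indicator B (T x) = (indicator B x :: ennreal)" for x
    by (simp add: B_def T indicator_def)
  have "(\<integral>\<^sup>+x. f (T x) \<partial>lborel) * emeasure lborel B
      = (\<integral>\<^sup>+x. f (T x) * emeasure lborel B \<partial>lborel)"
    by (simp add: nn_integral_multc)
  also have "\<dots> = (\<integral>\<^sup>+x. \<integral>\<^sup>+y. f (T x) * indicator B y \<partial>lborel \<partial>lborel)"
    by (simp add: nn_integral_cmult)
  also have "\<dots> = (\<integral>\<^sup>+x. \<integral>\<^sup>+y. f (T x) * indicator B (T x + y) \<partial>lborel \<partial>lborel)"
  proof (rule nn_integral_cong)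
    fix x
    show "(\<integral>\<^sup>+y. f (T x) * indicator B y \<partial>lborel) = (\<integral>\<^sup>+y. f (T x) * indicator B (T x + y) \<partial>lborel)"
      using nn_integral_lborel_translate[of "\<lambda>y. f (T x) * indicator B y" "T x"]
      by (simp add: add.commute)
  qed
  also have "\<dots> = (\<integral>\<^sup>+y. \<integral>\<^sup>+x. f (T x) * indicator B (T x + y) \<partial>lborel \<partial>lborel)"
    by (intro lborel_pair.Fubini') simp
  also have "\<dots> = (\<integral>\<^sup>+y. \<integral>\<^sup>+x. f (T x - y) * indicator B (T x) \<partial>lborel \<partial>lborel)"
    by (simp add: shift)
  also have "\<dots> = (\<integral>\<^sup>+x. \<integral>\<^sup>+y. f (T x - y) * indicator B (T x) \<partial>lborel \<partial>lborel)"
    by (intro lborel_pair.Fubini') simp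
  also have "\<dots> = (\<integral>\<^sup>+x. (\<integral>\<^sup>+y. f y \<partial>lborel) * indicator B x \<partial>lborel)"
    by (simp add: nn_integral_multc nn_integral_lborel_minus_left BT)
  also have "\<dots> = (\<integral>\<^sup>+y. f y \<partial>lborel) * emeasure lborel B"
    by (simp add: nn_integral_cmult)
  finally have eq: "(\<integral>\<^sup>+x. f (T x) \<partial>lborel) * emeasure lborel B = (\<integral>\<^sup>+y. f y \<partial>lborel) * emeasure lborel B" .
  \<comment> \<open>The ball has positive finite volume, so this factor can be cancelled from
    \<open>eq\<close> in \<open>ennreal\<close>.\<close>
  have "emeasure lborel B \<noteq> 0" "emeasure lborel B \<noteq> top"
    unfolding B_def using unit_ball_vol_pos[of "real DIM('a)"]
    by (auto simp: emeasure_ball less_top[symmetric] simp del: unit_ball_vol_pos)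
  with eq show ?thesis
    by (metis ennreal_mult_divide_eq ennreal_times_divide)
qed

text \<open>For distinct unit vectors, the reflection in the hyperplane orthogonal to
  \<open>u - e\<close> exchanges \<open>u\<close> and \<open>e\<close>.\<close>

lemma exists_linear_isometry:
  fixes u e :: "'a::euclidean_space"
  assumes "norm u = 1" "norm e = 1"
  obtains T where "linear T" "\<And>x. norm (T x) = norm x" "\<And>x y. T x \<bullet> T y = x \<bullet> y" "T u = e"
proof (cases "u = e")
  case True
  then show ?thesis
    using that[of "\<lambda>x. x"] by (simp add: linear_id[unfolded id_def])
next
  case False
  define n where "n = u - e"
  define T where "T x = x - (2 * (x \<bullet> n) / (n \<bullet> n)) *\<^sub>R n" for x
  have nn: "n \<bullet> n \<noteq> 0" using False by (simp add: n_def)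
  have lin: "linear T"
    unfolding T_def by (rule linearI) (auto simp: algebra_simps inner_simps add_divide_distrib)
  have inner: "T x \<bullet> T y = x \<bullet> y" for x y
    unfolding T_def using nn by (simp add: algebra_simps inner_simps inner_commute)
  have "norm (T x) = norm x" for x
    using inner[of x x] by (simp add: norm_eq_sqrt_inner)
  moreover have "T u = e"
  proof -
    have "u \<bullet> u = 1" "e \<bullet> e = 1" using assms by (simp_all add: norm_eq_1)
    then have "n \<bullet> n = 2 * (u \<bullet> n)"
      by (simp add: n_def inner_simps inner_commute)
    then show ?thesis using nn by (simp add: T_def n_def)
  qed
  ultimately show ?thesis using that lin inner by blast
qed

section \<open>The surface measure on the sphere\<close>

text \<open>\<^const>\<open>sphere_measure\<close> transported to the Borel sets of the whole space, so that functions on the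
  sphere need only be Borel measurable.\<close>
definition sph :: "'a::euclidean_space measure" where
  "sph = distr sphere_measure borel (\<lambda>x. x)"

lemma sets_sph[simp, measurable_cong]: "sets sph = sets borel"
  and space_sph[simp]: "space sph = UNIV"
  by (simp_all add: sph_def)

lemma space_sphere_measure: "space sphere_measure = sphere (0::'a::euclidean_space) 1"
  by (simp add: sphere_measure_def space_scale_measure space_restrict_space)

lemma measurable_ident_sphere:
  "(\<lambda>x::'a::euclidean_space. x) \<in> sphere_measure \<rightarrow>\<^sub>M borel"
proof -
  have "sets sphere_measure = sets (restrict_space borel (sphere (0::'a) 1))"
    by (simp add: sphere_measure_def)
  then show ?thesis
    by (subst measurable_cong_sets[OF _ refl]) (auto intro: measurable_restrict_space1)
qed

lemma nn_integral_sphere_measure: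
  fixes g :: "'a::euclidean_space \<Rightarrow> ennreal"
  assumes [measurable]: "g \<in> borel_measurable borel"
  shows "(\<integral>\<^sup>+x. g x \<partial>sphere_measure) = (\<integral>\<^sup>+x. g x \<partial>sph)"
  by (simp add: sph_def nn_integral_distr measurable_ident_sphere)

lemma AE_sph: "AE x in sph. norm (x::'a::euclidean_space) = 1"
  unfolding sph_def by (subst AE_distr_iff) (auto simp: space_sphere_measure measurable_ident_sphere)

text \<open>The origin, where \<open>x /\<^sub>R norm x\<close> has the default value 0, is a null
  set, so the punctured ball may be replaced by the full ball, which behaves well under scalings and
  linear isometries.\<close>

lemma nn_integral_sph:
  fixes g :: "'a::euclidean_space \<Rightarrow> ennreal"
  assumes [measurable]: "g \<in> borel_measurable borel"
  shows "(\<integral>\<^sup>+x. g x \<partial>sph) = of_nat DIM('a) * (\<integral>\<^sup>+x. g (x /\<^sub>R norm x) * indicator (ball 0 1) x \<partial>lborel)"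
proof -
  have m[measurable]: "(\<lambda>x. x /\<^sub>R norm x) \<in> restrict_space lborel (ball 0 1 - {0})
                        \<rightarrow>\<^sub>M restrict_space borel (sphere (0::'a) 1)"
    by (rule measurable_restrict_space2)
       (auto simp: space_restrict_space intro!: measurable_restrict_space1)
  have [measurable]: "g \<in> borel_measurable (restrict_space borel (sphere (0::'a) 1))"
    by (rule measurable_restrict_space1) simp
  have 0: "AE x in lborel. x \<noteq> (0::'a)" by (rule AE_lborel_singleton)
  have "(\<integral>\<^sup>+x. g x \<partial>sph) = (\<integral>\<^sup>+x. g x \<partial>sphere_measure)"
    by (simp add: nn_integral_sphere_measure)
  also have "\<dots> = of_nat DIM('a) * (\<integral>\<^sup>+x. g (x /\<^sub>R norm x) * indicator (ball 0 1 - {0}) x \<partial>lborel)"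
    unfolding sphere_measure_def
    by (simp add: nn_integral_scale_measure nn_integral_distr nn_integral_restrict_space)
  also have "(\<integral>\<^sup>+x. g (x /\<^sub>R norm x) * indicator (ball 0 1 - {0}) x \<partial>lborel)
      = (\<integral>\<^sup>+x. g (x /\<^sub>R norm x) * indicator (ball 0 1) x \<partial>lborel)"
    by (rule nn_integral_cong_AE, use 0 in eventually_elim) (simp add: indicator_def)
  finally show ?thesis .
qed

lemma emeasure_sph_finite: "emeasure (sph :: 'a::euclidean_space measure) UNIV < \<infinity>"
proof -
  have "emeasure sph (UNIV::'a set) = (\<integral>\<^sup>+x. (\<lambda>_::'a. 1) x \<partial>sph)" by simp
  also have "\<dots> < \<infinity>"
    by (subst nn_integral_sph) (auto simp: emeasure_ball ennreal_mult_less_top of_nat_less_top)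
  finally show ?thesis .
qed

lemma finite_measure_sph: "finite_measure (sph :: 'a::euclidean_space measure)"
  using emeasure_sph_finite by (intro finite_measureI) (simp add: less_top)

interpretation sph: finite_measure "sph :: 'a::euclidean_space measure"
  by (rule finite_measure_sph)

interpretation sph_sph: pair_sigma_finite "sph :: 'a::euclidean_space measure" "sph :: 'a::euclidean_space measure" ..

text \<open>A linear isometry commutes with the radial projection and preserves the unit ball, so
  the invariance is inherited from Lebesgue measure.\<close>

lemma nn_integral_sph_isometry:
  fixes T :: "'a::euclidean_space \<Rightarrow> 'a"
  assumes T: "linear T" "\<And>x. norm (T x) = norm x"
    and g[measurable]: "g \<in> borel_measurable borel"
  shows "(\<integral>\<^sup>+x. g (T x) \<partial>sph) = (\<integral>\<^sup>+x. g x \<partial>sph)"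
proof -
  have [measurable]: "T \<in> borel_measurable borel"
    using T by (intro borel_measurable_continuous_onI linear_continuous_on)
      (simp add: linear_conv_bounded_linear)
  have "(\<integral>\<^sup>+x. g (T (x /\<^sub>R norm x)) * indicator (ball 0 1) x \<partial>lborel)
      = (\<integral>\<^sup>+x. (\<lambda>x. g (x /\<^sub>R norm x) * indicator (ball 0 1) x) (T x) \<partial>lborel)"
    using T by (intro nn_integral_cong) (auto simp: linear_scale indicator_def)
  also have "\<dots> = (\<integral>\<^sup>+x. g (x /\<^sub>R norm x) * indicator (ball 0 1) x \<partial>lborel)"
    by (rule nn_integral_linear_isometry[OF T]) simp
  finally show ?thesis
    by (simp add: nn_integral_sph)
qed

text \<open>With \<open>d\<close> the dimension, the value \<open>1 / d\<close> cancels the factor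
  \<open>DIM('a)\<close> in the normalisation of \<open>sphere_measure\<close>.\<close>

lemma nn_integral_powr_tail:
  assumes "0 < (d::nat)"
  shows "(\<integral>\<^sup>+r. ennreal (inverse r ^ (d + 1)) * indicator {1<..} (r::real) \<partial>lborel) = ennreal (1 / d)"
proof -
  have "(\<integral>\<^sup>+r. ennreal (inverse r ^ (d + 1)) * indicator {1..} (r::real) \<partial>lborel)
      = ennreal (0 - (- (inverse 1 ^ d / real d)))"
  proof (rule nn_integral_FTC_atLeast)
    fix x :: real assume "1 \<le> x"
    then have "(inverse has_real_derivative - (inverse x * inverse x)) (at x)"
      by (auto intro!: derivative_eq_intros)
    from DERIV_minus[OF DERIV_cdivide[OF DERIV_power[OF this, of d], of "real d"]]
    show "((\<lambda>x. - (inverse x ^ d / real d)) has_real_derivative inverse x ^ (d + 1)) (at x)"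
    proof (rule DERIV_cong)
      have e: "inverse x ^ (d + 1) = inverse x * inverse x * inverse x ^ (d - Suc 0)"
        using assms by (cases d) auto
      show "- (real d * (- (inverse x * inverse x) * inverse x ^ (d - Suc 0)) / real d) = inverse x ^ (d + 1)"
        unfolding e using assms by simp
    qed
    show "0 \<le> inverse x ^ (d + 1)" using \<open>1 \<le> x\<close> by simp
  next
    have "((\<lambda>x::real. - (inverse x ^ d / real d)) \<longlongrightarrow> - (0 ^ d / real d)) at_top"
      by (intro tendsto_intros tendsto_inverse_0_at_top filterlim_ident) (use assms in auto)
    then show "((\<lambda>x::real. - (inverse x ^ d / real d)) \<longlongrightarrow> 0) at_top"
      using assms by (simp add: power_0_left)
  qed simp
  also have "(\<integral>\<^sup>+r. ennreal (inverse r ^ (d + 1)) * indicator {1..} (r::real) \<partial>lborel)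
    = (\<integral>\<^sup>+r. ennreal (inverse r ^ (d + 1)) * indicator {1<..} (r::real) \<partial>lborel)"
    using AE_lborel_singleton[of "1::real"]
    by (intro nn_integral_cong_AE) (auto simp: indicator_def)
  finally show ?thesis using assms by simp
qed

text \<open>The scaling \<open>r = \<lambda> \<bar>u\<bar>\<close> turns the right-hand side into
  the left-hand side times \<open>DIM('a)\<close> times the integral of \<open>\<lambda> powr (- 1 - DIM('a))\<close> over \<open>{1<..}\<close>.\<close>
lemma nn_integral_polar:
  fixes k :: "real \<Rightarrow> 'a::euclidean_space \<Rightarrow> ennreal"
  assumes [measurable]: "case_prod k \<in> borel_measurable (borel \<Otimes>\<^sub>M borel)"
  shows "(\<integral>\<^sup>+u. k (norm u) (u /\<^sub>R norm u) \<partial>lborel) =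
    (\<integral>\<^sup>+r. (\<integral>\<^sup>+\<sigma>. k r \<sigma> \<partial>sph) * (ennreal (r ^ (DIM('a) - 1)) * indicator {0<..} r) \<partial>lborel)"
proof -
  let ?d = "DIM('a)"
  define I where "I = (\<integral>\<^sup>+u. k (norm u) (u /\<^sub>R norm u) \<partial>lborel)"
  have d0: "0 < ?d" by simp
  have S: "?d = Suc (?d - 1)" using d0 by simp
  \<comment> \<open>Blowing the unit ball up to radius \<open>r\<close> costs
    \<open>inverse r ^ d\<close>; together with the Jacobian \<open>r ^ (d - 1)\<close> only
    \<open>inverse r\<close> remains.\<close>
  have "(\<integral>\<^sup>+r. (\<integral>\<^sup>+\<sigma>. k r \<sigma> \<partial>sph) * (ennreal (r ^ (?d - 1)) * indicator {0<..} r) \<partial>lborel)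
    = (\<integral>\<^sup>+r. of_nat ?d * (\<integral>\<^sup>+x. k r (x /\<^sub>R norm x) * indicator (ball 0 r) x * ennreal (inverse r) * indicator {0<..} r \<partial>lborel) \<partial>lborel)"
  proof (rule nn_integral_cong)
    fix r :: real
    show "(\<integral>\<^sup>+\<sigma>. k r \<sigma> \<partial>sph) * (ennreal (r ^ (?d - 1)) * indicator {0<..} r)
      = of_nat ?d * (\<integral>\<^sup>+x. k r (x /\<^sub>R norm x) * indicator (ball 0 r) x * ennreal (inverse r) * indicator {0<..} r \<partial>lborel)"
    proof (cases "0 < r")
      case False then show ?thesis by simp
    next
      case True
      have "(\<integral>\<^sup>+x. k r (x /\<^sub>R norm x) * indicator (ball 0 1) x \<partial>lborel)
        = ennreal (inverse r ^ ?d) * (\<integral>\<^sup>+x. k r (x /\<^sub>R norm x) * indicator (ball 0 r) x \<partial>lborel)"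
      proof -
        have "(\<integral>\<^sup>+x. k r ((inverse r *\<^sub>R x) /\<^sub>R norm (inverse r *\<^sub>R x)) * indicator (ball 0 1) (inverse r *\<^sub>R x) \<partial>lborel)
          = (\<integral>\<^sup>+x. k r (x /\<^sub>R norm x) * indicator (ball 0 r) x \<partial>lborel)"
          using True by (intro nn_integral_cong) (auto simp: indicator_def field_simps)
        then show ?thesis
          using True by (subst nn_integral_lborel_scale[where c="inverse r"]) auto
      qed
      moreover have p: "ennreal (inverse r ^ ?d) * ennreal (r ^ (?d - 1)) = ennreal (inverse r)"
      proof -
        have "inverse r ^ ?d * r ^ (?d - 1) = inverse r * (inverse r * r) ^ (?d - 1)"
          by (subst (1) S) (simp only: power_Suc power_mult_distrib mult.assoc)
        then show ?thesis using True by (simp add: ennreal_mult[symmetric])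
      qed
      moreover have "of_nat ?d * (ennreal (inverse r ^ ?d) * A) * ennreal (r ^ (?d - 1))
          = of_nat ?d * (A * ennreal (inverse r))" for A
        unfolding p[symmetric] by (simp only: mult_ac)
      ultimately show ?thesis using True
        by (simp add: nn_integral_sph nn_integral_multc)
    qed
  qed
  also have "\<dots> = of_nat ?d * (\<integral>\<^sup>+r. \<integral>\<^sup>+x. k r (x /\<^sub>R norm x) * indicator (ball 0 r) x * ennreal (inverse r) * indicator {0<..} r \<partial>lborel \<partial>lborel)"
    by (subst nn_integral_cmult) (auto simp: ball_def)
  also have "(\<integral>\<^sup>+r. \<integral>\<^sup>+x. k r (x /\<^sub>R norm x) * indicator (ball 0 r) x * ennreal (inverse r) * indicator {0<..} r \<partial>lborel \<partial>lborel)
     = (\<integral>\<^sup>+x. \<integral>\<^sup>+r. k r (x /\<^sub>R norm x) * indicator (ball 0 r) x * ennreal (inverse r) * indicator {0<..} r \<partial>lborel \<partial>lborel)"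
    by (intro lborel_pair.Fubini') (simp add: ball_def)
  \<comment> \<open>For fixed \<open>x\<close>, replace \<open>r\<close> by
    \<open>r * norm x\<close>. The weight \<open>inverse r\<close> is scale invariant, and the
    condition \<open>norm x < r\<close> becomes \<open>1 < r\<close>, independent of
    \<open>x\<close>.\<close>
  also have "\<dots> = (\<integral>\<^sup>+x. \<integral>\<^sup>+r. k (r * norm x) (x /\<^sub>R norm x) * (ennreal (inverse r) * indicator {1<..} r) \<partial>lborel \<partial>lborel)"
  proof (rule nn_integral_cong_AE)
    have inner: "(\<integral>\<^sup>+r. k r (x /\<^sub>R norm x) * indicator (ball 0 r) x * ennreal (inverse r) * indicator {0<..} r \<partial>lborel)
      = (\<integral>\<^sup>+r. k (r * norm x) (x /\<^sub>R norm x) * (ennreal (inverse r) * indicator {1<..} r) \<partial>lborel)"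
      if "x \<noteq> 0" for x
    proof -
      have eq: "ennreal (norm x) * (k (0 + norm x * r) (x /\<^sub>R norm x) * indicator (ball 0 (0 + norm x * r)) x * ennreal (inverse (0 + norm x * r)) * indicator {0<..} (0 + norm x * r))
        = k (r * norm x) (x /\<^sub>R norm x) * (ennreal (inverse r) * indicator {1<..} r)" for r
      proof (cases "1 < r")
        case True
        then have "ennreal (norm x) * ennreal (inverse (norm x * r)) = ennreal (inverse r)"
          using that by (simp add: ennreal_mult[symmetric])
        moreover have "0 < norm x * r" "norm x < norm x * r" using True that by auto
        moreover have "ennreal (norm x) * (A * ennreal (inverse (norm x * r)))
            = A * (ennreal (norm x) * ennreal (inverse (norm x * r)))" for A
          by (simp only: mult_ac)
        ultimately show ?thesis using True
          by (simp add: mult.commute[of r])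
      next
        case False
        then have "\<not> norm x < norm x * r" using that by auto
        then show ?thesis using False by simp
      qed
      show ?thesis
        apply (subst nn_integral_real_affine[where c="norm x" and t=0])
        subgoal by (simp add: ball_def)
        subgoal using that by simp
        apply (subst nn_integral_cmult[symmetric])
        subgoal by (simp add: ball_def)
        using eq by simp
    qed
    show "AE x in lborel. (\<integral>\<^sup>+r. k r (x /\<^sub>R norm x) * indicator (ball 0 r) x * ennreal (inverse r) * indicator {0<..} r \<partial>lborel)
      = (\<integral>\<^sup>+r. k (r * norm x) (x /\<^sub>R norm x) * (ennreal (inverse r) * indicator {1<..} r) \<partial>lborel)"
      using AE_lborel_singleton[of "0::'a"] by eventually_elim (rule inner)
  qed
  also have "\<dots> = (\<integral>\<^sup>+r. \<integral>\<^sup>+x. k (r * norm x) (x /\<^sub>R norm x) * (ennreal (inverse r) * indicator {1<..} r) \<partial>lborel \<partial>lborel)"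
    by (intro lborel_pair.Fubini') simp
  \<comment> \<open>Now \<open>x\<close> is rescaled by \<open>inverse r\<close>: the inner integral
    becomes \<open>I\<close>, and the extra \<open>inverse r ^ d\<close> completes the power needed
    in \<open>nn_integral_powr_tail\<close>.\<close>
  also have "\<dots> = (\<integral>\<^sup>+r. I * (ennreal (inverse r ^ (?d + 1)) * indicator {1<..} r) \<partial>lborel)"
  proof (rule nn_integral_cong)
    fix r :: real
    show "(\<integral>\<^sup>+x. k (r * norm x) (x /\<^sub>R norm x) * (ennreal (inverse r) * indicator {1<..} r) \<partial>lborel)
      = I * (ennreal (inverse r ^ (?d + 1)) * indicator {1<..} r)"
    proof (cases "1 < r")
      case True
      have "(\<integral>\<^sup>+x. k (r * norm x) (x /\<^sub>R norm x) \<partial>lborel)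
         = ennreal (inverse r ^ ?d) * (\<integral>\<^sup>+x. k (norm x) (x /\<^sub>R norm x) \<partial>lborel)"
      proof -
        have "(\<integral>\<^sup>+x. k (r * norm (inverse r *\<^sub>R x)) ((inverse r *\<^sub>R x) /\<^sub>R norm (inverse r *\<^sub>R x)) \<partial>lborel)
          = (\<integral>\<^sup>+x. k (norm x) (x /\<^sub>R norm x) \<partial>lborel)"
          using True by (intro nn_integral_cong) (auto simp: field_simps)
        then show ?thesis
          using True by (subst nn_integral_lborel_scale[where c="inverse r"]) auto
      qed
      moreover have "ennreal (inverse r ^ ?d) * ennreal (inverse r) = ennreal (inverse r ^ (?d + 1))"
        using True by (simp add: ennreal_mult[symmetric] mult.commute)
      moreover have "ennreal (inverse r ^ ?d) * A * ennreal (inverse r)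
          = A * (ennreal (inverse r ^ ?d) * ennreal (inverse r))" for A
        by (simp only: mult_ac)
      ultimately show ?thesis using True
        by (simp add: nn_integral_multc I_def)
    qed simp
  qed
  also have "\<dots> = I * ennreal (1 / ?d)"
    by (subst nn_integral_cmult) (use nn_integral_powr_tail[OF d0] in auto)
  also have "of_nat ?d * (I * ennreal (1 / ?d)) = I"
  proof -
    have "of_nat ?d * ennreal (1 / ?d) = 1"
      by (simp add: ennreal_of_nat_eq_real_of_nat ennreal_mult[symmetric])
    then show ?thesis by (metis mult.commute mult.left_commute mult_1)
  qed
  finally show ?thesis by (simp add: I_def)
qed

section \<open>Zonal functions on the sphere\<close>

lemma nn_integral_power_interval:
  assumes "0 \<le> (b::real)"
  shows "(\<integral>\<^sup>+r. ennreal (r ^ n) * indicator {0<..<b} r \<partial>lborel) = ennreal (b ^ Suc n / Suc n)"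
proof -
  have "(\<integral>\<^sup>+r. ennreal (r ^ n) * indicator {0..b} r \<partial>lborel)
      = ennreal (b ^ Suc n / Suc n - 0 ^ Suc n / Suc n)"
  proof (rule nn_integral_FTC_Icc)
    fix x :: real assume "x \<in> {0..b}"
    show "((\<lambda>x. x ^ Suc n / Suc n) has_real_derivative x ^ n) (at x)"
      using DERIV_cdivide[OF DERIV_power[OF DERIV_ident, of "Suc n"], of "real (Suc n)"]
      by (rule DERIV_cong) (simp del: of_nat_Suc)
    show "0 \<le> x ^ n" using \<open>x \<in> {0..b}\<close> by simp
  qed (use assms in auto)
  also have "b ^ Suc n / Suc n - 0 ^ Suc n / Suc n = b ^ Suc n / Suc n"
    by simp
  finally have "(\<integral>\<^sup>+r. ennreal (r ^ n) * indicator {0..b} r \<partial>lborel) = ennreal (b ^ Suc n / Suc n)" .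
  moreover have "(\<integral>\<^sup>+r. ennreal (r ^ n) * indicator {0<..<b} r \<partial>lborel)
      = (\<integral>\<^sup>+r. ennreal (r ^ n) * indicator {0..b} r \<partial>lborel)"
    by (rule nn_integral_cong_AE, use AE_lborel_singleton[of b] AE_lborel_singleton[of "0::real"] in eventually_elim)
       (auto simp: indicator_def)
  ultimately show ?thesis by metis
qed

text \<open>Both measures are determined by their values on the half-lines \<open>{..a}\<close>,
  which are ball volumes. A product over an index set is used because the orthogonal complement of a
  basis vector is not a type of its own.\<close>

lemma distr_norm_PiM:
  assumes "finite A" "A \<noteq> {}"
  shows "distr (Pi\<^sub>M A (\<lambda>_. lborel)) borel (\<lambda>y. sqrt (\<Sum>i\<in>A. (y i)\<^sup>2)) =
    density lborel (\<lambda>r. ennreal (unit_ball_vol (card A) * card A) * (ennreal (r ^ (card A - 1)) * indicator {0<..} r))"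
    (is "?M = ?N")
proof (rule measure_eqI_generator_eq[where E="range (\<lambda>a. {..a})" and \<Omega>=UNIV and A="\<lambda>n. {..real n}"])
  let ?n = "card A"
  have n: "0 < ?n" using assms by (simp add: card_gt_0_iff)
  have [measurable]: "(\<lambda>y. sqrt (\<Sum>i\<in>A. (y i)\<^sup>2)) \<in> borel_measurable (Pi\<^sub>M A (\<lambda>_. lborel))"
    by measurable
  have M: "emeasure ?M {..a} = ennreal (unit_ball_vol ?n * max 0 a ^ ?n)" for a
  proof -
    have pos: "emeasure ?M {..a} = ennreal (unit_ball_vol ?n * a ^ ?n)" if "0 < a" for a
      using that assms by (subst emeasure_distr) (auto simp: vimage_def emeasure_cball_aux)
    show ?thesis
    proof (cases "0 < a")
      case True with pos show ?thesis by simp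
    next
      case False
      \<comment> \<open>For \<open>a \<le> 0\<close> the half-line lies inside \<open>{..r}\<close>
        for every small positive \<open>r\<close>; the choice of \<open>r\<close> makes the volume
        at most \<open>e\<close>.\<close>
      have "emeasure ?M {..a} \<le> ennreal e" if "0 < e" for e
      proof -
        define v where "v = unit_ball_vol ?n"
        have v: "0 < v" by (simp add: v_def)
        define r where "r = min 1 (e / v)"
        have r: "0 < r" "r \<le> 1" using v that by (simp_all add: r_def)
        have "v * r \<le> v * (e / v)" using v by (intro mult_left_mono) (simp_all add: r_def)
        with v have "v * r \<le> e" by simp
        note r = r this
        have "emeasure ?M {..a} \<le> emeasure ?M {..r}"
          using False r by (intro emeasure_mono) auto
        also have "\<dots> = ennreal (v * r ^ ?n)" using pos[OF r(1)] by (simp add: v_def)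
        also have "\<dots> \<le> ennreal e"
        proof (rule ennreal_leI)
          have "r ^ ?n \<le> r ^ 1" using r n by (intro power_decreasing) auto
          then have "v * r ^ ?n \<le> v * r" using v by simp
          with r show "v * r ^ ?n \<le> e" by simp
        qed
        finally show ?thesis .
      qed
      then have "emeasure ?M {..a} \<le> 0"
        by - (rule ennreal_le_epsilon, simp only: add_0)
      then show ?thesis using False n by (simp add: max_def)
    qed
  qed
  have N: "emeasure ?N {..a} = ennreal (unit_ball_vol ?n * max 0 a ^ ?n)" for a
  proof -
    have "emeasure ?N {..a} = (\<integral>\<^sup>+r. ennreal (unit_ball_vol ?n * ?n) * (ennreal (r ^ (?n - 1)) * indicator {0<..<max 0 a} r) \<partial>lborel)"
      apply (subst emeasure_density)
      subgoal by simp
      subgoal by simp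
      by (rule nn_integral_cong_AE, use AE_lborel_singleton[of a] in eventually_elim) (auto simp: indicator_def)
    also have "\<dots> = ennreal (unit_ball_vol ?n * ?n) * ennreal (max 0 a ^ Suc (?n - 1) / Suc (?n - 1))"
      by (simp add: nn_integral_cmult nn_integral_power_interval)
    also have "\<dots> = ennreal (unit_ball_vol ?n * max 0 a ^ ?n)"
      using n by (simp add: ennreal_mult[symmetric])
    finally show ?thesis .
  qed
  show "emeasure ?M X = emeasure ?N X" if "X \<in> range (\<lambda>a. {..a})" for X
    using that M N by auto
  show "Int_stable (range (\<lambda>a::real. {..a}))"
    by (auto simp: Int_stable_def)
  show "sets ?M = sigma_sets UNIV (range (\<lambda>a. {..a}))" "sets ?N = sigma_sets UNIV (range (\<lambda>a. {..a}))"
    unfolding sets_distr sets_density sets_lborel by (subst borel_eq_atMost, simp)+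
  show "(\<Union>n. {..real n}) = UNIV"
    using real_arch_simple by auto
  show "emeasure ?M {..real i} \<noteq> \<infinity>" for i by (simp add: M)
qed auto

text \<open>The substitution is \<open>z = k / sqrt (1 + k^2)\<close>, which takes the slope of a
  ray to its cosine and has derivative \<open>(1 + k^2) powr (- 3 / 2)\<close>. It is carried out on
  compact intervals; monotone convergence extends it to the whole line.\<close>

lemma nn_integral_line_interval:
  fixes f :: "real \<Rightarrow> ennreal"
  assumes [measurable]: "f \<in> borel_measurable borel"
  shows "(\<integral>\<^sup>+k. f (k / sqrt (1 + k\<^sup>2)) * ennreal ((1 + k\<^sup>2) powr (- 3 / 2)) \<partial>lborel)
     = (\<integral>\<^sup>+z. f z * indicator {-1<..<1} z \<partial>lborel)"
proof -
  define g where "g k = k / sqrt (1 + k\<^sup>2)" for k :: real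
  define g' where "g' k = (1 + k\<^sup>2) powr (- 3 / 2)" for k :: real
  have pos: "0 < 1 + k\<^sup>2" for k :: real by (simp add: add_pos_nonneg)
  have g_powr: "g k = k * (1 + k\<^sup>2) powr (- 1 / 2)" for k
    using pos[of k] by (simp add: g_def powr_half_sqrt powr_minus_divide)
  have deriv: "(g has_real_derivative g' k) (at k)" for k
  proof -
    have "((\<lambda>k. k * (1 + k\<^sup>2) powr (- 1 / 2)) has_real_derivative
      (1 + k\<^sup>2) powr (- 1 / 2) + k * ((- 1 / 2) * (1 + k\<^sup>2) powr (- 1 / 2 - 1) * (2 * k))) (at k)"
      using pos[of k] by (auto intro!: derivative_eq_intros)
    moreover have "(1 + k\<^sup>2) powr (- 1 / 2) = (1 + k\<^sup>2) * g' k"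
      using pos[of k] powr_add[of "1 + k\<^sup>2" 1 "- 3 / 2"] by (simp add: g'_def)
    moreover have "(1 + k\<^sup>2) powr (- 1 / 2 - 1) = g' k" by (simp add: g'_def)
    ultimately have "((\<lambda>k. k * (1 + k\<^sup>2) powr (- 1 / 2)) has_real_derivative g' k) (at k)"
      by (simp add: algebra_simps power2_eq_square)
    moreover have "(\<lambda>k. k * (1 + k\<^sup>2) powr (- 1 / 2)) = g" by (rule ext) (rule g_powr[symmetric])
    ultimately show ?thesis by simp
  qed
  have g'pos: "0 < g' k" for k using pos[of k] by (simp add: g'_def)
  have cont: "continuous_on S g'" for S
    unfolding g'_def using pos by (intro continuous_intros) (auto simp: less_imp_neq[symmetric] order_less_imp_not_eq2)
  have [measurable]: "g \<in> borel_measurable borel" "g' \<in> borel_measurable borel"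
    unfolding g_def g'_def by measurable
  have strict: "g x < g y" if "x < y" for x y
    using DERIV_pos_imp_increasing[OF that] deriv g'pos by blast
  have bound: "- 1 < g k" "g k < 1" for k
  proof -
    have "\<bar>k\<bar> < sqrt (1 + k\<^sup>2)" by (rule real_less_rsqrt) simp
    then have "- sqrt (1 + k\<^sup>2) < k" "k < sqrt (1 + k\<^sup>2)" by linarith+
    then show "- 1 < g k" "g k < 1"
      using pos[of k] by (simp_all add: g_def pos_less_divide_eq pos_divide_less_eq)
  qed
  have onto: "g (z / sqrt (1 - z\<^sup>2)) = z" if "- 1 < z" "z < 1" for z
  proof -
    have z: "0 < 1 - z\<^sup>2" using that by (simp add: abs_square_less_1)
    have "1 + (z / sqrt (1 - z\<^sup>2))\<^sup>2 = 1 / (1 - z\<^sup>2)"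
      using z by (simp add: power_divide add_divide_eq_iff)
    then show ?thesis using z by (simp add: g_def real_sqrt_divide)
  qed
  have eq: "(\<integral>\<^sup>+z. f z * indicator {g (- real n)..g (real n)} z \<partial>lborel)
     = (\<integral>\<^sup>+k. f (g k) * g' k * indicator {- real n..real n} k \<partial>lborel)" if "0 < n" for n :: nat
    by (rule nn_integral_substitution_aux) (use deriv g'pos[THEN less_imp_le] cont that in auto)
  have "(\<lambda>n. \<integral>\<^sup>+z. f z * indicator {g (- real n)..g (real n)} z \<partial>lborel)
      \<longlonglongrightarrow> (\<integral>\<^sup>+z. f z * indicator {-1<..<1} z \<partial>lborel)"
  proof (rule nn_integral_LIMSEQ)
    show "incseq (\<lambda>n z. f z * indicator {g (- real n)..g (real n)} z)"
    proof (intro incseq_SucI le_funI mult_left_mono)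
      fix n z
      have "g (- real (Suc n)) < g (- real n)" "g (real n) < g (real (Suc n))"
        by (rule strict; simp)+
      then show "indicator {g (- real n)..g (real n)} z \<le> (indicator {g (- real (Suc n))..g (real (Suc n))} z :: ennreal)"
        by (intro indicator_leI) auto
    qed simp
    fix z
    show "(\<lambda>n. f z * indicator {g (- real n)..g (real n)} z) \<longlonglongrightarrow> f z * indicator {-1<..<1} z"
    proof (cases "- 1 < z \<and> z < 1")
      case True
      obtain m :: nat where m: "\<bar>z / sqrt (1 - z\<^sup>2)\<bar> < real m" using reals_Archimedean2 by blast
      have "\<forall>n\<ge>m. f z * indicator {g (- real n)..g (real n)} z = f z * indicator {-1<..<1} z"
      proof (intro allI impI)
        fix n assume "m \<le> n"
        with m have "- real n < z / sqrt (1 - z\<^sup>2)" "z / sqrt (1 - z\<^sup>2) < real n" by linarith+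
        from this[THEN strict] onto[of z] True show "f z * indicator {g (- real n)..g (real n)} z = f z * indicator {-1<..<1} z"
          by simp
      qed
      then show ?thesis by (intro tendsto_eventually) (auto simp: eventually_sequentially)
    next
      case False
      then have "indicator {g (- real n)..g (real n)} z = (0::ennreal)" for n
        using bound[of "real n"] bound[of "- real n"] by (auto simp: indicator_def)
      then show ?thesis using False by auto
    qed
  qed simp
  moreover have "(\<lambda>n. \<integral>\<^sup>+k. f (g k) * g' k * indicator {- real n..real n} k \<partial>lborel)
      \<longlonglongrightarrow> (\<integral>\<^sup>+k. f (g k) * g' k \<partial>lborel)"
  proof (rule nn_integral_LIMSEQ)
    show "incseq (\<lambda>n k. f (g k) * ennreal (g' k) * indicator {- real n..real n} k)"
      by (intro incseq_SucI le_funI mult_left_mono indicator_leI) auto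
    fix k
    obtain m :: nat where m: "\<bar>k\<bar> < real m" using reals_Archimedean2 by blast
    then have "\<forall>n\<ge>m. f (g k) * ennreal (g' k) * indicator {- real n..real n} k = f (g k) * g' k"
      by (auto simp: indicator_def)
    then show "(\<lambda>n. f (g k) * ennreal (g' k) * indicator {- real n..real n} k) \<longlonglongrightarrow> f (g k) * g' k"
      by (intro tendsto_eventually) (auto simp: eventually_sequentially)
  qed simp
  then have "(\<lambda>n. \<integral>\<^sup>+z. f z * indicator {g (- real n)..g (real n)} z \<partial>lborel)
      \<longlonglongrightarrow> (\<integral>\<^sup>+k. f (g k) * g' k \<partial>lborel)"
    by (rule Lim_transform_eventually) (use eq in \<open>auto simp: eventually_sequentially intro!: exI[of _ 1]\<close>)
  ultimately show ?thesis
    unfolding g_def g'_def using LIMSEQ_unique by blast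
qed

text \<open>A point of the ball is described by its coordinate \<open>z\<close> along
  \<open>e\<close> and the norm \<open>r\<close> of the remaining coordinates. The integrand depends
  only on the slope \<open>z / r\<close> and on the ball condition, so \<open>r\<close> can be
  integrated out explicitly.\<close>

lemma nn_integral_sph_Basis:
  fixes e :: "'a::euclidean_space" and g :: "real \<Rightarrow> ennreal"
  assumes e: "e \<in> Basis" and d: "2 \<le> DIM('a)" and [measurable]: "g \<in> borel_measurable borel"
  shows "(\<integral>\<^sup>+\<sigma>. g (e \<bullet> \<sigma>) \<partial>sph) =
    ennreal (unit_ball_vol (DIM('a) - 1) * (DIM('a) - 1)) *
     (\<integral>\<^sup>+z. g z * ennreal ((1 - z\<^sup>2) powr ((real DIM('a) - 3) / 2)) * indicator {-1<..<1} z \<partial>lborel)"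
proof -
  let ?d = "DIM('a)"
  define A where "A = (Basis :: 'a set) - {e}"
  have A: "finite A" "e \<notin> A" "insert e A = Basis" "card A = ?d - 1" "card A > 0"
    using e d by (auto simp: A_def)
  have A': "A \<noteq> {}" using A(5) by auto
  define H where "H z r = g (z / sqrt (z\<^sup>2 + r\<^sup>2)) * indicator {..<1} (z\<^sup>2 + r\<^sup>2)" for z r :: real
  have [measurable]: "case_prod H \<in> borel_measurable (borel \<Otimes>\<^sub>M borel)"
    unfolding H_def by measurable
  define c where "c = ennreal (unit_ball_vol (card A) * card A)"
  have ind[measurable]: "(\<lambda>x. indicator {0<..<1 / sqrt (1 + (fst x)\<^sup>2)} (snd x) :: ennreal) \<in> borel_measurable (borel \<Otimes>\<^sub>M borel)"
    unfolding indicator_def greaterThanLessThan_iff by measurable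
  have ind2[measurable]: "(\<lambda>x. indicator {0<..<1 / sqrt (1 + (snd x)\<^sup>2)} (fst x) :: ennreal) \<in> borel_measurable (borel \<Otimes>\<^sub>M borel)"
    unfolding indicator_def greaterThanLessThan_iff by measurable
  have ind3[measurable]: "(\<lambda>k. indicator {0<..<1 / sqrt (1 + k\<^sup>2)} r :: ennreal) \<in> borel_measurable borel" for r
    unfolding indicator_def greaterThanLessThan_iff by measurable
  interpret P: product_sigma_finite "\<lambda>_::'a. lborel :: real measure" ..
  have norm_eq: "norm (\<Sum>b\<in>Basis. f b *\<^sub>R b :: 'a) = sqrt ((f e)\<^sup>2 + (\<Sum>b\<in>A. (f b)\<^sup>2))" for f
  proof -
    have "norm (\<Sum>b\<in>Basis. f b *\<^sub>R b :: 'a) = sqrt (\<Sum>b\<in>Basis. (f b)\<^sup>2)"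
      using euclidean_dist_l2[of "0::'a" "\<Sum>b\<in>Basis. f b *\<^sub>R b"] by (simp add: L2_set_def)
    also have "(\<Sum>b\<in>Basis. (f b)\<^sup>2) = (f e)\<^sup>2 + (\<Sum>b\<in>A. (f b)\<^sup>2)"
      unfolding A(3)[symmetric] using A(1,2) by simp
    finally show ?thesis .
  qed
  have "(\<integral>\<^sup>+\<sigma>. g (e \<bullet> \<sigma>) \<partial>sph) = of_nat ?d * (\<integral>\<^sup>+x. g (e \<bullet> (x /\<^sub>R norm x)) * indicator (ball 0 1) x \<partial>lborel)"
    by (rule nn_integral_sph) simp
  also have "(\<integral>\<^sup>+x. g (e \<bullet> (x /\<^sub>R norm x)) * indicator (ball 0 1) x \<partial>lborel)
     = (\<integral>\<^sup>+f. H (f e) (sqrt (\<Sum>b\<in>A. (f b)\<^sup>2)) \<partial>(Pi\<^sub>M Basis (\<lambda>_. lborel)))"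
  proof -
    have *: "g (e \<bullet> ((\<Sum>b\<in>Basis. f b *\<^sub>R b) /\<^sub>R norm (\<Sum>b\<in>Basis. f b *\<^sub>R b))) * indicator (ball 0 1) (\<Sum>b\<in>Basis. f b *\<^sub>R b)
       = H (f e) (sqrt (\<Sum>b\<in>A. (f b)\<^sup>2))" for f
    proof -
      have "e \<bullet> (\<Sum>b\<in>Basis. f b *\<^sub>R b) = f e" using e by (simp add: inner_sum_right inner_Basis if_distrib sum.delta cong: if_cong)
      moreover have "0 \<le> (\<Sum>b\<in>A. (f b)\<^sup>2)" by (simp add: sum_nonneg)
      ultimately show ?thesis
        by (simp add: H_def norm_eq divide_inverse indicator_def mult.commute)
    qed
    have "(\<integral>\<^sup>+x. g (e \<bullet> (x /\<^sub>R norm x)) * indicator (ball 0 1) x \<partial>lborel)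
      = (\<integral>\<^sup>+x. g (e \<bullet> (x /\<^sub>R norm x)) * indicator (ball 0 1) x
          \<partial>distr (Pi\<^sub>M Basis (\<lambda>_. lborel)) borel (\<lambda>f. \<Sum>b\<in>Basis. f b *\<^sub>R b))"
      by (simp only: lborel_eq[symmetric])
    also have "\<dots> = (\<integral>\<^sup>+f. H (f e) (sqrt (\<Sum>b\<in>A. (f b)\<^sup>2)) \<partial>(Pi\<^sub>M Basis (\<lambda>_. lborel)))"
      by (subst nn_integral_distr) (measurable, simp only: *)
    finally show ?thesis .
  qed
  also have "\<dots> = (\<integral>\<^sup>+z. \<integral>\<^sup>+y. H z (sqrt (\<Sum>b\<in>A. (y b)\<^sup>2)) \<partial>Pi\<^sub>M A (\<lambda>_. lborel) \<partial>lborel)"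
  proof -
    have [measurable]: "(\<lambda>f. H (f e) (sqrt (\<Sum>b\<in>A. (f b)\<^sup>2))) \<in> borel_measurable (Pi\<^sub>M (insert e A) (\<lambda>_. lborel))"
      by measurable
    have "(\<Sum>b\<in>A. ((y(e := z)) b)\<^sup>2) = (\<Sum>b\<in>A. (y b)\<^sup>2)" for y and z :: real
      using A by (intro sum.cong) auto
    then show ?thesis
      unfolding A(3)[symmetric] using A(1,2) by (subst P.product_nn_integral_insert_rev) simp_all
  qed
  also have "\<dots> = (\<integral>\<^sup>+z. \<integral>\<^sup>+r. c * (H z r * (ennreal (r ^ (?d - 2)) * indicator {0<..} r)) \<partial>lborel \<partial>lborel)"
  proof (rule nn_integral_cong)
    fix z
    have "(\<integral>\<^sup>+y. H z (sqrt (\<Sum>b\<in>A. (y b)\<^sup>2)) \<partial>Pi\<^sub>M A (\<lambda>_. lborel))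
      = (\<integral>\<^sup>+r. H z r \<partial>distr (Pi\<^sub>M A (\<lambda>_. lborel)) borel (\<lambda>y. sqrt (\<Sum>i\<in>A. (y i)\<^sup>2)))"
      by (subst nn_integral_distr) simp_all
    also have "\<dots> = (\<integral>\<^sup>+r. c * (H z r * (ennreal (r ^ (?d - 2)) * indicator {0<..} r)) \<partial>lborel)"
      unfolding distr_norm_PiM[OF A(1) A'] using A(4) d
      by (subst nn_integral_density) (auto simp: c_def mult_ac numeral_2_eq_2 intro!: nn_integral_cong)
    finally show "(\<integral>\<^sup>+y. H z (sqrt (\<Sum>b\<in>A. (y b)\<^sup>2)) \<partial>Pi\<^sub>M A (\<lambda>_. lborel)) = \<dots>" .
  qed
  also have "\<dots> = (\<integral>\<^sup>+r. \<integral>\<^sup>+z. c * (H z r * (ennreal (r ^ (?d - 2)) * indicator {0<..} r)) \<partial>lborel \<partial>lborel)"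
    by (intro lborel_pair.Fubini') simp
  \<comment> \<open>With \<open>z = r * k\<close> the argument of \<open>g\<close> no longer
    contains \<open>r\<close>, and the unit ball becomes
    \<open>r < 1 / sqrt (1 + k^2)\<close>.\<close>
  also have "\<dots> = (\<integral>\<^sup>+r. \<integral>\<^sup>+k. c * (g (k / sqrt (1 + k\<^sup>2)) * (ennreal (r ^ (?d - 1)) * indicator {0<..<1 / sqrt (1 + k\<^sup>2)} r)) \<partial>lborel \<partial>lborel)"
  proof (rule nn_integral_cong)
    fix r :: real
    show "(\<integral>\<^sup>+z. c * (H z r * (ennreal (r ^ (?d - 2)) * indicator {0<..} r)) \<partial>lborel)
      = (\<integral>\<^sup>+k. c * (g (k / sqrt (1 + k\<^sup>2)) * (ennreal (r ^ (?d - 1)) * indicator {0<..<1 / sqrt (1 + k\<^sup>2)} r)) \<partial>lborel)"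
    proof (cases "0 < r")
      case False then show ?thesis by simp
    next
      case True
      have p: "ennreal r * ennreal (r ^ (?d - 2)) = ennreal (r ^ (?d - 1))"
      proof -
        have "r * r ^ (?d - 2) = r ^ (?d - 1)" using d power_Suc[of r "?d - 2"] by (simp add: Suc_diff_Suc numeral_2_eq_2 del: power_Suc)
        then show ?thesis using True by (simp add: ennreal_mult[symmetric])
      qed
      have "H (0 + r * k) r = g (k / sqrt (1 + k\<^sup>2)) * indicator {0<..<1 / sqrt (1 + k\<^sup>2)} r" for k
      proof -
        have k: "0 < 1 + k\<^sup>2" by (simp add: add_pos_nonneg)
        have "(r * k)\<^sup>2 + r\<^sup>2 = r\<^sup>2 * (1 + k\<^sup>2)" by (simp add: algebra_simps power_mult_distrib)
        moreover have "sqrt (r\<^sup>2 * (1 + k\<^sup>2)) = r * sqrt (1 + k\<^sup>2)" using True by (simp add: real_sqrt_mult)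
        moreover have "r\<^sup>2 * (1 + k\<^sup>2) < 1 \<longleftrightarrow> r < 1 / sqrt (1 + k\<^sup>2)"
        proof -
          have "r\<^sup>2 * (1 + k\<^sup>2) < 1 \<longleftrightarrow> sqrt (r\<^sup>2 * (1 + k\<^sup>2)) < sqrt 1" by (simp only: real_sqrt_less_iff)
          also have "\<dots> \<longleftrightarrow> r * sqrt (1 + k\<^sup>2) < 1" using True by (simp add: real_sqrt_mult)
          finally show ?thesis using k by (simp add: pos_less_divide_eq)
        qed
        ultimately show ?thesis using True by (simp add: H_def indicator_def)
      qed
      then have "(\<integral>\<^sup>+z. H z r \<partial>lborel) = ennreal r * (\<integral>\<^sup>+k. g (k / sqrt (1 + k\<^sup>2)) * indicator {0<..<1 / sqrt (1 + k\<^sup>2)} r \<partial>lborel)"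
        using True by (subst nn_integral_real_affine[where c=r and t=0]) auto
      note H = this
      have "(\<integral>\<^sup>+z. c * (H z r * (ennreal (r ^ (?d - 2)) * indicator {0<..} r)) \<partial>lborel)
          = c * ((\<integral>\<^sup>+z. H z r \<partial>lborel) * ennreal (r ^ (?d - 2)))"
        using True by (simp add: nn_integral_cmult nn_integral_multc)
      also have "\<dots> = c * ((\<integral>\<^sup>+k. g (k / sqrt (1 + k\<^sup>2)) * indicator {0<..<1 / sqrt (1 + k\<^sup>2)} r \<partial>lborel) * ennreal (r ^ (?d - 1)))"
        unfolding H p[symmetric] by (simp only: mult_ac)
      also have "\<dots> = (\<integral>\<^sup>+k. c * (g (k / sqrt (1 + k\<^sup>2)) * indicator {0<..<1 / sqrt (1 + k\<^sup>2)} r * ennreal (r ^ (?d - 1))) \<partial>lborel)"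
        by (simp add: nn_integral_cmult nn_integral_multc)
      finally show ?thesis by (simp only: mult_ac)
    qed
  qed
  also have "\<dots> = (\<integral>\<^sup>+k. \<integral>\<^sup>+r. c * (g (k / sqrt (1 + k\<^sup>2)) * (ennreal (r ^ (?d - 1)) * indicator {0<..<1 / sqrt (1 + k\<^sup>2)} r)) \<partial>lborel \<partial>lborel)"
    by (intro lborel_pair.Fubini') (simp add: case_prod_beta)
  also have "\<dots> = (\<integral>\<^sup>+k. c * ennreal (1 / ?d) * (g (k / sqrt (1 + k\<^sup>2)) * ennreal ((1 / sqrt (1 + k\<^sup>2)) ^ ?d)) \<partial>lborel)"
  proof (rule nn_integral_cong)
    fix k :: real
    define R where "R = 1 / sqrt (1 + k\<^sup>2)"
    have R: "0 \<le> R" by (simp add: R_def)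
    have "(\<integral>\<^sup>+r. c * (g (k / sqrt (1 + k\<^sup>2)) * (ennreal (r ^ (?d - 1)) * indicator {0<..<R} r)) \<partial>lborel)
      = c * (g (k / sqrt (1 + k\<^sup>2)) * ennreal (R ^ ?d / ?d))"
      using d R by (simp add: nn_integral_cmult nn_integral_power_interval Suc_diff_1)
    also have "ennreal (R ^ ?d / ?d) = ennreal (1 / ?d) * ennreal (R ^ ?d)"
      using R by (simp add: ennreal_mult[symmetric])
    finally show "(\<integral>\<^sup>+r. c * (g (k / sqrt (1 + k\<^sup>2)) * (ennreal (r ^ (?d - 1)) * indicator {0<..<1 / sqrt (1 + k\<^sup>2)} r)) \<partial>lborel)
      = c * ennreal (1 / ?d) * (g (k / sqrt (1 + k\<^sup>2)) * ennreal ((1 / sqrt (1 + k\<^sup>2)) ^ ?d))"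
      by (simp only: R_def mult_ac)
  qed
  also have "\<dots> = c * ennreal (1 / ?d) * (\<integral>\<^sup>+k. g (k / sqrt (1 + k\<^sup>2)) * ennreal ((1 / sqrt (1 + k\<^sup>2)) ^ ?d) \<partial>lborel)"
    by (rule nn_integral_cmult) simp
  also have "of_nat ?d * (c * ennreal (1 / ?d) * X) = c * X" for X
  proof -
    have "of_nat ?d * ennreal (1 / ?d) = 1"
      by (simp add: ennreal_of_nat_eq_real_of_nat ennreal_mult[symmetric])
    moreover have "of_nat ?d * (c * ennreal (1 / ?d) * X) = (of_nat ?d * ennreal (1 / ?d)) * (c * X)"
      by (simp only: mult_ac)
    ultimately show ?thesis by simp
  qed
  \<comment> \<open>For \<open>z = k / sqrt (1 + k^2)\<close> one has
    \<open>1 - z^2 = 1 / (1 + k^2)\<close>. Splitting off the derivative of the substitution from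
    the exponent \<open>- d / 2\<close> leaves \<open>- (d - 3) / 2\<close>, the source of the zonal
    weight.\<close>
  also have "(\<integral>\<^sup>+k. g (k / sqrt (1 + k\<^sup>2)) * ennreal ((1 / sqrt (1 + k\<^sup>2)) ^ ?d) \<partial>lborel)
     = (\<integral>\<^sup>+k. (\<lambda>z. g z * ennreal ((1 - z\<^sup>2) powr ((real ?d - 3) / 2))) (k / sqrt (1 + k\<^sup>2)) * ennreal ((1 + k\<^sup>2) powr (- 3 / 2)) \<partial>lborel)"
  proof (rule nn_integral_cong)
    fix k :: real
    have k: "0 < 1 + k\<^sup>2" by (simp add: add_pos_nonneg)
    have "1 - (k / sqrt (1 + k\<^sup>2))\<^sup>2 = (1 + k\<^sup>2) powr (- 1)"
      using k by (simp add: power_divide powr_minus field_simps)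
    then have "(1 - (k / sqrt (1 + k\<^sup>2))\<^sup>2) powr ((real ?d - 3) / 2) * (1 + k\<^sup>2) powr (- 3 / 2)
       = (1 + k\<^sup>2) powr (- 1 * ((real ?d - 3) / 2) + - 3 / 2)"
      by (simp only: powr_powr powr_add)
    also have "- 1 * ((real ?d - 3) / 2) + - 3 / 2 = (- 1 / 2) * real ?d" by (simp add: field_simps)
    also have "(1 + k\<^sup>2) powr ((- 1 / 2) * real ?d) = ((1 + k\<^sup>2) powr (- 1 / 2)) ^ ?d"
      using k by (subst powr_powr[symmetric], subst powr_realpow) auto
    also have "(1 + k\<^sup>2) powr (- 1 / 2) = 1 / sqrt (1 + k\<^sup>2)"
      using k by (simp add: powr_half_sqrt powr_minus_divide)
    finally have "ennreal ((1 / sqrt (1 + k\<^sup>2)) ^ ?d) = ennreal ((1 - (k / sqrt (1 + k\<^sup>2))\<^sup>2) powr ((real ?d - 3) / 2)) * ennreal ((1 + k\<^sup>2) powr (- 3 / 2))"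
      by (simp add: ennreal_mult[symmetric])
    then show "g (k / sqrt (1 + k\<^sup>2)) * ennreal ((1 / sqrt (1 + k\<^sup>2)) ^ ?d)
      = g (k / sqrt (1 + k\<^sup>2)) * ennreal ((1 - (k / sqrt (1 + k\<^sup>2))\<^sup>2) powr ((real ?d - 3) / 2)) * ennreal ((1 + k\<^sup>2) powr (- 3 / 2))"
      by (simp only: mult.assoc)
  qed
  also have "\<dots> = (\<integral>\<^sup>+z. g z * ennreal ((1 - z\<^sup>2) powr ((real ?d - 3) / 2)) * indicator {-1<..<1} z \<partial>lborel)"
    by (rule nn_integral_line_interval) simp
  finally show ?thesis
    using A(4) d by (simp add: c_def of_nat_diff)
qed

lemma nn_integral_sph_inner:
  fixes u :: "'a::euclidean_space" and g :: "real \<Rightarrow> ennreal"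
  assumes u: "norm u = 1" and d: "2 \<le> DIM('a)" and [measurable]: "g \<in> borel_measurable borel"
  shows "(\<integral>\<^sup>+\<sigma>. g (u \<bullet> \<sigma>) \<partial>sph) =
    ennreal (unit_ball_vol (DIM('a) - 1) * (DIM('a) - 1)) *
     (\<integral>\<^sup>+z. g z * ennreal ((1 - z\<^sup>2) powr ((real DIM('a) - 3) / 2)) * indicator {-1<..<1} z \<partial>lborel)"
proof -
  obtain e :: 'a where e: "e \<in> Basis" using nonempty_Basis by blast
  obtain T where T: "linear T" "\<And>x. norm (T x) = norm x" "\<And>x y. T x \<bullet> T y = x \<bullet> y" "T u = e"
    using exists_linear_isometry[OF u norm_Basis[OF e]] by blast
  have "(\<integral>\<^sup>+\<sigma>. g (u \<bullet> \<sigma>) \<partial>sph) = (\<integral>\<^sup>+\<sigma>. g (e \<bullet> T \<sigma>) \<partial>sph)"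
    using T(3)[of u] by (simp add: T(4))
  also have "\<dots> = (\<integral>\<^sup>+\<sigma>. g (e \<bullet> \<sigma>) \<partial>sph)"
    by (rule nn_integral_sph_isometry[OF T(1,2), of "\<lambda>\<sigma>. g (e \<bullet> \<sigma>)"]) simp
  finally show ?thesis using nn_integral_sph_Basis[OF e d assms(3)] by simp
qed

section \<open>The collision change of variables\<close>

text \<open>Two successive translations, each with the other variable frozen, so the Jacobian 1
  comes without a determinant.\<close>

lemma nn_integral_center_of_mass:
  fixes g :: "'a::euclidean_space \<Rightarrow> 'a \<Rightarrow> ennreal"
  assumes [measurable]: "case_prod g \<in> borel_measurable (borel \<Otimes>\<^sub>M borel)"
  shows "(\<integral>\<^sup>+v. \<integral>\<^sup>+w. g v w \<partial>lborel \<partial>lborel) = (\<integral>\<^sup>+c. \<integral>\<^sup>+u. g (c + u /\<^sub>R 2) (c - u /\<^sub>R 2) \<partial>lborel \<partial>lborel)"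
proof -
  have "(\<integral>\<^sup>+v. \<integral>\<^sup>+w. g v w \<partial>lborel \<partial>lborel) = (\<integral>\<^sup>+w. \<integral>\<^sup>+v. g v w \<partial>lborel \<partial>lborel)"
    by (intro lborel_pair.Fubini') simp
  also have "\<dots> = (\<integral>\<^sup>+w. \<integral>\<^sup>+u. g (u + w) w \<partial>lborel \<partial>lborel)"
  proof (rule nn_integral_cong)
    fix w show "(\<integral>\<^sup>+v. g v w \<partial>lborel) = (\<integral>\<^sup>+u. g (u + w) w \<partial>lborel)"
      using nn_integral_lborel_translate[of "\<lambda>v. g v w" w] by simp
  qed
  also have "\<dots> = (\<integral>\<^sup>+u. \<integral>\<^sup>+w. g (u + w) w \<partial>lborel \<partial>lborel)"
    by (intro lborel_pair.Fubini') simp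
  also have "\<dots> = (\<integral>\<^sup>+u. \<integral>\<^sup>+c. g (c + u /\<^sub>R 2) (c - u /\<^sub>R 2) \<partial>lborel \<partial>lborel)"
  proof (rule nn_integral_cong)
    fix u :: 'a
    have "u + (x + - (u /\<^sub>R 2)) = x + u /\<^sub>R 2" for x
      using scaleR_half_double[of u] by (simp add: algebra_simps)
    note e = this
    have "(\<integral>\<^sup>+x. g (u + (x + - (u /\<^sub>R 2))) (x + - (u /\<^sub>R 2)) \<partial>lborel) = (\<integral>\<^sup>+w. g (u + w) w \<partial>lborel)"
      by (rule nn_integral_lborel_translate) measurable
    then show "(\<integral>\<^sup>+w. g (u + w) w \<partial>lborel) = (\<integral>\<^sup>+c. g (c + u /\<^sub>R 2) (c - u /\<^sub>R 2) \<partial>lborel)"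
      unfolding e diff_conv_add_uminus by (rule sym)
  qed
  also have "\<dots> = (\<integral>\<^sup>+c. \<integral>\<^sup>+u. g (c + u /\<^sub>R 2) (c - u /\<^sub>R 2) \<partial>lborel \<partial>lborel)"
    by (intro lborel_pair.Fubini') simp
  finally show ?thesis .
qed

text \<open>Used as a measurability rule for integrands depending on the two velocities before and
  the two after a collision.\<close>

lemma measurable_compose4:
  assumes H: "(\<lambda>(x, y, z, w). H x y z w) \<in> N1 \<Otimes>\<^sub>M N2 \<Otimes>\<^sub>M N3 \<Otimes>\<^sub>M N4 \<rightarrow>\<^sub>M N"
    and [measurable]: "f1 \<in> M \<rightarrow>\<^sub>M N1" "f2 \<in> M \<rightarrow>\<^sub>M N2" "f3 \<in> M \<rightarrow>\<^sub>M N3" "f4 \<in> M \<rightarrow>\<^sub>M N4"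
  shows "(\<lambda>x. H (f1 x) (f2 x) (f3 x) (f4 x)) \<in> M \<rightarrow>\<^sub>M N"
proof -
  have "(\<lambda>x. (f1 x, f2 x, f3 x, f4 x)) \<in> M \<rightarrow>\<^sub>M N1 \<Otimes>\<^sub>M N2 \<Otimes>\<^sub>M N3 \<Otimes>\<^sub>M N4" by measurable
  from measurable_compose[OF this H] show ?thesis by simp
qed

definition kern :: "real \<Rightarrow> (real \<Rightarrow> ennreal) \<Rightarrow> 'a::euclidean_space \<Rightarrow> 'a \<Rightarrow> 'a \<Rightarrow> ennreal" where
  "kern \<beta> k v w \<sigma> = ennreal (norm (v - w) powr \<beta>) * k (cos_theta v w \<sigma>)"

lemma measurable_post[measurable (raw)]:
  fixes f g h :: "'b \<Rightarrow> 'a::euclidean_space"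
  assumes [measurable]: "f \<in> borel_measurable M" "g \<in> borel_measurable M" "h \<in> borel_measurable M"
  shows "(\<lambda>x. post_v (f x) (g x) (h x)) \<in> borel_measurable M"
    "(\<lambda>x. post_v_star (f x) (g x) (h x)) \<in> borel_measurable M"
    "(\<lambda>x. cos_theta (f x) (g x) (h x)) \<in> borel_measurable M"
  unfolding post_v_def post_v_star_def cos_theta_def by measurable

lemma measurable_kern[measurable (raw)]:
  fixes f g h :: "'b \<Rightarrow> 'a::euclidean_space"
  assumes [measurable]: "k \<in> borel_measurable borel" "f \<in> borel_measurable M" "g \<in> borel_measurable M" "h \<in> borel_measurable M"
  shows "(\<lambda>x. kern \<beta> k (f x) (g x) (h x)) \<in> borel_measurable M"
  unfolding kern_def by measurable

text \<open>In the variables \<open>c = (v + w) / 2\<close>, \<open>r = norm (v - w)\<close>, \<open>\<omega> = (v - w) / r\<close>, \<open>\<sigma>\<close>, a collision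
  exchanges \<open>\<omega>\<close> and \<open>\<sigma>\<close>.\<close>
lemma nn_integral_collision:
  fixes H :: "'a::euclidean_space \<Rightarrow> 'a \<Rightarrow> 'a \<Rightarrow> 'a \<Rightarrow> ennreal"
  assumes [measurable]: "k \<in> borel_measurable borel"
    and H: "(\<lambda>(x, y, z, w). H x y z w) \<in> borel_measurable (borel \<Otimes>\<^sub>M borel \<Otimes>\<^sub>M borel \<Otimes>\<^sub>M borel)"
  shows "(\<integral>\<^sup>+v. \<integral>\<^sup>+w. \<integral>\<^sup>+\<sigma>. kern \<beta> k v w \<sigma> * H v w (post_v v w \<sigma>) (post_v_star v w \<sigma>) \<partial>sph \<partial>lborel \<partial>lborel)
    = (\<integral>\<^sup>+v. \<integral>\<^sup>+w. \<integral>\<^sup>+\<sigma>. kern \<beta> k v w \<sigma> * H (post_v v w \<sigma>) (post_v_star v w \<sigma>) v w \<partial>sph \<partial>lborel \<partial>lborel)"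
proof -
  note measurable_compose4[OF H, measurable (raw)]
  define \<Phi> where "\<Phi> c r \<omega> \<sigma> = ennreal (r powr \<beta>) * k (\<omega> \<bullet> \<sigma>) *
    H (c + (r / 2) *\<^sub>R \<omega>) (c - (r / 2) *\<^sub>R \<omega>) (c + (r / 2) *\<^sub>R \<sigma>) (c - (r / 2) *\<^sub>R \<sigma>)" for c r \<omega> \<sigma>
  define W where "W r = ennreal (r ^ (DIM('a) - 1)) * indicator {0<..} r" for r :: real
  have Phi[measurable (raw)]: "(\<lambda>x. \<Phi> (f1 x) (f2 x) (f3 x) (f4 x)) \<in> borel_measurable M"
    if [measurable]: "f1 \<in> borel_measurable M" "f2 \<in> borel_measurable M" "f3 \<in> borel_measurable M" "f4 \<in> borel_measurable M"
    for f1 f2 f3 f4 and M :: "'x measure"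
    unfolding \<Phi>_def by measurable
  have vals: "kern \<beta> k (c + u /\<^sub>R 2) (c - u /\<^sub>R 2) \<sigma> = ennreal (norm u powr \<beta>) * k ((u /\<^sub>R norm u) \<bullet> \<sigma>)"
    "post_v (c + u /\<^sub>R 2) (c - u /\<^sub>R 2) \<sigma> = c + (norm u / 2) *\<^sub>R \<sigma>"
    "post_v_star (c + u /\<^sub>R 2) (c - u /\<^sub>R 2) \<sigma> = c - (norm u / 2) *\<^sub>R \<sigma>"
    "c + u /\<^sub>R 2 = c + (norm u / 2) *\<^sub>R (u /\<^sub>R norm u)"
    "c - u /\<^sub>R 2 = c - (norm u / 2) *\<^sub>R (u /\<^sub>R norm u)" for c u \<sigma> :: 'a
  proof -
    have d: "(c + u /\<^sub>R 2) - (c - u /\<^sub>R 2) = u"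
    proof -
      have "(c + h) - (c - h) = h + h" for h by simp
      then have "(c + u /\<^sub>R 2) - (c - u /\<^sub>R 2) = (inverse 2 + inverse 2) *\<^sub>R u"
        by (simp only: scaleR_left_distrib)
      then show ?thesis by simp
    qed
    have s: "((c + u /\<^sub>R 2) + (c - u /\<^sub>R 2)) /\<^sub>R 2 = c"
    proof -
      have "(c + h) + (c - h) = c + c" for h by simp
      then show ?thesis using scaleR_half_double[of c] by (simp only: inverse_eq_divide)
    qed
    show "kern \<beta> k (c + u /\<^sub>R 2) (c - u /\<^sub>R 2) \<sigma> = ennreal (norm u powr \<beta>) * k ((u /\<^sub>R norm u) \<bullet> \<sigma>)"
      unfolding kern_def cos_theta_def d ..
    show "post_v (c + u /\<^sub>R 2) (c - u /\<^sub>R 2) \<sigma> = c + (norm u / 2) *\<^sub>R \<sigma>"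
      "post_v_star (c + u /\<^sub>R 2) (c - u /\<^sub>R 2) \<sigma> = c - (norm u / 2) *\<^sub>R \<sigma>"
      unfolding post_v_def post_v_star_def d s by (rule refl)+
    have "(norm u / 2) *\<^sub>R (u /\<^sub>R norm u) = u /\<^sub>R 2" by (cases "u = 0") simp_all
    then show "c + u /\<^sub>R 2 = c + (norm u / 2) *\<^sub>R (u /\<^sub>R norm u)"
      "c - u /\<^sub>R 2 = c - (norm u / 2) *\<^sub>R (u /\<^sub>R norm u)" by simp_all
  qed
  \<comment> \<open>Stated for a general integrand, because it is applied twice: forwards to the
    left-hand side and backwards to the right-hand side with the two directions exchanged.\<close>
  have polar: "(\<integral>\<^sup>+v. \<integral>\<^sup>+w. \<integral>\<^sup>+\<sigma>. G v w \<sigma> \<partial>sph \<partial>lborel \<partial>lborel)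
     = (\<integral>\<^sup>+c. \<integral>\<^sup>+r. (\<integral>\<^sup>+\<omega>. \<integral>\<^sup>+\<sigma>. \<Psi> c r \<omega> \<sigma> \<partial>sph \<partial>sph) * W r \<partial>lborel \<partial>lborel)"
    if [measurable]: "(\<lambda>x. G (fst (fst x)) (snd (fst x)) (snd x)) \<in> borel_measurable ((borel \<Otimes>\<^sub>M borel) \<Otimes>\<^sub>M borel)"
      and G: "\<And>c u \<sigma>. G (c + u /\<^sub>R 2) (c - u /\<^sub>R 2) \<sigma> = \<Psi> c (norm u) (u /\<^sub>R norm u) \<sigma>"
      and \<Psi>: "\<And>c. (\<lambda>x. \<Psi> c (fst (fst x)) (snd (fst x)) (snd x)) \<in> borel_measurable ((borel \<Otimes>\<^sub>M borel) \<Otimes>\<^sub>M borel)"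
    for G :: "'a \<Rightarrow> 'a \<Rightarrow> 'a \<Rightarrow> ennreal" and \<Psi> :: "'a \<Rightarrow> real \<Rightarrow> 'a \<Rightarrow> 'a \<Rightarrow> ennreal"
  proof -
    have [measurable]: "(\<lambda>(v, w). \<integral>\<^sup>+\<sigma>. G v w \<sigma> \<partial>sph) \<in> borel_measurable (borel \<Otimes>\<^sub>M borel)"
      by (simp add: case_prod_beta)
    note [measurable] = \<Psi>
    have [measurable]: "(\<lambda>(r, \<omega>). \<integral>\<^sup>+\<sigma>. \<Psi> c r \<omega> \<sigma> \<partial>sph) \<in> borel_measurable (borel \<Otimes>\<^sub>M borel)" for c
      by (simp add: case_prod_beta)
    have "(\<integral>\<^sup>+v. \<integral>\<^sup>+w. \<integral>\<^sup>+\<sigma>. G v w \<sigma> \<partial>sph \<partial>lborel \<partial>lborel)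
       = (\<integral>\<^sup>+c. \<integral>\<^sup>+u. \<integral>\<^sup>+\<sigma>. G (c + u /\<^sub>R 2) (c - u /\<^sub>R 2) \<sigma> \<partial>sph \<partial>lborel \<partial>lborel)"
      by (rule nn_integral_center_of_mass) measurable
    also have "\<dots> = (\<integral>\<^sup>+c. \<integral>\<^sup>+u. (\<lambda>r \<omega>. \<integral>\<^sup>+\<sigma>. \<Psi> c r \<omega> \<sigma> \<partial>sph) (norm u) (u /\<^sub>R norm u) \<partial>lborel \<partial>lborel)"
      unfolding G ..
    also have "\<dots> = (\<integral>\<^sup>+c. \<integral>\<^sup>+r. (\<integral>\<^sup>+\<omega>. \<integral>\<^sup>+\<sigma>. \<Psi> c r \<omega> \<sigma> \<partial>sph \<partial>sph) * W r \<partial>lborel \<partial>lborel)"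
      unfolding W_def by (rule nn_integral_cong, rule nn_integral_polar) measurable
    finally show ?thesis .
  qed
  have "(\<integral>\<^sup>+v. \<integral>\<^sup>+w. \<integral>\<^sup>+\<sigma>. kern \<beta> k v w \<sigma> * H v w (post_v v w \<sigma>) (post_v_star v w \<sigma>) \<partial>sph \<partial>lborel \<partial>lborel)
    = (\<integral>\<^sup>+c. \<integral>\<^sup>+r. (\<integral>\<^sup>+\<omega>. \<integral>\<^sup>+\<sigma>. \<Phi> c r \<omega> \<sigma> \<partial>sph \<partial>sph) * W r \<partial>lborel \<partial>lborel)"
  proof (rule polar)
    fix c u \<sigma> :: 'a
    show "kern \<beta> k (c + u /\<^sub>R 2) (c - u /\<^sub>R 2) \<sigma> * H (c + u /\<^sub>R 2) (c - u /\<^sub>R 2) (post_v (c + u /\<^sub>R 2) (c - u /\<^sub>R 2) \<sigma>)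
          (post_v_star (c + u /\<^sub>R 2) (c - u /\<^sub>R 2) \<sigma>) = \<Phi> c (norm u) (u /\<^sub>R norm u) \<sigma>"
      unfolding vals(1-3) unfolding vals(4,5) \<Phi>_def by (simp only: mult.assoc)
  qed measurable
  also have "\<dots> = (\<integral>\<^sup>+c. \<integral>\<^sup>+r. (\<integral>\<^sup>+\<omega>. \<integral>\<^sup>+\<sigma>. \<Phi> c r \<sigma> \<omega> \<partial>sph \<partial>sph) * W r \<partial>lborel \<partial>lborel)"
    by (intro nn_integral_cong arg_cong2[where f="(*)"] sph_sph.Fubini' refl) measurable
  also have "\<dots> = (\<integral>\<^sup>+v. \<integral>\<^sup>+w. \<integral>\<^sup>+\<sigma>. kern \<beta> k v w \<sigma> * H (post_v v w \<sigma>) (post_v_star v w \<sigma>) v w \<partial>sph \<partial>lborel \<partial>lborel)"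
  proof (rule polar[symmetric])
    fix c u \<sigma> :: 'a
    show "kern \<beta> k (c + u /\<^sub>R 2) (c - u /\<^sub>R 2) \<sigma> * H (post_v (c + u /\<^sub>R 2) (c - u /\<^sub>R 2) \<sigma>)
          (post_v_star (c + u /\<^sub>R 2) (c - u /\<^sub>R 2) \<sigma>) (c + u /\<^sub>R 2) (c - u /\<^sub>R 2)= \<Phi> c (norm u) \<sigma> (u /\<^sub>R norm u)"
      unfolding vals(1-3) unfolding vals(4,5) \<Phi>_def inner_commute[of \<sigma>] by (simp only: mult.assoc)
  qed measurable
  finally show ?thesis .
qed

text \<open>Exchanging the two particles together with \<open>\<sigma>\<close> and
  \<open>- \<sigma>\<close> leaves the deflection cosine unchanged and makes the post-collisional
  velocities trade places.\<close>

lemma nn_integral_collision_swap: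
  fixes H :: "'a::euclidean_space \<Rightarrow> 'a \<Rightarrow> 'a \<Rightarrow> 'a \<Rightarrow> ennreal"
  assumes [measurable]: "k \<in> borel_measurable borel"
    and H: "(\<lambda>(x, y, z, w). H x y z w) \<in> borel_measurable (borel \<Otimes>\<^sub>M borel \<Otimes>\<^sub>M borel \<Otimes>\<^sub>M borel)"
  shows "(\<integral>\<^sup>+v. \<integral>\<^sup>+w. \<integral>\<^sup>+\<sigma>. kern \<beta> k v w \<sigma> * H v w (post_v v w \<sigma>) (post_v_star v w \<sigma>) \<partial>sph \<partial>lborel \<partial>lborel)
    = (\<integral>\<^sup>+v. \<integral>\<^sup>+w. \<integral>\<^sup>+\<sigma>. kern \<beta> k v w \<sigma> * H w v (post_v_star v w \<sigma>) (post_v v w \<sigma>) \<partial>sph \<partial>lborel \<partial>lborel)"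
proof -
  note measurable_compose4[OF H, measurable (raw)]
  let ?G = "\<lambda>v w \<sigma>. kern \<beta> k v w \<sigma> * H v w (post_v v w \<sigma>) (post_v_star v w \<sigma>)"
  have "(\<integral>\<^sup>+v. \<integral>\<^sup>+w. \<integral>\<^sup>+\<sigma>. ?G v w \<sigma> \<partial>sph \<partial>lborel \<partial>lborel) = (\<integral>\<^sup>+v. \<integral>\<^sup>+w. \<integral>\<^sup>+\<sigma>. ?G w v \<sigma> \<partial>sph \<partial>lborel \<partial>lborel)"
    by (rule lborel_pair.Fubini') measurable
  also have "\<dots> = (\<integral>\<^sup>+v. \<integral>\<^sup>+w. \<integral>\<^sup>+\<sigma>. ?G w v (- \<sigma>) \<partial>sph \<partial>lborel \<partial>lborel)"
    by (intro nn_integral_cong nn_integral_sph_isometry[symmetric, where T=uminus])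
      (auto simp: linear_uminus)
  also have "\<dots> = (\<integral>\<^sup>+v. \<integral>\<^sup>+w. \<integral>\<^sup>+\<sigma>. kern \<beta> k v w \<sigma> * H w v (post_v_star v w \<sigma>) (post_v v w \<sigma>) \<partial>sph \<partial>lborel \<partial>lborel)"
  proof -
    have "cos_theta w v (- \<sigma>) = cos_theta v w \<sigma>" for v w \<sigma> :: 'a
      unfolding cos_theta_def norm_minus_commute[of w v] by (simp add: inner_diff_left algebra_simps)
    then have "?G w v (- \<sigma>) = kern \<beta> k v w \<sigma> * H w v (post_v_star v w \<sigma>) (post_v v w \<sigma>)" for v w \<sigma>
      unfolding kern_def by (simp add: norm_minus_commute[of w v] post_v_def post_v_star_def add.commute)
    then show ?thesis by simp
  qed
  finally show ?thesis .
qed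

section \<open>Angular averages of the kernel\<close>

text \<open>\<open>TA\<close> only pins down the type of velocities, whose dimension occurs in the assumptions.\<close>
locale hard_potential =
  fixes TA :: "'a::euclidean_space itself" and b :: "real \<Rightarrow> real" and \<beta> :: real
  assumes dim: "2 \<le> DIM('a)"
    and beta: "0 < \<beta>" "\<beta> \<le> 2"
    and b_nonneg: "\<And>z. z \<in> {-1..1} \<Longrightarrow> 0 \<le> b z"
    and b_nonzero: "\<not> (AE z\<in>{-1..1} in lborel. b z = 0)"
    and b_L1: "set_integrable lborel {-1..1} (\<lambda>z. b z * (1 - z\<^sup>2) powr ((real DIM('a) - 3) / 2))"
begin

text \<open>Nothing is known about \<open>b\<close> outside \<open>{-1..1}\<close>, not even
  measurability, so it is cut off there.\<close>

definition k :: "real \<Rightarrow> ennreal" where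
  "k z = ennreal (indicator {-1..1} z * b z)"

definition zonal_weight :: "real \<Rightarrow> real" where
  "zonal_weight z = (1 - z\<^sup>2) powr ((real DIM('a) - 3) / 2)"

definition zonal_const :: real where
  "zonal_const = unit_ball_vol (DIM('a) - 1) * (DIM('a) - 1)"

lemma zonal_const_pos: "0 < zonal_const"
  using dim by (simp add: zonal_const_def)

lemma zonal_weight_pos: "- 1 < z \<Longrightarrow> z < 1 \<Longrightarrow> 0 < zonal_weight z"
  using abs_square_less_1[of z] by (auto simp: zonal_weight_def)

lemma measurable_zonal_weight[measurable]: "zonal_weight \<in> borel_measurable borel"
  unfolding zonal_weight_def by measurable

text \<open>Measurability of \<open>b\<close> is hidden in its integrability against the weight.
  Dividing by the weight recovers \<open>b\<close> on the open interval; the two endpoints, where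
  the weight is 0, are added back as single points.\<close>

lemma measurable_k[measurable]: "k \<in> borel_measurable borel"
proof -
  have m: "(\<lambda>z. indicator {-1..1} z *\<^sub>R (b z * zonal_weight z)) \<in> borel_measurable borel"
    using b_L1 unfolding set_integrable_def zonal_weight_def by (auto dest: borel_measurable_integrable)
  have [measurable]: "(\<lambda>z. indicator {-1<..<1} z * (indicator {-1..1} z *\<^sub>R (b z * zonal_weight z)) / zonal_weight z) \<in> borel_measurable borel"
    using m by measurable
  have "k z = ennreal (indicator {-1<..<1} z * (indicator {-1..1} z *\<^sub>R (b z * zonal_weight z)) / zonal_weight z
      + indicator {1} z * b 1 + indicator {-1} z * b (-1))" for z
    using zonal_weight_pos[of z] by (auto simp: k_def indicator_def)
  then have "k = (\<lambda>z. ennreal (indicator {-1<..<1} z * (indicator {-1..1} z *\<^sub>R (b z * zonal_weight z)) / zonal_weight z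
      + indicator {1} z * b 1 + indicator {-1} z * b (-1)))" by (rule ext)
  then show ?thesis
    by (rule ssubst[where P="\<lambda>g. g \<in> borel_measurable borel"]) measurable
qed

text \<open>The image of the measure \<open>k (u \<bullet> \<sigma>) d\<sigma>\<close> under the
  cosine \<open>u \<bullet> \<sigma>\<close>; it is the same for every unit vector
  \<open>u\<close>.\<close>

definition \<nu> :: "real measure" where
  "\<nu> = density lborel (\<lambda>z. ennreal zonal_const * (k z * ennreal (zonal_weight z) * indicator {-1<..<1} z))"

lemma sets_nu[simp, measurable_cong]: "sets \<nu> = sets borel" and space_nu[simp]: "space \<nu> = UNIV"
  by (simp_all add: \<nu>_def)

lemma nn_integral_k_inner:
  fixes u :: 'a
  assumes "norm u = 1" and [measurable]: "g \<in> borel_measurable borel"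
  shows "(\<integral>\<^sup>+\<sigma>. k (u \<bullet> \<sigma>) * g (u \<bullet> \<sigma>) \<partial>sph) = (\<integral>\<^sup>+z. g z \<partial>\<nu>)"
proof -
  have "(\<integral>\<^sup>+\<sigma>. k (u \<bullet> \<sigma>) * g (u \<bullet> \<sigma>) \<partial>sph) =
    ennreal zonal_const * (\<integral>\<^sup>+z. k z * g z * ennreal (zonal_weight z) * indicator {-1<..<1} z \<partial>lborel)"
    using nn_integral_sph_inner[OF assms(1) dim, of "\<lambda>z. k z * g z"] by (simp add: zonal_const_def zonal_weight_def)
  also have "\<dots> = (\<integral>\<^sup>+z. g z \<partial>\<nu>)"
    by (simp add: \<nu>_def nn_integral_density nn_integral_cmult[symmetric] mult_ac)
  finally show ?thesis .
qed

text \<open>The two assumptions on \<open>b\<close> act here: integrability gives finiteness, and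
  \<open>b_nonzero\<close> gives positivity because the zonal weight is positive in the open
  interval.\<close>

lemma emeasure_nu_UNIV: "0 < emeasure \<nu> UNIV" "emeasure \<nu> UNIV < \<infinity>"
proof -
  have eq: "emeasure \<nu> UNIV = ennreal zonal_const * (\<integral>\<^sup>+z. k z * ennreal (zonal_weight z) * indicator {-1<..<1} z \<partial>lborel)"
    by (simp add: \<nu>_def emeasure_density nn_integral_cmult)
  have "(\<integral>\<^sup>+z. k z * ennreal (zonal_weight z) * indicator {-1<..<1} z \<partial>lborel)
      \<le> (\<integral>\<^sup>+z. ennreal (norm (indicator {-1..1} z *\<^sub>R (b z * zonal_weight z))) \<partial>lborel)"
    by (intro nn_integral_mono) (auto simp: k_def indicator_def b_nonneg ennreal_mult[symmetric] zonal_weight_def)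
  also have "\<dots> < \<infinity>"
    using b_L1 unfolding set_integrable_def zonal_weight_def[symmetric] integrable_iff_bounded by simp
  finally show "emeasure \<nu> UNIV < \<infinity>" unfolding eq by (simp add: ennreal_mult_less_top)
  show "0 < emeasure \<nu> UNIV"
  proof (rule ccontr)
    assume "\<not> 0 < emeasure \<nu> UNIV"
    then have "(\<integral>\<^sup>+z. k z * ennreal (zonal_weight z) * indicator {-1<..<1} z \<partial>lborel) = 0"
      unfolding eq using zonal_const_pos by simp
    then have "AE z in lborel. k z * ennreal (zonal_weight z) * indicator {-1<..<1} z = 0"
      by (subst (asm) nn_integral_0_iff_AE) simp_all
    moreover have "AE z in lborel. z \<noteq> (1::real)" "AE z in lborel. z \<noteq> (-1::real)"
      by (rule AE_lborel_singleton)+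
    ultimately have "AE z\<in>{-1..1} in lborel. b z = 0"
    proof eventually_elim
      case (elim z)
      show ?case
      proof
        assume z: "z \<in> {-1..1}"
        with elim have z': "- 1 < z" "z < 1" by auto
        with elim zonal_weight_pos[of z] have "k z = 0" by auto
        then show "b z = 0" using z b_nonneg[OF z] by (simp add: k_def)
      qed
    qed
    then show False using b_nonzero by blast
  qed
qed

text \<open>The total angular cross-section, i.e. the collision rate at relative speed 1.\<close>

definition \<Lambda> :: real where "\<Lambda> = enn2real (emeasure \<nu> UNIV)"

lemma Lambda: "0 < \<Lambda>" "emeasure \<nu> UNIV = ennreal \<Lambda>"
  using emeasure_nu_UNIV by (auto simp: \<Lambda>_def enn2real_positive_iff)

lemma nn_integral_k: "norm (u::'a) = 1 \<Longrightarrow> (\<integral>\<^sup>+\<sigma>. k (u \<bullet> \<sigma>) \<partial>sph) = ennreal \<Lambda>"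
  using nn_integral_k_inner[of u "\<lambda>_. 1"] Lambda by simp

lemma AE_nu: "AE z in \<nu>. - 1 < z \<and> z < 1"
  unfolding \<nu>_def by (subst AE_density) (auto simp: indicator_def)

text \<open>The measure \<open>\<nu>\<close> is nonzero and does not charge the endpoints, so some
  compact subinterval of cosines has positive mass. It supplies the collisions that really share
  energy.\<close>

lemma exists_mid_angle:
  "\<exists>\<delta> l0. 0 < \<delta> \<and> \<delta> < 1/2 \<and> 0 < l0 \<and>
    (\<forall>u::'a. norm u = 1 \<longrightarrow> ennreal l0 \<le> (\<integral>\<^sup>+\<sigma>. k (u \<bullet> \<sigma>) * indicator {z. \<bar>z\<bar> \<le> 1 - 2 * \<delta>} (u \<bullet> \<sigma>) \<partial>sph))"
proof -
  \<comment> \<open>The shift by 3 keeps \<open>\<delta> = 1 / (n + 3)\<close> below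
    \<open>1/2\<close> for every \<open>n\<close>.\<close>
  define A where "A n = {z. \<bar>z\<bar> \<le> 1 - 2 * (1 / (real n + 3))}" for n :: nat
  have [measurable]: "A n \<in> sets borel" for n unfolding A_def by measurable
  have "\<exists>n. 0 < emeasure \<nu> (A n)"
  proof (rule ccontr)
    assume "\<not> (\<exists>n. 0 < emeasure \<nu> (A n))"
    then have "(\<Union>n. A n) \<in> null_sets \<nu>"
      by (intro null_sets_UN) (auto simp: null_sets_def)
    then have "AE z in \<nu>. z \<notin> (\<Union>n. A n)" by (rule AE_not_in)
    with AE_nu have "AE z in \<nu>. False"
    proof eventually_elim
      case (elim z)
      then have "0 < (1 - \<bar>z\<bar>) / 2" by auto
      then obtain n :: nat where n: "n > 0" "inverse (real n) < (1 - \<bar>z\<bar>) / 2"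
        using reals_Archimedean2[of "inverse ((1 - \<bar>z\<bar>) / 2)"] ex_inverse_of_nat_less by blast
      have "1 / (real n + 3) \<le> inverse (real n)" using n by (simp add: field_simps)
      with n have "z \<in> A n" by (simp add: A_def)
      with elim show ?case by auto
    qed
    then have "emeasure \<nu> UNIV = 0" using emeasure_eq_0_AE[of "\<lambda>_. True" \<nu>] by simp
    then show False using emeasure_nu_UNIV by simp
  qed
  then obtain n where n: "0 < emeasure \<nu> (A n)" ..
  have fin: "emeasure \<nu> (A n) < \<infinity>"
    using emeasure_nu_UNIV(2) emeasure_mono[of "A n" UNIV \<nu>] by (simp add: order_le_less_trans)
  define l0 where "l0 = enn2real (emeasure \<nu> (A n))"
  have l0: "0 < l0" "emeasure \<nu> (A n) = ennreal l0"
    using n fin by (auto simp: l0_def enn2real_positive_iff)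
  have "(\<integral>\<^sup>+\<sigma>. k (u \<bullet> \<sigma>) * indicator (A n) (u \<bullet> \<sigma>) \<partial>sph) = ennreal l0" if "norm u = 1" for u :: 'a
    using nn_integral_k_inner[OF that, of "indicator (A n)"] l0 by simp
  then show ?thesis using l0(1)
    by (intro exI[of _ "1 / (real n + 3)"] exI[of _ l0]) (auto simp: A_def)
qed

text \<open>For \<open>z\<close> the cosine between \<open>\<sigma>\<close> and the direction of
  \<open>v + w\<close>, \<open>(1 + \<bar>z\<bar>) / 2\<close> bounds the share of the total energy
  that one outgoing particle can take; the power \<open>\<beta> / 2\<close> passes from energies to
  \<open>\<rho>\<close>. The \<open>min\<close> keeps the bound by 1 valid off the sphere.\<close>

definition angular_factor :: "real \<Rightarrow> real" where
  "angular_factor z = ((1 + min 1 \<bar>z\<bar>) / 2) powr (\<beta> / 2)"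

lemma angular_factor_bounds: "0 < angular_factor z" "angular_factor z \<le> 1"
  using beta by (auto simp: angular_factor_def intro!: powr_le1)

lemma angular_factor_power_le_1: "angular_factor z ^ p \<le> 1"
  by (intro power_le_one) (use angular_factor_bounds[of z] in simp_all)

lemma angular_factor_less_1: "\<bar>z\<bar> < 1 \<Longrightarrow> angular_factor z < 1"
  using beta powr_less_mono2[of "\<beta> / 2" "(1 + min 1 \<bar>z\<bar>) / 2" 1] by (auto simp: angular_factor_def)

lemma measurable_angular_factor[measurable]: "angular_factor \<in> borel_measurable borel"
  unfolding angular_factor_def by measurable

text \<open>The kernel is centred at \<open>u\<close> and the factor at \<open>V\<close>, with no
  relation between them. Where \<open>k\<close> is at most \<open>n\<close>, the average is
  \<open>n\<close> times a rotation-invariant integral that tends to 0 in the power; where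
  \<open>k\<close> exceeds \<open>n\<close>, the factor is bounded by 1 and the
  \<open>\<nu>\<close>-mass is small. Hence \<open>n\<close> is fixed first and \<open>p0\<close>
  afterwards, uniformly in \<open>u\<close> and \<open>V\<close>.\<close>

lemma angular_small:
  assumes "0 < \<epsilon>"
  shows "\<exists>p0. \<forall>u V::'a. norm u = 1 \<longrightarrow> norm V = 1 \<longrightarrow>
    (\<integral>\<^sup>+\<sigma>. k (u \<bullet> \<sigma>) * ennreal (angular_factor (V \<bullet> \<sigma>) ^ p0) \<partial>sph) \<le> ennreal \<epsilon>"
proof -
  obtain e :: 'a where "e \<in> Basis" using nonempty_Basis by blast
  then have e: "norm e = 1" by simp
  have tail: "\<exists>n::nat. emeasure \<nu> {z. of_nat n < k z} < ennreal (\<epsilon> / 2)"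
  proof -
    have "(\<lambda>n::nat. emeasure \<nu> {z. of_nat n < k z}) \<longlonglongrightarrow> emeasure \<nu> (\<Inter>n::nat. {z. of_nat n < k z})"
    proof (rule Lim_emeasure_decseq)
      show "decseq (\<lambda>n. {z. of_nat n < k z})"
        by (auto simp: decseq_def intro: order_le_less_trans of_nat_mono)
      fix n :: nat
      show "emeasure \<nu> {z. of_nat n < k z} \<noteq> \<infinity>"
        using emeasure_nu_UNIV(2) emeasure_mono[of "{z. of_nat n < k z}" UNIV \<nu>]
        by (simp add: less_top order_le_less_trans)
    qed auto
    moreover have "(\<Inter>n::nat. {z. of_nat n < k z}) = {}"
    proof -
      have "\<exists>n::nat. \<not> of_nat n < k z" for z
        using real_arch_simple[of "indicator {-1..1} z * b z"]
        by (auto simp: k_def not_less ennreal_of_nat_eq_real_of_nat intro!: ennreal_leI)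
      then show ?thesis by auto
    qed
    ultimately have "(\<lambda>n::nat. emeasure \<nu> {z. of_nat n < k z}) \<longlonglongrightarrow> 0" by simp
    then have "eventually (\<lambda>n::nat. emeasure \<nu> {z. of_nat n < k z} < ennreal (\<epsilon> / 2)) sequentially"
      using assms by (intro order_tendstoD(2)) auto
    then show ?thesis by (auto simp: eventually_sequentially)
  qed
  then obtain n :: nat where n: "emeasure \<nu> {z. of_nat n < k z} < ennreal (\<epsilon> / 2)" ..
  \<comment> \<open>The poles, where the angular factor equals 1 and its powers do not decay, form a
    null set.\<close>
  have le1: "AE \<sigma>::'a in sph. \<bar>e \<bullet> \<sigma>\<bar> < 1"
  proof -
    have "(\<integral>\<^sup>+\<sigma>. indicator {1, -1} (e \<bullet> \<sigma>) \<partial>sph) = 0"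
      by (subst nn_integral_sph_inner[OF e dim]) (auto simp: nn_integral_0_iff_AE indicator_def)
    then have "AE \<sigma>::'a in sph. indicator {1, -1::real} (e \<bullet> \<sigma>) = (0::ennreal)"
      by (subst (asm) nn_integral_0_iff_AE) simp_all
    with AE_sph show ?thesis
    proof eventually_elim
      case (elim \<sigma>)
      have "\<bar>e \<bullet> \<sigma>\<bar> \<le> 1" using Cauchy_Schwarz_ineq2[of e \<sigma>] e elim by simp
      moreover have "e \<bullet> \<sigma> \<noteq> 1" "e \<bullet> \<sigma> \<noteq> - 1" using elim by (auto simp: indicator_def)
      ultimately show ?case by linarith
    qed
  qed
  have "(\<lambda>p. \<integral>\<^sup>+\<sigma>. ennreal (angular_factor (e \<bullet> \<sigma>) ^ p) \<partial>sph) \<longlonglongrightarrow> (\<integral>\<^sup>+\<sigma>. 0 \<partial>(sph :: 'a measure))"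
  proof (rule nn_integral_dominated_convergence[where w="\<lambda>_. 1"])
    show "AE \<sigma>::'a in sph. ennreal (angular_factor (e \<bullet> \<sigma>) ^ p) \<le> 1" for p
      using angular_factor_power_le_1 by (simp add: ennreal_le_1)
    show "AE \<sigma>::'a in sph. (\<lambda>p. ennreal (angular_factor (e \<bullet> \<sigma>) ^ p)) \<longlonglongrightarrow> 0"
      using le1
    proof eventually_elim
      case (elim \<sigma>)
      have "(\<lambda>p. angular_factor (e \<bullet> \<sigma>) ^ p) \<longlonglongrightarrow> 0"
        using angular_factor_bounds[of "e \<bullet> \<sigma>"] angular_factor_less_1[OF elim] by (intro LIMSEQ_power_zero) simp
      then show ?case using tendsto_ennrealI by fastforce
    qed
  qed (use emeasure_sph_finite in auto)
  then have lim: "(\<lambda>p. of_nat n * (\<integral>\<^sup>+\<sigma>. ennreal (angular_factor (e \<bullet> \<sigma>) ^ p) \<partial>sph)) \<longlonglongrightarrow> of_nat n * 0"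
    by (intro ennreal_tendsto_cmult) (simp_all add: of_nat_less_top)
  then have "eventually (\<lambda>p. of_nat n * (\<integral>\<^sup>+\<sigma>. ennreal (angular_factor (e \<bullet> \<sigma>) ^ p) \<partial>sph) < ennreal (\<epsilon> / 2)) sequentially"
    using assms by (intro order_tendstoD(2)[OF lim]) auto
  then obtain p0 where p0: "of_nat n * (\<integral>\<^sup>+\<sigma>. ennreal (angular_factor (e \<bullet> \<sigma>) ^ p0) \<partial>sph) < ennreal (\<epsilon> / 2)"
    by (auto simp: eventually_sequentially)
  have "(\<integral>\<^sup>+\<sigma>. k (u \<bullet> \<sigma>) * ennreal (angular_factor (V \<bullet> \<sigma>) ^ p0) \<partial>sph) \<le> ennreal \<epsilon>"
    if u: "norm u = 1" and V: "norm V = 1" for u V :: 'a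
  proof -
    have "(\<integral>\<^sup>+\<sigma>. k (u \<bullet> \<sigma>) * ennreal (angular_factor (V \<bullet> \<sigma>) ^ p0) \<partial>sph)
      \<le> (\<integral>\<^sup>+\<sigma>. of_nat n * ennreal (angular_factor (V \<bullet> \<sigma>) ^ p0) + k (u \<bullet> \<sigma>) * indicator {z. of_nat n < k z} (u \<bullet> \<sigma>) \<partial>sph)"
    proof (rule nn_integral_mono)
      fix \<sigma> :: 'a
      show "k (u \<bullet> \<sigma>) * ennreal (angular_factor (V \<bullet> \<sigma>) ^ p0)
        \<le> of_nat n * ennreal (angular_factor (V \<bullet> \<sigma>) ^ p0) + k (u \<bullet> \<sigma>) * indicator {z. of_nat n < k z} (u \<bullet> \<sigma>)"
      proof (cases "of_nat n < k (u \<bullet> \<sigma>)")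
        case True
        have "ennreal (angular_factor (V \<bullet> \<sigma>) ^ p0) \<le> 1"
          using angular_factor_power_le_1 by (simp add: ennreal_le_1)
        then have "k (u \<bullet> \<sigma>) * ennreal (angular_factor (V \<bullet> \<sigma>) ^ p0) \<le> k (u \<bullet> \<sigma>) * 1"
          by (intro mult_left_mono) auto
        also have "\<dots> = k (u \<bullet> \<sigma>) * indicator {z. of_nat n < k z} (u \<bullet> \<sigma>)" using True by simp
        also have "\<dots> \<le> of_nat n * ennreal (angular_factor (V \<bullet> \<sigma>) ^ p0) + \<dots>" by simp
        finally show ?thesis .
      next
        case False
        then show ?thesis by (auto simp: not_less intro!: mult_right_mono)
      qed
    qed
    also have "\<dots> = of_nat n * (\<integral>\<^sup>+\<sigma>. ennreal (angular_factor (V \<bullet> \<sigma>) ^ p0) \<partial>sph) + (\<integral>\<^sup>+\<sigma>. k (u \<bullet> \<sigma>) * indicator {z. of_nat n < k z} (u \<bullet> \<sigma>) \<partial>sph)"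
      by (simp add: nn_integral_add nn_integral_cmult)
    also have "(\<integral>\<^sup>+\<sigma>. ennreal (angular_factor (V \<bullet> \<sigma>) ^ p0) \<partial>sph) = (\<integral>\<^sup>+\<sigma>. ennreal (angular_factor (e \<bullet> \<sigma>) ^ p0) \<partial>sph)"
      by (simp add: nn_integral_sph_inner[OF V dim, of "\<lambda>z. ennreal (angular_factor z ^ p0)"]
        nn_integral_sph_inner[OF e dim, of "\<lambda>z. ennreal (angular_factor z ^ p0)"])
    also have "(\<integral>\<^sup>+\<sigma>. k (u \<bullet> \<sigma>) * indicator {z. of_nat n < k z} (u \<bullet> \<sigma>) \<partial>sph) = emeasure \<nu> {z. of_nat n < k z}"
      by (subst nn_integral_k_inner[OF u]) auto
    also have "of_nat n * (\<integral>\<^sup>+\<sigma>. ennreal (angular_factor (e \<bullet> \<sigma>) ^ p0) \<partial>sph) + emeasure \<nu> {z. of_nat n < k z}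
      \<le> ennreal (\<epsilon> / 2) + ennreal (\<epsilon> / 2)"
      using p0 n by (intro add_mono) auto
    also have "\<dots> = ennreal \<epsilon>" using assms by (simp flip: ennreal_plus)
    finally show ?thesis .
  qed
  then show ?thesis by blast
qed

end

section \<open>Gain and loss terms\<close>

text \<open>After division by \<open>x + y\<close> the claim concerns two numbers in the unit
  interval with sum 1, each of which is at most its power of exponent \<open>s\<close>.\<close>

lemma powr_subadditive:
  fixes x y s :: real
  assumes "0 \<le> x" "0 \<le> y" "0 < s" "s \<le> 1"
  shows "(x + y) powr s \<le> x powr s + y powr s"
proof (cases "x + y = 0")
  case True
  then have "x = 0" "y = 0" using assms by auto
  then show ?thesis by simp
next
  case False
  define m where "m = x + y"
  have m: "0 < m" using False assms by (simp add: m_def)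
  have le: "z / m \<le> (z / m) powr s" if "0 \<le> z" "z \<le> m" for z
  proof -
    have "(z / m) powr 1 \<le> (z / m) powr s"
      using that m assms by (intro powr_mono') auto
    then show ?thesis using that m by simp
  qed
  have "x / m + y / m \<le> (x / m) powr s + (y / m) powr s"
    using assms by (intro add_mono le) (auto simp: m_def)
  also have "x / m + y / m = 1" using m by (simp add: m_def flip: add_divide_distrib)
  finally have "m powr s * 1 \<le> m powr s * ((x / m) powr s + (y / m) powr s)"
    by (intro mult_left_mono) auto
  also have "\<dots> = x powr s + y powr s"
    using m assms by (simp add: powr_divide field_simps)
  finally show ?thesis by (simp add: m_def)
qed

lemma square_powr_half: "0 \<le> z \<Longrightarrow> (z\<^sup>2) powr (\<beta> / 2) = z powr \<beta>" for z :: real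
  by (cases "z = 0") (simp_all add: powr_powr flip: powr_numeral)

text \<open>Subadditivity needs an exponent at most 1, whereas \<open>\<beta>\<close> may reach 2;
  squaring first reduces it to \<open>\<beta> / 2\<close>.\<close>

lemma powr_add_le_twice:
  fixes x y \<beta> :: real
  assumes "0 \<le> x" "0 \<le> y" "0 < \<beta>" "\<beta> \<le> 2"
  shows "(x + y) powr \<beta> \<le> 2 * (x powr \<beta> + y powr \<beta>)"
proof -
  note sq = square_powr_half
  have "(x + y)\<^sup>2 \<le> 2 * x\<^sup>2 + 2 * y\<^sup>2"
    using sum_squares_bound[of x y] by (simp add: power2_sum)
  then have "(x + y) powr \<beta> \<le> (2 * x\<^sup>2 + 2 * y\<^sup>2) powr (\<beta> / 2)"
    using assms sq[of "x + y"] by (metis add_nonneg_nonneg divide_nonneg_pos less_eq_real_def powr_mono2 zero_le_power2 zero_less_numeral)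
  also have "\<dots> \<le> (2 * x\<^sup>2) powr (\<beta> / 2) + (2 * y\<^sup>2) powr (\<beta> / 2)"
    using assms by (intro powr_subadditive) auto
  also have "\<dots> = 2 powr (\<beta> / 2) * (x powr \<beta> + y powr \<beta>)"
    using assms by (simp add: powr_mult sq algebra_simps)
  also have "\<dots> \<le> 2 powr 1 * (x powr \<beta> + y powr \<beta>)"
    using assms by (intro mult_right_mono powr_mono) auto
  finally show ?thesis by simp
qed

context hard_potential
begin

definition \<rho> :: "'a \<Rightarrow> real" where "\<rho> v = norm v powr \<beta>"

lemma rho_nonneg[simp]: "0 \<le> \<rho> v" by (simp add: \<rho>_def)

lemma measurable_rho[measurable]: "\<rho> \<in> borel_measurable borel"
  unfolding \<rho>_def by measurable

lemma rel_speed_le: "norm (v - w) powr \<beta> \<le> 2 * (\<rho> v + \<rho> w)" for v w :: 'a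
proof -
  have "norm (v - w) powr \<beta> \<le> (norm v + norm w) powr \<beta>"
    using beta by (intro powr_mono2 norm_triangle_ineq4) auto
  also have "\<dots> \<le> 2 * (\<rho> v + \<rho> w)"
    unfolding \<rho>_def using beta by (intro powr_add_le_twice) auto
  finally show ?thesis .
qed

lemma rho_le_rel_speed: "\<rho> v \<le> 2 * (norm (v - w) powr \<beta> + \<rho> w)" for v w :: 'a
proof -
  have "norm v \<le> norm (v - w) + norm w"
    using norm_triangle_ineq[of "v - w" w] by simp
  then have "\<rho> v \<le> (norm (v - w) + norm w) powr \<beta>"
    unfolding \<rho>_def using beta by (intro powr_mono2) auto
  also have "\<dots> \<le> 2 * (norm (v - w) powr \<beta> + \<rho> w)"
    unfolding \<rho>_def using beta by (intro powr_add_le_twice) auto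
  finally show ?thesis .
qed

lemma rho_le: "\<rho> v \<le> 1 + (norm v)\<^sup>2"
proof (cases "norm v \<le> 1")
  case True
  then have "\<rho> v \<le> 1" unfolding \<rho>_def using beta by (intro powr_le1) auto
  then show ?thesis by (simp add: add_increasing2)
next
  case False
  then have "\<rho> v \<le> norm v powr 2" unfolding \<rho>_def using beta by (intro powr_mono) auto
  then show ?thesis using False by (simp add: powr_numeral)
qed

text \<open>This is the form after the collision change of variables: the weight sits at the
  outgoing velocity and \<open>F\<close> at the incoming ones, so the pointwise geometry of one
  collision bounds it.\<close>

definition gain :: "('a \<Rightarrow> ennreal) \<Rightarrow> ('a \<Rightarrow> ennreal) \<Rightarrow> ennreal" where
  "gain F \<phi> = (\<integral>\<^sup>+v. \<integral>\<^sup>+w. \<integral>\<^sup>+\<sigma>. kern \<beta> k v w \<sigma> * (F v * F w * \<phi> (post_v v w \<sigma>)) \<partial>sph \<partial>lborel \<partial>lborel)"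

definition loss :: "('a \<Rightarrow> ennreal) \<Rightarrow> ('a \<Rightarrow> ennreal) \<Rightarrow> ennreal" where
  "loss F \<phi> = (\<integral>\<^sup>+v. \<integral>\<^sup>+w. \<integral>\<^sup>+\<sigma>. kern \<beta> k v w \<sigma> * (F v * F w * \<phi> v) \<partial>sph \<partial>lborel \<partial>lborel)"

lemma nn_integral_kern: "(\<integral>\<^sup>+\<sigma>. kern \<beta> k v w \<sigma> \<partial>sph) = ennreal \<Lambda> * ennreal (norm (v - w) powr \<beta>)" for v w :: 'a
proof (cases "v = w")
  \<comment> \<open>Here \<open>cos_theta\<close> has the default value 0, but the prefactor
    \<open>0 powr \<beta>\<close> is 0 as well.\<close>
  case True
  then show ?thesis by (simp add: kern_def)
next
  case False
  then have "(\<integral>\<^sup>+\<sigma>. k (cos_theta v w \<sigma>) \<partial>sph) = ennreal \<Lambda>"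
    unfolding cos_theta_def by (intro nn_integral_k) simp
  moreover have "(\<integral>\<^sup>+\<sigma>. kern \<beta> k v w \<sigma> \<partial>sph) = ennreal (norm (v - w) powr \<beta>) * (\<integral>\<^sup>+\<sigma>. k (cos_theta v w \<sigma>) \<partial>sph)"
    unfolding kern_def by (intro nn_integral_cmult) measurable
  ultimately show ?thesis by (simp add: mult.commute)
qed

lemma loss_eq:
  assumes [measurable]: "F \<in> borel_measurable borel" "\<phi> \<in> borel_measurable borel"
  shows "loss F \<phi> = ennreal \<Lambda> * (\<integral>\<^sup>+v. \<integral>\<^sup>+w. ennreal (norm (v - w) powr \<beta>) * (F v * F w * \<phi> v) \<partial>lborel \<partial>lborel)"
  unfolding loss_def
  by (simp add: nn_integral_multc nn_integral_kern mult.assoc nn_integral_cmult)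

section \<open>Pointwise collision terms and their weak forms\<close>

definition Qp :: "('a \<Rightarrow> ennreal) \<Rightarrow> 'a \<Rightarrow> ennreal" where
  "Qp F v = (\<integral>\<^sup>+w. \<integral>\<^sup>+\<sigma>. kern \<beta> k v w \<sigma> * (F (post_v_star v w \<sigma>) * F (post_v v w \<sigma>)) \<partial>sph \<partial>lborel)"

definition Qm :: "('a \<Rightarrow> ennreal) \<Rightarrow> 'a \<Rightarrow> ennreal" where
  "Qm F v = (\<integral>\<^sup>+w. \<integral>\<^sup>+\<sigma>. kern \<beta> k v w \<sigma> * (F w * F v) \<partial>sph \<partial>lborel)"

lemma nn_integral_Qp:
  assumes [measurable]: "F \<in> borel_measurable borel" "\<phi> \<in> borel_measurable borel"
  shows "(\<integral>\<^sup>+v. Qp F v * \<phi> v \<partial>lborel) = gain F \<phi>"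
proof -
  have "(\<integral>\<^sup>+v. Qp F v * \<phi> v \<partial>lborel)
     = (\<integral>\<^sup>+v. \<integral>\<^sup>+w. \<integral>\<^sup>+\<sigma>. kern \<beta> k v w \<sigma> * (F (post_v v w \<sigma>) * F (post_v_star v w \<sigma>) * \<phi> v) \<partial>sph \<partial>lborel \<partial>lborel)"
    unfolding Qp_def by (simp add: nn_integral_multc[symmetric]) (simp add: mult_ac)
  also have "\<dots> = gain F \<phi>"
    unfolding gain_def
    by (rule nn_integral_collision[symmetric, where H="\<lambda>x y z w. F x * F y * \<phi> z"]) measurable
  finally show ?thesis .
qed

lemma nn_integral_Qm:
  assumes [measurable]: "F \<in> borel_measurable borel" "\<phi> \<in> borel_measurable borel"
  shows "(\<integral>\<^sup>+v. Qm F v * \<phi> v \<partial>lborel) = loss F \<phi>"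
  unfolding Qm_def loss_def by (simp add: nn_integral_multc[symmetric]) (simp add: mult_ac)

text \<open>The sum of the gain and its copy with the particles interchanged. The symmetric form is
  the one to which energy conservation in a collision applies.\<close>

lemma two_gain:
  assumes [measurable]: "F \<in> borel_measurable borel" "\<phi> \<in> borel_measurable borel"
  shows "2 * gain F \<phi> = (\<integral>\<^sup>+v. \<integral>\<^sup>+w. \<integral>\<^sup>+\<sigma>. kern \<beta> k v w \<sigma> * (F v * F w * (\<phi> (post_v v w \<sigma>) + \<phi> (post_v_star v w \<sigma>))) \<partial>sph \<partial>lborel \<partial>lborel)"
proof -
  have "gain F \<phi> = (\<integral>\<^sup>+v. \<integral>\<^sup>+w. \<integral>\<^sup>+\<sigma>. kern \<beta> k v w \<sigma> * (F w * F v * \<phi> (post_v_star v w \<sigma>)) \<partial>sph \<partial>lborel \<partial>lborel)"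
    unfolding gain_def
    by (rule nn_integral_collision_swap[where H="\<lambda>x y z w. F x * F y * \<phi> z"]) measurable
  then have "2 * gain F \<phi> = (\<integral>\<^sup>+v. \<integral>\<^sup>+w. \<integral>\<^sup>+\<sigma>. kern \<beta> k v w \<sigma> * (F v * F w * \<phi> (post_v v w \<sigma>)) \<partial>sph \<partial>lborel \<partial>lborel)
      + (\<integral>\<^sup>+v. \<integral>\<^sup>+w. \<integral>\<^sup>+\<sigma>. kern \<beta> k v w \<sigma> * (F w * F v * \<phi> (post_v_star v w \<sigma>)) \<partial>sph \<partial>lborel \<partial>lborel)"
    by (simp add: mult_2 gain_def)
  also have "\<dots> = (\<integral>\<^sup>+v. \<integral>\<^sup>+w. \<integral>\<^sup>+\<sigma>. kern \<beta> k v w \<sigma> * (F v * F w * (\<phi> (post_v v w \<sigma>) + \<phi> (post_v_star v w \<sigma>))) \<partial>sph \<partial>lborel \<partial>lborel)"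
    by (simp add: nn_integral_add[symmetric] distrib_left mult.commute[of "F _" "F _"])
  finally show ?thesis .
qed

lemma two_loss:
  assumes [measurable]: "F \<in> borel_measurable borel" "\<phi> \<in> borel_measurable borel"
  shows "2 * loss F \<phi> = (\<integral>\<^sup>+v. \<integral>\<^sup>+w. \<integral>\<^sup>+\<sigma>. kern \<beta> k v w \<sigma> * (F v * F w * (\<phi> v + \<phi> w)) \<partial>sph \<partial>lborel \<partial>lborel)"
proof -
  have "loss F \<phi> = (\<integral>\<^sup>+v. \<integral>\<^sup>+w. \<integral>\<^sup>+\<sigma>. kern \<beta> k v w \<sigma> * (F w * F v * \<phi> w) \<partial>sph \<partial>lborel \<partial>lborel)"
    unfolding loss_def
    by (rule nn_integral_collision_swap[where H="\<lambda>x y z w. F x * F y * \<phi> x"]) measurable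
  then have "2 * loss F \<phi> = (\<integral>\<^sup>+v. \<integral>\<^sup>+w. \<integral>\<^sup>+\<sigma>. kern \<beta> k v w \<sigma> * (F v * F w * \<phi> v) \<partial>sph \<partial>lborel \<partial>lborel)
      + (\<integral>\<^sup>+v. \<integral>\<^sup>+w. \<integral>\<^sup>+\<sigma>. kern \<beta> k v w \<sigma> * (F w * F v * \<phi> w) \<partial>sph \<partial>lborel \<partial>lborel)"
    by (simp add: mult_2 loss_def)
  also have "\<dots> = (\<integral>\<^sup>+v. \<integral>\<^sup>+w. \<integral>\<^sup>+\<sigma>. kern \<beta> k v w \<sigma> * (F v * F w * (\<phi> v + \<phi> w)) \<partial>sph \<partial>lborel \<partial>lborel)"
    by (simp add: nn_integral_add[symmetric] distrib_left mult.commute[of "F _" "F _"])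
  finally show ?thesis .
qed

lemma gain_one: "gain F (\<lambda>_. 1) = loss F (\<lambda>_. 1)"
  by (simp add: gain_def loss_def)

lemma rel_speed_integral_le:
  assumes [measurable]: "F \<in> borel_measurable borel" "G \<in> borel_measurable borel"
  shows "(\<integral>\<^sup>+v. \<integral>\<^sup>+w. ennreal (norm (v - w) powr \<beta>) * (F v * G w) \<partial>lborel \<partial>lborel)
    \<le> 2 * ((\<integral>\<^sup>+v. F v * ennreal (\<rho> v) \<partial>lborel) * (\<integral>\<^sup>+w. G w \<partial>lborel)
        + (\<integral>\<^sup>+v. F v \<partial>lborel) * (\<integral>\<^sup>+w. G w * ennreal (\<rho> w) \<partial>lborel))"
proof -
  have "(\<integral>\<^sup>+v. \<integral>\<^sup>+w. ennreal (norm (v - w) powr \<beta>) * (F v * G w) \<partial>lborel \<partial>lborel)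
    \<le> (\<integral>\<^sup>+v. \<integral>\<^sup>+w. 2 * (F v * ennreal (\<rho> v) * G w + F v * (G w * ennreal (\<rho> w))) \<partial>lborel \<partial>lborel)"
  proof (intro nn_integral_mono)
    fix v w :: 'a
    have "ennreal (norm (v - w) powr \<beta>) \<le> ennreal (2 * (\<rho> v + \<rho> w))"
      by (intro ennreal_leI rel_speed_le)
    also have "\<dots> = 2 * (ennreal (\<rho> v) + ennreal (\<rho> w))"
      by (simp add: ennreal_mult)
    finally have "ennreal (norm (v - w) powr \<beta>) * (F v * G w) \<le> 2 * (ennreal (\<rho> v) + ennreal (\<rho> w)) * (F v * G w)"
      by (intro mult_right_mono) auto
    then show "ennreal (norm (v - w) powr \<beta>) * (F v * G w) \<le> 2 * (F v * ennreal (\<rho> v) * G w + F v * (G w * ennreal (\<rho> w)))"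
      by (simp add: distrib_left distrib_right mult_ac)
  qed
  also have "\<dots> = 2 * ((\<integral>\<^sup>+v. F v * ennreal (\<rho> v) \<partial>lborel) * (\<integral>\<^sup>+w. G w \<partial>lborel)
        + (\<integral>\<^sup>+v. F v \<partial>lborel) * (\<integral>\<^sup>+w. G w * ennreal (\<rho> w) \<partial>lborel))"
    by (simp add: nn_integral_cmult nn_integral_add nn_integral_multc)
  finally show ?thesis .
qed

text \<open>Where both parts of the collision integral are finite, the Bochner integral defining
  \<^term>\<open>collision_op\<close> takes its intended value rather than the default value \<open>0\<close>.\<close>
lemma collision_op_eq:
  fixes h :: "'a \<Rightarrow> real"
  assumes h: "\<And>v. 0 \<le> h v" and [measurable]: "h \<in> borel_measurable borel"
    and fin: "Qp (\<lambda>v. ennreal (h v)) v < \<infinity>" "Qm (\<lambda>v. ennreal (h v)) v < \<infinity>"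
  shows "collision_op (\<lambda>r z. r powr \<beta> * b z) h v
    = enn2real (Qp (\<lambda>v. ennreal (h v)) v) - enn2real (Qm (\<lambda>v. ennreal (h v)) v)"
proof -
  let ?N = "(lborel :: 'a measure) \<Otimes>\<^sub>M (sphere_measure :: 'a measure)"
  \<comment> \<open>A real-valued Borel version of the kernel; \<open>b\<close> itself may fail to
    be measurable off the interval.\<close>
  define kr where "kr z = indicator {-1..1} z * b z" for z
  have kr: "0 \<le> kr z" "k z = ennreal (kr z)" for z
    using b_nonneg by (auto simp: kr_def k_def indicator_def)
  have [measurable]: "kr \<in> borel_measurable borel"
  proof -
    have "kr = (\<lambda>z. enn2real (k z))" using kr by auto
    then show ?thesis by simp
  qed
  have finS: "finite_measure (sphere_measure :: 'a measure)"
  proof (rule finite_measureI)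
    have "emeasure (sphere_measure :: 'a measure) (space sphere_measure) = (\<integral>\<^sup>+x. (\<lambda>_::'a. 1) x \<partial>sphere_measure)" by simp
    also have "\<dots> = emeasure (sph :: 'a measure) UNIV" by (subst nn_integral_sphere_measure) auto
    finally show "emeasure (sphere_measure :: 'a measure) (space sphere_measure) \<noteq> \<infinity>"
      using emeasure_sph_finite by simp
  qed
  interpret S: finite_measure "sphere_measure :: 'a measure" by fact
  note measurable_ident_sphere[measurable]
  have s[measurable]: "(\<lambda>x. snd x) \<in> ?N \<rightarrow>\<^sub>M borel"
    using measurable_compose[OF measurable_snd measurable_ident_sphere] by simp
  have nn: "(\<integral>\<^sup>+x. ennreal (norm (v - fst x) powr \<beta> * kr (cos_theta v (fst x) (snd x)) * g (fst x) (snd x)) \<partial>?N)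
     = (\<integral>\<^sup>+w. \<integral>\<^sup>+\<sigma>. kern \<beta> k v w \<sigma> * ennreal (g w \<sigma>) \<partial>sph \<partial>lborel)"
    if g: "case_prod g \<in> borel_measurable (borel \<Otimes>\<^sub>M borel)" "\<And>w \<sigma>. 0 \<le> g w \<sigma>" for g :: "'a \<Rightarrow> 'a \<Rightarrow> real"
  proof -
    note [measurable] = g(1)
    have "(\<integral>\<^sup>+x. ennreal (norm (v - fst x) powr \<beta> * kr (cos_theta v (fst x) (snd x)) * g (fst x) (snd x)) \<partial>?N)
      = (\<integral>\<^sup>+w. \<integral>\<^sup>+\<sigma>. ennreal (norm (v - w) powr \<beta> * kr (cos_theta v w \<sigma>) * g w \<sigma>) \<partial>sphere_measure \<partial>lborel)"
      by (subst S.nn_integral_fst[symmetric]) simp_all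
    also have "\<dots> = (\<integral>\<^sup>+w. \<integral>\<^sup>+\<sigma>. ennreal (norm (v - w) powr \<beta> * kr (cos_theta v w \<sigma>) * g w \<sigma>) \<partial>sph \<partial>lborel)"
      by (intro nn_integral_cong nn_integral_sphere_measure) measurable
    finally show ?thesis
      using g(2) kr by (simp add: kern_def ennreal_mult)
  qed
  define P where "P x = norm (v - fst x) powr \<beta> * kr (cos_theta v (fst x) (snd x)) * (h (post_v_star v (fst x) (snd x)) * h (post_v v (fst x) (snd x)))" for x
  define N where "N x = norm (v - fst x) powr \<beta> * kr (cos_theta v (fst x) (snd x)) * (h (fst x) * h v)" for x
  have PN: "P \<in> borel_measurable ?N" "N \<in> borel_measurable ?N" "\<And>x. 0 \<le> P x" "\<And>x. 0 \<le> N x"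
    unfolding P_def N_def using kr h by simp_all
  have P: "(\<integral>\<^sup>+x. ennreal (P x) \<partial>?N) = Qp (\<lambda>v. ennreal (h v)) v"
    unfolding P_def Qp_def by (subst nn) (simp_all add: h ennreal_mult)
  have N: "(\<integral>\<^sup>+x. ennreal (N x) \<partial>?N) = Qm (\<lambda>v. ennreal (h v)) v"
    unfolding N_def Qm_def by (subst nn) (simp_all add: h ennreal_mult)
  have "integrable ?N P" "integrable ?N N"
    using PN P N fin by (auto intro!: integrableI_nonneg)
  moreover have "collision_op (\<lambda>r z. r powr \<beta> * b z) h v = (\<integral>x. P x - N x \<partial>?N)"
    unfolding collision_op_def
  proof (rule Bochner_Integration.integral_cong[OF refl])
    fix x assume "x \<in> space ?N"
    then obtain w \<sigma> where x: "x = (w, \<sigma>)" "norm \<sigma> = 1"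
      by (auto simp: space_pair_measure space_sphere_measure)
    \<comment> \<open>On the sphere the cosine lies in the unit interval, so the cut-off is
      invisible. For \<open>v = w\<close> the normalised difference is the zero vector and the bound
      persists.\<close>
    have "\<bar>cos_theta v w \<sigma>\<bar> \<le> norm ((v - w) /\<^sub>R norm (v - w)) * norm \<sigma>"
      unfolding cos_theta_def by (rule Cauchy_Schwarz_ineq2)
    also have "\<dots> \<le> 1" using x by (cases "v = w") auto
    finally have "b (cos_theta v w \<sigma>) = kr (cos_theta v w \<sigma>)"
      by (auto simp: kr_def indicator_def)
    then show "(case x of (w, \<sigma>) \<Rightarrow> norm (v - w) powr \<beta> * b (cos_theta v w \<sigma>) *
        (h (post_v_star v w \<sigma>) * h (post_v v w \<sigma>) - h w * h v)) = P x - N x"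
      by (simp add: x P_def N_def right_diff_distrib)
  qed
  ultimately show ?thesis
    using PN P N by (simp add: integral_eq_nn_integral)
qed

end

section \<open>Solutions as measurable curves of densities\<close>

text \<open>Mass and energy are parameters tied to \<open>f0\<close> by equations, so constants
  expressed through them, \<open>b\<close> and \<open>\<beta>\<close> are visibly shared by all
  solutions.\<close>

locale boltzmann_flow = hard_potential TA b \<beta>
  for TA :: "'a::euclidean_space itself" and b :: "real \<Rightarrow> real" and \<beta> :: real +
  fixes f0 :: "'a \<Rightarrow> real" and f :: "real \<Rightarrow> 'a \<Rightarrow> real" and mass energy :: real
  assumes f0_nonneg: "\<And>v. 0 \<le> f0 v"
    and f0_int: "integrable lborel (\<lambda>v. (1 + (norm v)\<^sup>2) * f0 v)"
    and f0_mass: "(\<integral>v. f0 v \<partial>lborel) = mass"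
    and f0_energy: "(\<integral>v. (norm v)\<^sup>2 * f0 v \<partial>lborel) = energy"
    and sol: "boltzmann_solution (\<lambda>r z. r powr \<beta> * b z) f0 f"
    and cons: "energy_conserving f0 f"
begin

lemma f_nonneg: "0 \<le> t \<Longrightarrow> 0 \<le> f t v"
  and f_joint: "(\<lambda>(t, v). f t v) \<in> borel_measurable (restrict_space borel {0..} \<Otimes>\<^sub>M borel)"
  and f_integrable: "0 \<le> t \<Longrightarrow> integrable lborel (f t)"
  and f_bound: "0 \<le> T \<Longrightarrow> \<exists>K::real. AE t\<in>{0..T} in lborel.
        (\<integral>\<^sup>+v. ennreal ((1 + (norm v)\<^sup>2) * f t v) \<partial>lborel) \<le> ennreal K"
  and f_Q_integrable: "0 \<le> t \<Longrightarrow> integrable (restrict_space lborel {0..t} \<Otimes>\<^sub>M lborel)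
        (\<lambda>(\<tau>, v). collision_op (\<lambda>r z. r powr \<beta> * b z) (f \<tau>) v)"
  and f_eq: "0 \<le> t \<Longrightarrow> AE v in lborel.
        f t v = f0 v + (\<integral>\<tau>\<in>{0..t}. collision_op (\<lambda>r z. r powr \<beta> * b z) (f \<tau>) v \<partial>lborel)"
  using sol unfolding boltzmann_solution_def by blast+

text \<open>Clamping the time at \<open>0\<close> makes \<open>f\<close> jointly measurable on the whole space.\<close>
definition F :: "real \<Rightarrow> 'a \<Rightarrow> ennreal" where "F t v = ennreal (f (max 0 t) v)"

lemma measurable_F_pair: "(\<lambda>(t, v). F t v) \<in> borel_measurable (borel \<Otimes>\<^sub>M borel)"
proof -
  have "(\<lambda>(t, v::'a). (max 0 t, v)) \<in> borel \<Otimes>\<^sub>M borel \<rightarrow>\<^sub>M restrict_space borel {0::real..} \<Otimes>\<^sub>M borel"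
    unfolding case_prod_beta by (intro measurable_Pair measurable_restrict_space2) auto
  from measurable_compose[OF this f_joint] show ?thesis
    unfolding F_def case_prod_beta by simp
qed

lemma measurable_F[measurable (raw)]:
  assumes [measurable]: "g \<in> borel_measurable M" "h \<in> borel_measurable M"
  shows "(\<lambda>x. F (g x) (h x)) \<in> borel_measurable M"
proof -
  have "(\<lambda>x. (g x, h x)) \<in> M \<rightarrow>\<^sub>M borel \<Otimes>\<^sub>M borel" by measurable
  from measurable_compose[OF this measurable_F_pair] show ?thesis by simp
qed

lemma measurable_f[measurable]: "0 \<le> t \<Longrightarrow> f t \<in> borel_measurable borel"
  using f_integrable[of t] by (auto dest: borel_measurable_integrable)

text \<open>Measurability is extracted from the weighted integrability by dividing out the positive
  weight.\<close>

lemma measurable_f0[measurable]: "f0 \<in> borel_measurable borel"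
proof -
  have pos: "1 + (norm v)\<^sup>2 \<noteq> 0" for v :: 'a
    by (metis add_cancel_left_right add_nonneg_eq_0_iff zero_le_one zero_le_power2 zero_neq_one)
  have [measurable]: "(\<lambda>v. (1 + (norm v)\<^sup>2) * f0 v) \<in> borel_measurable borel"
    using f0_int by (auto dest: borel_measurable_integrable)
  have "(\<lambda>v. ((1 + (norm v)\<^sup>2) * f0 v) / (1 + (norm v)\<^sup>2)) \<in> borel_measurable borel" by measurable
  then show ?thesis using pos by simp
qed

lemma f0_integrable: "integrable lborel f0" "integrable lborel (\<lambda>v. (norm v)\<^sup>2 * f0 v)"
  using f0_nonneg by (auto intro!: Bochner_Integration.integrable_bound[OF f0_int] simp: algebra_simps)

lemma energy_nonneg: "0 \<le> energy"
  unfolding f0_energy[symmetric] using f0_nonneg by (intro integral_nonneg_AE) auto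

lemma mass_nonneg: "0 \<le> mass"
  unfolding f0_mass[symmetric] using f0_nonneg by (intro integral_nonneg_AE) auto

lemma F_energy: "(\<integral>\<^sup>+v. F t v * ennreal ((norm v)\<^sup>2) \<partial>lborel) = ennreal energy"
proof -
  have "(\<integral>\<^sup>+v. F t v * ennreal ((norm v)\<^sup>2) \<partial>lborel) = (\<integral>\<^sup>+v. ennreal ((norm v)\<^sup>2 * f (max 0 t) v) \<partial>lborel)"
    by (simp add: F_def ennreal_mult'' mult.commute)
  also have "\<dots> = (\<integral>\<^sup>+v. ennreal ((norm v)\<^sup>2 * f0 v) \<partial>lborel)"
    using cons unfolding energy_conserving_def by simp
  also have "\<dots> = ennreal energy"
    unfolding f0_energy[symmetric] using f0_nonneg by (intro nn_integral_eq_integral f0_integrable) auto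
  finally show ?thesis .
qed

lemma F_rho_le: "(\<integral>\<^sup>+v. F t v * ennreal (\<rho> v) \<partial>lborel) \<le> (\<integral>\<^sup>+v. F t v \<partial>lborel) + ennreal energy"
proof -
  have "(\<integral>\<^sup>+v. F t v * ennreal (\<rho> v) \<partial>lborel) \<le> (\<integral>\<^sup>+v. F t v + F t v * ennreal ((norm v)\<^sup>2) \<partial>lborel)"
  proof (intro nn_integral_mono)
    fix v :: 'a
    have "F t v * ennreal (\<rho> v) \<le> F t v * ennreal (1 + (norm v)\<^sup>2)"
      by (intro mult_left_mono ennreal_leI rho_le) auto
    then show "F t v * ennreal (\<rho> v) \<le> F t v + F t v * ennreal ((norm v)\<^sup>2)"
      by (simp add: distrib_left)
  qed
  also have "\<dots> = (\<integral>\<^sup>+v. F t v \<partial>lborel) + ennreal energy"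
    by (simp add: nn_integral_add F_energy)
  finally show ?thesis .
qed

section \<open>Time integrability of the collision terms and the mild form\<close>

lemma measurable_Qp[measurable (raw)]:
  assumes [measurable]: "g \<in> borel_measurable M" "h \<in> borel_measurable M"
  shows "(\<lambda>x. Qp (F (g x)) (h x)) \<in> borel_measurable M" "(\<lambda>x. Qm (F (g x)) (h x)) \<in> borel_measurable M"
  unfolding Qp_def Qm_def by measurable

lemma measurable_gain_loss[measurable (raw)]:
  assumes [measurable]: "\<phi> \<in> borel_measurable borel"
  shows "(\<lambda>t. gain (F t) \<phi>) \<in> borel_measurable borel" "(\<lambda>t. loss (F t) \<phi>) \<in> borel_measurable borel"
  unfolding gain_def loss_def by measurable

lemma loss_one_le:
  assumes "(\<integral>\<^sup>+v. F t v \<partial>lborel) \<le> K"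
  shows "loss (F t) (\<lambda>_. 1) \<le> ennreal \<Lambda> * (4 * ((K + ennreal energy) * K))"
proof -
  have "(\<integral>\<^sup>+v. \<integral>\<^sup>+w. ennreal (norm (v - w) powr \<beta>) * (F t v * F t w) \<partial>lborel \<partial>lborel)
    \<le> 2 * ((K + ennreal energy) * K + K * (K + ennreal energy))"
    by (rule order_trans[OF rel_speed_integral_le])
      (use assms order_trans[OF F_rho_le add_right_mono[OF assms]] in \<open>auto intro!: mult_left_mono add_mono mult_mono\<close>)
  also have "\<dots> = 4 * ((K + ennreal energy) * K)"
    by (simp add: mult.commute[of K] mult_2[symmetric] mult.assoc[symmetric])
  finally show ?thesis
    by (subst loss_eq) (auto intro!: mult_left_mono)
qed

text \<open>The total number of collisions up to \<open>T\<close> is finite. Conservation of mass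
  cannot be invoked, since its proof cancels this very integral; the locally bounded mass and energy
  in the notion of solution are used instead.\<close>

lemma loss_one_integral:
  assumes "0 \<le> T"
  shows "(\<integral>\<^sup>+t. loss (F t) (\<lambda>_. 1) * indicator {0..T} t \<partial>lborel) < \<infinity>"
proof -
  obtain K :: real where K: "AE t\<in>{0..T} in lborel. (\<integral>\<^sup>+v. ennreal ((1 + (norm v)\<^sup>2) * f t v) \<partial>lborel) \<le> ennreal K"
    using f_bound[OF assms] by blast
  define C where "C = ennreal \<Lambda> * (4 * ((ennreal K + ennreal energy) * ennreal K))"
  have "(\<integral>\<^sup>+t. loss (F t) (\<lambda>_. 1) * indicator {0..T} t \<partial>lborel) \<le> (\<integral>\<^sup>+t. C * indicator {0..T} t \<partial>lborel)"
  proof (rule nn_integral_mono_AE, use K in eventually_elim)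
    case (elim t)
    show ?case
    proof (cases "t \<in> {0..T}")
      case True
      then have "(\<integral>\<^sup>+v. F t v \<partial>lborel) \<le> (\<integral>\<^sup>+v. ennreal ((1 + (norm v)\<^sup>2) * f t v) \<partial>lborel)"
        using f_nonneg[of t] by (intro nn_integral_mono) (auto simp: F_def max_def intro!: ennreal_leI mult_right_le_one_le simp: algebra_simps)
      with elim True have "(\<integral>\<^sup>+v. F t v \<partial>lborel) \<le> ennreal K" by auto
      from loss_one_le[OF this] show ?thesis using True by (simp add: C_def)
    qed simp
  qed
  also have "\<dots> < \<infinity>"
    using assms by (simp add: nn_integral_cmult_indicator C_def ennreal_mult_less_top)
  finally show ?thesis .
qed

text \<open>Gain and loss have the same finite integral over time and velocity, so for almost every
  \<open>v\<close> both are integrable in time, and the signed collision integral splits into two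
  finite pieces.\<close>

lemma mild_form_pointwise:
  assumes "0 \<le> t"
  shows "AE v in lborel.
    (\<integral>\<^sup>+\<tau>. Qp (F \<tau>) v * indicator {0..t} \<tau> \<partial>lborel) < \<infinity> \<and>
    (\<integral>\<^sup>+\<tau>. Qm (F \<tau>) v * indicator {0..t} \<tau> \<partial>lborel) < \<infinity> \<and>
    f t v = f0 v + (enn2real (\<integral>\<^sup>+\<tau>. Qp (F \<tau>) v * indicator {0..t} \<tau> \<partial>lborel)
                  - enn2real (\<integral>\<^sup>+\<tau>. Qm (F \<tau>) v * indicator {0..t} \<tau> \<partial>lborel))"
proof -
  \<comment> \<open>Shared by \<open>Qp\<close> and \<open>Qm\<close>, whose velocity integrals both
    equal the loss of the weight 1.\<close>
  have fin: "AE v in lborel. (\<integral>\<^sup>+\<tau>. G \<tau> v * indicator {0..t} \<tau> \<partial>lborel) < \<infinity>"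
    if G: "(\<lambda>(\<tau>, v). G \<tau> v) \<in> borel_measurable (borel \<Otimes>\<^sub>M borel)"
      "\<And>\<tau>. (\<integral>\<^sup>+v. G \<tau> v \<partial>lborel) = loss (F \<tau>) (\<lambda>_. 1)" for G :: "real \<Rightarrow> 'a \<Rightarrow> ennreal"
  proof -
    note [measurable] = G(1)
    have "(\<integral>\<^sup>+v. \<integral>\<^sup>+\<tau>. G \<tau> v * indicator {0..t} \<tau> \<partial>lborel \<partial>lborel)
       = (\<integral>\<^sup>+\<tau>. \<integral>\<^sup>+v. G \<tau> v * indicator {0..t} \<tau> \<partial>lborel \<partial>lborel)"
      by (rule lborel_pair.Fubini') measurable
    also have "\<dots> = (\<integral>\<^sup>+\<tau>. loss (F \<tau>) (\<lambda>_. 1) * indicator {0..t} \<tau> \<partial>lborel)"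
      by (simp add: nn_integral_multc G(2))
    finally have "(\<integral>\<^sup>+v. \<integral>\<^sup>+\<tau>. G \<tau> v * indicator {0..t} \<tau> \<partial>lborel \<partial>lborel) \<noteq> \<infinity>"
      using loss_one_integral[OF assms] by simp
    then have "AE v in lborel. (\<integral>\<^sup>+\<tau>. G \<tau> v * indicator {0..t} \<tau> \<partial>lborel) \<noteq> \<infinity>"
      by (intro nn_integral_noteq_infinite) measurable
    then show ?thesis
      by eventually_elim (simp add: less_top)
  qed
  have p: "AE v in lborel. (\<integral>\<^sup>+\<tau>. Qp (F \<tau>) v * indicator {0..t} \<tau> \<partial>lborel) < \<infinity>"
    using nn_integral_Qp[of _ "\<lambda>_. 1"] by (intro fin) (simp_all add: gain_one case_prod_beta)
  have m: "AE v in lborel. (\<integral>\<^sup>+\<tau>. Qm (F \<tau>) v * indicator {0..t} \<tau> \<partial>lborel) < \<infinity>"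
    using nn_integral_Qm[of _ "\<lambda>_. 1"] by (intro fin) (simp_all add: case_prod_beta)
  from p m f_eq[OF assms] show ?thesis
  proof eventually_elim
    case (elim v)
    let ?P = "\<lambda>\<tau>. Qp (F \<tau>) v * indicator {0..t} \<tau>" and ?N = "\<lambda>\<tau>. Qm (F \<tau>) v * indicator {0..t} \<tau>"
    have fin: "AE \<tau> in lborel. ?P \<tau> < \<infinity>" "AE \<tau> in lborel. ?N \<tau> < \<infinity>"
      using nn_integral_noteq_infinite[of ?P lborel] nn_integral_noteq_infinite[of ?N lborel] elim
      by (auto simp: less_top)
    have int: "integrable lborel (\<lambda>\<tau>. enn2real (?P \<tau>))" "integrable lborel (\<lambda>\<tau>. enn2real (?N \<tau>))"
      and val: "(\<integral>\<tau>. enn2real (?P \<tau>) \<partial>lborel) = enn2real (\<integral>\<^sup>+\<tau>. ?P \<tau> \<partial>lborel)"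
       "(\<integral>\<tau>. enn2real (?N \<tau>) \<partial>lborel) = enn2real (\<integral>\<^sup>+\<tau>. ?N \<tau> \<partial>lborel)"
    proof -
      have e: "(\<integral>\<^sup>+\<tau>. ennreal (enn2real (?P \<tau>)) \<partial>lborel) = (\<integral>\<^sup>+\<tau>. ?P \<tau> \<partial>lborel)"
        "(\<integral>\<^sup>+\<tau>. ennreal (enn2real (?N \<tau>)) \<partial>lborel) = (\<integral>\<^sup>+\<tau>. ?N \<tau> \<partial>lborel)"
        by (rule nn_integral_cong_AE, use fin in eventually_elim, simp)+
      show "integrable lborel (\<lambda>\<tau>. enn2real (?P \<tau>))" "integrable lborel (\<lambda>\<tau>. enn2real (?N \<tau>))"
        using e elim by (auto intro!: integrableI_nonneg)
      show "(\<integral>\<tau>. enn2real (?P \<tau>) \<partial>lborel) = enn2real (\<integral>\<^sup>+\<tau>. ?P \<tau> \<partial>lborel)"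
       "(\<integral>\<tau>. enn2real (?N \<tau>) \<partial>lborel) = enn2real (\<integral>\<^sup>+\<tau>. ?N \<tau> \<partial>lborel)"
        by (subst integral_eq_nn_integral; simp add: e)+
    qed
    have "(\<integral>\<tau>\<in>{0..t}. collision_op (\<lambda>r z. r powr \<beta> * b z) (f \<tau>) v \<partial>lborel)
       = (\<integral>\<tau>. indicator {0..t} \<tau> *\<^sub>R collision_op (\<lambda>r z. r powr \<beta> * b z) (f \<tau>) v \<partial>lborel)"
      by (simp add: set_lebesgue_integral_def)
    also have "\<dots> = (\<integral>\<tau>. enn2real (?P \<tau>) - enn2real (?N \<tau>) \<partial>lborel)"
    proof -
      have ae: "AE \<tau> in lborel. indicator {0..t} \<tau> *\<^sub>R collision_op (\<lambda>r z. r powr \<beta> * b z) (f \<tau>) v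
          = enn2real (?P \<tau>) - enn2real (?N \<tau>)"
        using fin
      proof eventually_elim
        case (elim \<tau>)
        show ?case
        proof (cases "\<tau> \<in> {0..t}")
          case True
          then have "F \<tau> = (\<lambda>v. ennreal (f \<tau> v))" by (auto simp: F_def max_def)
          with True elim show ?thesis
            using collision_op_eq[of "f \<tau>" v] f_nonneg[of \<tau>] by simp
        qed simp
      qed
      \<comment> \<open>For fixed \<open>v\<close>, measurability in time is that of a section of
        the jointly integrable collision term.\<close>
      have "(\<lambda>\<tau>. indicator {0..t} \<tau> *\<^sub>R collision_op (\<lambda>r z. r powr \<beta> * b z) (f \<tau>) v) \<in> borel_measurable lborel"
      proof -
        have "(\<lambda>\<tau>. (\<tau>, v)) \<in> restrict_space lborel {0..t} \<rightarrow>\<^sub>M restrict_space lborel {0..t} \<Otimes>\<^sub>M lborel"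
          by (rule measurable_Pair2') simp
        from measurable_compose[OF this borel_measurable_integrable[OF f_Q_integrable[OF assms]]]
        show ?thesis by (simp add: borel_measurable_restrict_space_iff)
      qed
      with ae show ?thesis by (intro integral_cong_AE) simp_all
    qed
    also have "\<dots> = enn2real (\<integral>\<^sup>+\<tau>. ?P \<tau> \<partial>lborel) - enn2real (\<integral>\<^sup>+\<tau>. ?N \<tau> \<partial>lborel)"
      using int val by simp
    finally show ?case using elim by simp
  qed
qed

end

section \<open>A Povzner inequality for truncated energies\<close>

lemma norm_post:
  fixes v w \<sigma> :: "'a::euclidean_space"
  assumes "norm \<sigma> = 1"
  shows "(norm (post_v v w \<sigma>))\<^sup>2 = ((norm v)\<^sup>2 + (norm w)\<^sup>2) / 2 + norm (v - w) * ((v + w) \<bullet> \<sigma>) / 2"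
    "(norm (post_v_star v w \<sigma>))\<^sup>2 = ((norm v)\<^sup>2 + (norm w)\<^sup>2) / 2 - norm (v - w) * ((v + w) \<bullet> \<sigma>) / 2"
proof -
  have s: "\<sigma> \<bullet> \<sigma> = 1" using assms by (simp add: norm_eq_1)
  have n: "norm (v - w) * norm (v - w) = v \<bullet> v - 2 * (v \<bullet> w) + w \<bullet> w"
    unfolding power2_eq_square[symmetric] power2_norm_eq_inner
    by (simp add: inner_diff inner_commute algebra_simps)
  have "(norm (p + q *\<^sub>R \<sigma>))\<^sup>2 = p \<bullet> p + 2 * q * (p \<bullet> \<sigma>) + q * q" for p q
    unfolding power2_norm_eq_inner by (simp add: inner_simps s inner_commute algebra_simps)
  note e = this[of "(v + w) /\<^sub>R 2" "norm (v - w) / 2"]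
  have vw: "((v + w) /\<^sub>R 2) \<bullet> ((v + w) /\<^sub>R 2) = (v \<bullet> v + 2 * (v \<bullet> w) + w \<bullet> w) / 4"
    by (simp add: inner_simps inner_commute)
  have q: "norm (v - w) / 2 * (norm (v - w) / 2) = (v \<bullet> v - 2 * (v \<bullet> w) + w \<bullet> w) / 4"
    using n by simp
  have i: "((v + w) /\<^sub>R 2) \<bullet> \<sigma> = ((v + w) \<bullet> \<sigma>) / 2" by simp
  show "(norm (post_v v w \<sigma>))\<^sup>2 = ((norm v)\<^sup>2 + (norm w)\<^sup>2) / 2 + norm (v - w) * ((v + w) \<bullet> \<sigma>) / 2"
    unfolding post_v_def e vw q i unfolding power2_norm_eq_inner by (simp add: field_simps)
  have "(norm (p - q *\<^sub>R \<sigma>))\<^sup>2 = p \<bullet> p - 2 * q * (p \<bullet> \<sigma>) + q * q" for p q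
    unfolding power2_norm_eq_inner by (simp add: inner_simps s inner_commute algebra_simps)
  note e' = this[of "(v + w) /\<^sub>R 2" "norm (v - w) / 2"]
  show "(norm (post_v_star v w \<sigma>))\<^sup>2 = ((norm v)\<^sup>2 + (norm w)\<^sup>2) / 2 - norm (v - w) * ((v + w) \<bullet> \<sigma>) / 2"
    unfolding post_v_star_def e' vw q i unfolding power2_norm_eq_inner by (simp add: field_simps)
qed

lemma post_energy:
  fixes v w \<sigma> :: "'a::euclidean_space"
  assumes "norm \<sigma> = 1"
  shows "(norm (post_v v w \<sigma>))\<^sup>2 + (norm (post_v_star v w \<sigma>))\<^sup>2 = (norm v)\<^sup>2 + (norm w)\<^sup>2"
  using norm_post[OF assms, of v w] by simp

text \<open>Writing \<open>v + w = (v - w) + 2 w\<close> expresses the energy exchange through the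
  deflection cosine, up to an error proportional to \<open>norm w\<close>. A cosine away from both
  ends leaves each outgoing particle a fixed share of the energy of \<open>v\<close>, and the
  slowness of \<open>w\<close> keeps the error small.\<close>

lemma post_norm_lower:
  fixes v w \<sigma> :: "'a::euclidean_space"
  assumes s: "norm \<sigma> = 1" and c: "\<bar>cos_theta v w \<sigma>\<bar> \<le> 1 - 2 * \<delta>" and d: "0 < \<delta>" "\<delta> < 1/2"
    and w: "norm w \<le> \<delta> * norm v / 8"
  shows "\<delta> / 4 * (norm v)\<^sup>2 \<le> (norm (post_v v w \<sigma>))\<^sup>2" "\<delta> / 4 * (norm v)\<^sup>2 \<le> (norm (post_v_star v w \<sigma>))\<^sup>2"
proof -
  define a e u where "a = norm v" and "e = norm w" and "u = norm (v - w)"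
  have pos: "0 \<le> a" "0 \<le> e" "0 \<le> u" by (simp_all add: a_def e_def u_def)
  have ule: "u \<le> a + e" unfolding u_def a_def e_def by (rule norm_triangle_ineq4)
  have cs: "u * cos_theta v w \<sigma> = (v - w) \<bullet> \<sigma>"
    unfolding cos_theta_def u_def by (cases "v = w") auto
  have "(v + w) \<bullet> \<sigma> = u * cos_theta v w \<sigma> + 2 * (w \<bullet> \<sigma>)"
    unfolding cs by (simp add: inner_simps)
  then have "\<bar>u * ((v + w) \<bullet> \<sigma>)\<bar> = \<bar>u * u * cos_theta v w \<sigma> + 2 * u * (w \<bullet> \<sigma>)\<bar>"
    by (simp add: algebra_simps)
  also have "\<dots> \<le> u * u * \<bar>cos_theta v w \<sigma>\<bar> + 2 * u * \<bar>w \<bullet> \<sigma>\<bar>"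
    using pos by (intro order_trans[OF abs_triangle_ineq]) (simp add: abs_mult)
  also have "\<dots> \<le> (a + e) * (a + e) * (1 - 2 * \<delta>) + 2 * (a + e) * e"
  proof (intro add_mono mult_mono ule)
    show "\<bar>w \<bullet> \<sigma>\<bar> \<le> e" using Cauchy_Schwarz_ineq2[of w \<sigma>] s by (simp add: e_def)
  qed (use c pos ule d in auto)
  finally have D: "\<bar>u * ((v + w) \<bullet> \<sigma>)\<bar> \<le> (a + e) * (a + e) * (1 - 2 * \<delta>) + 2 * (a + e) * e" .
  \<comment> \<open>The two errors cost at most a quarter and \<open>1/128\<close> of
    \<open>\<delta> * a * a\<close>, well within the available three quarters.\<close>
  have eb: "e \<le> \<delta> * a / 8" using w by (simp add: e_def a_def)
  have "2 * (a * e) \<le> 2 * (a * (\<delta> * a / 8))" using eb pos by (intro mult_left_mono) auto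
  moreover have "e * e \<le> (a / 16) * (\<delta> * a / 8)"
  proof (rule mult_mono[OF _ eb])
    have "\<delta> * a \<le> 1 / 2 * a" using d pos by (intro mult_right_mono) auto
    then show "e \<le> a / 16" using eb by simp
  qed (use pos d in auto)
  moreover have "0 \<le> \<delta> * (a * e)" "0 \<le> \<delta> * (e * e)" "0 \<le> \<delta> * (a * a)" using pos d by auto
  ultimately have "\<delta> / 4 * (a * a) \<le> \<delta> * ((a + e) * (a + e)) - 2 * (a * e) - e * e"
    by (simp add: algebra_simps)
  also have "\<dots> = (a * a + e * e) / 2 - ((a + e) * (a + e) * (1 - 2 * \<delta>) + 2 * (a + e) * e) / 2"
    by (simp add: field_simps)
  also have "\<dots> \<le> (a * a + e * e) / 2 - \<bar>u * ((v + w) \<bullet> \<sigma>)\<bar> / 2" using D by simp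
  finally have "\<delta> / 4 * a\<^sup>2 \<le> (a\<^sup>2 + e\<^sup>2) / 2 - \<bar>u * ((v + w) \<bullet> \<sigma>)\<bar> / 2"
    by (simp add: power2_eq_square)
  then show "\<delta> / 4 * (norm v)\<^sup>2 \<le> (norm (post_v v w \<sigma>))\<^sup>2" "\<delta> / 4 * (norm v)\<^sup>2 \<le> (norm (post_v_star v w \<sigma>))\<^sup>2"
    unfolding norm_post[OF s] a_def[symmetric] e_def[symmetric] u_def[symmetric]
    using abs_ge_self[of "u * ((v + w) \<bullet> \<sigma>)"] abs_ge_minus_self[of "u * ((v + w) \<bullet> \<sigma>)"] by linarith+
qed

text \<open>If both energies are below \<open>n / 2\<close>, their sum is below \<open>n\<close> and
  no truncation acts before or after. Otherwise the outgoing truncated sum is at least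
  \<open>min (x + y) n\<close>, which dominates the truncated larger energy; at most the smaller
  energy is lost.\<close>

lemma min_post_ge:
  fixes x y s r n :: real
  assumes "0 \<le> x" "0 \<le> y" "0 \<le> s" "0 \<le> r" "s + r = x + y" "0 \<le> n"
  shows "min x n + min y n \<le> min s n + min r n
    + ((if y \<le> x \<and> n / 2 \<le> x then y else 0) + (if x \<le> y \<and> n / 2 \<le> y then x else 0))"
  using assms by (auto simp: min_def)

context hard_potential
begin

text \<open>Up to constants, the collision rate of particles with energy at least \<open>m\<close>.
  It measures both the dissipation and the error in the tail estimate.\<close>

definition fast_flux :: "('a \<Rightarrow> ennreal) \<Rightarrow> real \<Rightarrow> ennreal" where
  "fast_flux F m = (\<integral>\<^sup>+v. F v * ennreal (\<rho> v) * indicator {v. m \<le> (norm v)\<^sup>2} v \<partial>lborel)"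

text \<open>Collisions of a very fast with a slow particle raise the truncated energy by an amount
  of order \<open>n\<close>, whereas the possible decrease in any other collision is at most the
  smaller energy, whose integral is controlled by \<open>E\<close>. This difference of one power of
  \<open>n\<close> drives the iteration.\<close>

lemma concave_povzner:
  assumes M: "0 < M" and E: "0 \<le> E"
  obtains K n0 c C :: real where "1 \<le> K" "1 \<le> n0" "0 < c" "0 \<le> C"
    "\<And>F n. F \<in> borel_measurable borel \<Longrightarrow> (\<integral>\<^sup>+v. F v \<partial>lborel) = ennreal M \<Longrightarrow>
      (\<integral>\<^sup>+v. F v * ennreal ((norm v)\<^sup>2) \<partial>lborel) = ennreal E \<Longrightarrow> n0 \<le> n \<Longrightarrow>
      2 * loss F (\<lambda>v. ennreal (min ((norm v)\<^sup>2) n)) + ennreal (c * n) * fast_flux F (K * n)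
       \<le> 2 * gain F (\<lambda>v. ennreal (min ((norm v)\<^sup>2) n)) + ennreal C * fast_flux F (n / 2)"
proof -
  obtain \<delta> l0 where *: "0 < \<delta> \<and> \<delta> < 1/2 \<and> 0 < l0 \<and> (\<forall>u::'a. norm u = 1 \<longrightarrow>
      ennreal l0 \<le> (\<integral>\<^sup>+\<sigma>. k (u \<bullet> \<sigma>) * indicator {z. \<bar>z\<bar> \<le> 1 - 2 * \<delta>} (u \<bullet> \<sigma>) \<partial>sph))"
    using exists_mid_angle by (elim exE) (rule that)
  then have \<delta>: "0 < \<delta>" "\<delta> < 1/2" "0 < l0"
    and mid: "\<And>u::'a. norm u = 1 \<Longrightarrow> ennreal l0 \<le> (\<integral>\<^sup>+\<sigma>. k (u \<bullet> \<sigma>) * indicator {z. \<bar>z\<bar> \<le> 1 - 2 * \<delta>} (u \<bullet> \<sigma>) \<partial>sph)"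
    by simp_all
  \<comment> \<open>By \<open>post_norm_lower\<close>, energy \<open>K * n\<close> before the
    collision leaves both outgoing particles with energy at least
    \<open>\<delta> / 4 * (K * n) = n\<close>.\<close>
  define K where "K = 4 / \<delta>"
  \<comment> \<open>Chebyshev: at least half of the mass has energy at most \<open>R\<close>. The
    summand 1 keeps \<open>R\<close> positive when \<open>E = 0\<close>.\<close>
  define R where "R = 2 * (E + 1) / M"
  \<comment> \<open>An energy ratio of at least \<open>L\<close> gives both
    \<open>4 * \<rho> w \<le> \<rho> v\<close> and the speed ratio \<open>\<delta> / 8\<close>
    required by \<open>post_norm_lower\<close>.\<close>
  define L where "L = max (4 powr (2 / \<beta>)) (64 / \<delta>\<^sup>2)"
  define n0 where "n0 = max 1 (max (2 * R) (R * L))"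
  have K: "1 \<le> K" using \<delta> by (simp add: K_def field_simps)
  have R: "0 < R" using M E by (simp add: R_def)
  have L: "0 < L" using \<delta> by (simp add: L_def less_max_iff_disj)
  have n0: "1 \<le> n0" "2 * R \<le> n0" "R * L \<le> n0" by (simp_all add: n0_def)
  \<comment> \<open>\<open>c\<close> is the product of the relative-speed bound \<open>1/4\<close>,
    the angular mass \<open>l0\<close>, the energy increment \<open>1/2\<close> and the slow mass
    \<open>M / 2\<close>. Below, the factor 8 in \<open>C\<close> is 4 from the relative speed times
    2 from the two orders of the pair.\<close>
  define c where "c = l0 * M / 16"
  define C where "C = 8 * \<Lambda> * E"
  show thesis
  proof (rule that[OF K n0(1), of c C])
    show "0 < c" "0 \<le> C" using \<delta> M E Lambda by (simp_all add: c_def C_def)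
    fix F :: "'a \<Rightarrow> ennreal" and n :: real
    assume F[measurable]: "F \<in> borel_measurable borel" and FM: "(\<integral>\<^sup>+v. F v \<partial>lborel) = ennreal M"
      and FE: "(\<integral>\<^sup>+v. F v * ennreal ((norm v)\<^sup>2) \<partial>lborel) = ennreal E" and n: "n0 \<le> n"
    define \<phi> where "\<phi> v = ennreal (min ((norm v)\<^sup>2) n)" for v :: 'a
    define err where "err v w = (if (norm w)\<^sup>2 \<le> (norm v)\<^sup>2 \<and> n / 2 \<le> (norm v)\<^sup>2 then (norm w)\<^sup>2 else 0)" for v w :: 'a
    define A where "A v w \<longleftrightarrow> K * n \<le> (norm v)\<^sup>2 \<and> (norm w)\<^sup>2 \<le> R" for v w :: 'a
    \<comment> \<open>Before such a collision the truncated energies sum to at most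
      \<open>n + n / 2\<close>, afterwards to \<open>2 * n\<close>.\<close>
    define B where "B v w \<sigma> = (if A v w \<and> \<bar>cos_theta v w \<sigma>\<bar> \<le> 1 - 2 * \<delta> then n / 2 else 0)" for v w \<sigma> :: 'a
    have [measurable]: "\<phi> \<in> borel_measurable borel" unfolding \<phi>_def by measurable
    have errm[measurable (raw)]: "(\<lambda>x. err (g x) (h x)) \<in> borel_measurable N"
      if [measurable]: "g \<in> borel_measurable N" "h \<in> borel_measurable N" for g h and N :: "'x measure"
      unfolding err_def by measurable
    have Bm[measurable (raw)]: "(\<lambda>x. B (g x) (h x) (i x)) \<in> borel_measurable N"
      if [measurable]: "g \<in> borel_measurable N" "h \<in> borel_measurable N" "i \<in> borel_measurable N" for g h i and N :: "'x measure"
      unfolding B_def A_def by measurable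
    have n1: "1 \<le> n" "2 * R \<le> n" "R * L \<le> n" using n n0 by auto
    have far: "norm w \<le> \<delta> * norm v / 8" "4 * \<rho> w \<le> \<rho> v" "v \<noteq> w" if "A v w" for v w
    proof -
      have x: "K * n \<le> (norm v)\<^sup>2" "(norm w)\<^sup>2 \<le> R" using that by (auto simp: A_def)
      have "L * (norm w)\<^sup>2 \<le> L * R" using x L by (intro mult_left_mono) auto
      also have "\<dots> \<le> 1 * n" using n1 by (simp add: mult.commute)
      also have "\<dots> \<le> K * n" using K n1 by (intro mult_right_mono) auto
      finally have L1: "L * (norm w)\<^sup>2 \<le> (norm v)\<^sup>2" using x by simp
      have "64 / \<delta>\<^sup>2 * (norm w)\<^sup>2 \<le> (norm v)\<^sup>2"
        by (rule order_trans[OF mult_right_mono L1]) (simp_all add: L_def)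
      then have "(8 * norm w)\<^sup>2 \<le> (\<delta> * norm v)\<^sup>2"
        using \<delta> by (simp add: power_mult_distrib field_simps)
      then have "8 * norm w \<le> \<delta> * norm v"
        using \<delta> by (intro power2_le_imp_le[of "8 * norm w"]) auto
      then show "norm w \<le> \<delta> * norm v / 8" by simp
      have "4 powr (2 / \<beta>) * (norm w)\<^sup>2 \<le> (norm v)\<^sup>2"
        by (rule order_trans[OF mult_right_mono L1]) (simp_all add: L_def)
      then have "(4 powr (2 / \<beta>) * (norm w)\<^sup>2) powr (\<beta> / 2) \<le> ((norm v)\<^sup>2) powr (\<beta> / 2)"
        using beta by (intro powr_mono2) auto
      moreover note square_powr_half
      ultimately show "4 * \<rho> w \<le> \<rho> v"
        using beta by (simp add: powr_mult powr_powr \<rho>_def)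
      have "0 < (norm v)\<^sup>2" using x K n1 by (meson less_le_trans mult_pos_pos zero_less_one order_trans)
      then have "0 < norm v" by simp
      then have "\<delta> * norm v / 8 < norm v" using \<delta> by simp
      with \<open>norm w \<le> \<delta> * norm v / 8\<close> show "v \<noteq> w" by auto
    qed
    have pointwise: "\<phi> v + \<phi> w + ennreal (B v w \<sigma>) \<le> \<phi> (post_v v w \<sigma>) + \<phi> (post_v_star v w \<sigma>) + ennreal (err v w + err w v)"
      if s: "norm \<sigma> = 1" for v w \<sigma>
    proof -
      have "min ((norm v)\<^sup>2) n + min ((norm w)\<^sup>2) n + B v w \<sigma>
        \<le> min ((norm (post_v v w \<sigma>))\<^sup>2) n + min ((norm (post_v_star v w \<sigma>))\<^sup>2) n + (err v w + err w v)"
      proof (cases "A v w \<and> \<bar>cos_theta v w \<sigma>\<bar> \<le> 1 - 2 * \<delta>")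
        case True
        then have x: "K * n \<le> (norm v)\<^sup>2" "(norm w)\<^sup>2 \<le> R" by (auto simp: A_def)
        have "n = \<delta> / 4 * (K * n)" using \<delta> by (simp add: K_def)
        also have "\<dots> \<le> \<delta> / 4 * (norm v)\<^sup>2" using x \<delta> by (intro mult_left_mono) auto
        finally have "n \<le> \<delta> / 4 * (norm v)\<^sup>2" .
        with post_norm_lower[OF s _ \<delta>(1,2) far(1), of v w] True
        have "n \<le> (norm (post_v v w \<sigma>))\<^sup>2" "n \<le> (norm (post_v_star v w \<sigma>))\<^sup>2" by auto
        moreover have "(norm w)\<^sup>2 \<le> n / 2" using x n1 by simp
        moreover have "0 \<le> err v w + err w v" by (simp add: err_def)
        ultimately show ?thesis using True by (simp add: B_def min_def)
      next
        case False
        then have "B v w \<sigma> = 0" by (auto simp: B_def)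
        then show ?thesis
          unfolding err_def
          using min_post_ge[of "(norm v)\<^sup>2" "(norm w)\<^sup>2" "(norm (post_v v w \<sigma>))\<^sup>2" "(norm (post_v_star v w \<sigma>))\<^sup>2" n]
            post_energy[OF s, of v w] n1 by simp
      qed
      moreover have "0 \<le> B v w \<sigma>" "0 \<le> err v w" "0 \<le> err w v" using n1 by (auto simp: B_def err_def)
      ultimately show ?thesis
        using n1 unfolding \<phi>_def by (simp flip: ennreal_plus)
    qed
    have main: "2 * loss F \<phi> + (\<integral>\<^sup>+v. \<integral>\<^sup>+w. \<integral>\<^sup>+\<sigma>. kern \<beta> k v w \<sigma> * (F v * F w * ennreal (B v w \<sigma>)) \<partial>sph \<partial>lborel \<partial>lborel)
      \<le> 2 * gain F \<phi> + (\<integral>\<^sup>+v. \<integral>\<^sup>+w. \<integral>\<^sup>+\<sigma>. kern \<beta> k v w \<sigma> * (F v * F w * ennreal (err v w + err w v)) \<partial>sph \<partial>lborel \<partial>lborel)"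
    proof -
      have "2 * loss F \<phi> + (\<integral>\<^sup>+v. \<integral>\<^sup>+w. \<integral>\<^sup>+\<sigma>. kern \<beta> k v w \<sigma> * (F v * F w * ennreal (B v w \<sigma>)) \<partial>sph \<partial>lborel \<partial>lborel)
        = (\<integral>\<^sup>+v. \<integral>\<^sup>+w. \<integral>\<^sup>+\<sigma>. kern \<beta> k v w \<sigma> * (F v * F w * (\<phi> v + \<phi> w + ennreal (B v w \<sigma>))) \<partial>sph \<partial>lborel \<partial>lborel)"
        by (subst two_loss) (simp_all add: nn_integral_add[symmetric] distrib_left)
      also have "\<dots> \<le> (\<integral>\<^sup>+v. \<integral>\<^sup>+w. \<integral>\<^sup>+\<sigma>. kern \<beta> k v w \<sigma> * (F v * F w * (\<phi> (post_v v w \<sigma>) + \<phi> (post_v_star v w \<sigma>) + ennreal (err v w + err w v))) \<partial>sph \<partial>lborel \<partial>lborel)"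
      proof (rule nn_integral_mono, rule nn_integral_mono)
        fix v w :: 'a
        show "(\<integral>\<^sup>+\<sigma>. kern \<beta> k v w \<sigma> * (F v * F w * (\<phi> v + \<phi> w + ennreal (B v w \<sigma>))) \<partial>sph)
          \<le> (\<integral>\<^sup>+\<sigma>. kern \<beta> k v w \<sigma> * (F v * F w * (\<phi> (post_v v w \<sigma>) + \<phi> (post_v_star v w \<sigma>) + ennreal (err v w + err w v))) \<partial>sph)"
          by (rule nn_integral_mono_AE, use AE_sph in eventually_elim) (intro mult_left_mono pointwise; simp)
      qed
      also have "\<dots> = 2 * gain F \<phi> + (\<integral>\<^sup>+v. \<integral>\<^sup>+w. \<integral>\<^sup>+\<sigma>. kern \<beta> k v w \<sigma> * (F v * F w * ennreal (err v w + err w v)) \<partial>sph \<partial>lborel \<partial>lborel)"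
        by (subst two_gain) (simp_all add: nn_integral_add[symmetric] distrib_left)
      finally show ?thesis .
    qed
    have errle: "(\<integral>\<^sup>+v. \<integral>\<^sup>+w. \<integral>\<^sup>+\<sigma>. kern \<beta> k v w \<sigma> * (F v * F w * ennreal (err v w + err w v)) \<partial>sph \<partial>lborel \<partial>lborel)
       \<le> ennreal C * fast_flux F (n / 2)"
    proof -
      define G where "G v = F v * ennreal (\<rho> v) * indicator {v. n / 2 \<le> (norm v)\<^sup>2} v" for v
      define H where "H v = F v * ennreal ((norm v)\<^sup>2)" for v
      have [measurable]: "G \<in> borel_measurable borel" "H \<in> borel_measurable borel"
        unfolding G_def H_def by measurable
      \<comment> \<open>An error arises only if \<open>w\<close> is the slower particle, so the
        relative speed is controlled by \<open>\<rho> v\<close> alone.\<close>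
      have sp: "norm (v - w) powr \<beta> * err v w \<le> 4 * (\<rho> v * indicator {v. n / 2 \<le> (norm v)\<^sup>2} v * (norm w)\<^sup>2)" for v w
      proof (cases "(norm w)\<^sup>2 \<le> (norm v)\<^sup>2 \<and> n / 2 \<le> (norm v)\<^sup>2")
        case True
        then have "norm w \<le> norm v" by (auto intro: power2_le_imp_le)
        then have "\<rho> w \<le> \<rho> v" unfolding \<rho>_def using beta by (intro powr_mono2) auto
        then have "norm (v - w) powr \<beta> \<le> 4 * \<rho> v" using rel_speed_le[of v w] by simp
        then have "norm (v - w) powr \<beta> * (norm w)\<^sup>2 \<le> 4 * \<rho> v * (norm w)\<^sup>2" by (intro mult_right_mono) auto
        then show ?thesis using True by (simp add: err_def)
      qed (auto simp: err_def)
      have sp2: "ennreal (norm (v - w) powr \<beta>) * ennreal (err v w + err w v)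
          \<le> 4 * (ennreal (\<rho> v) * indicator {v. n / 2 \<le> (norm v)\<^sup>2} v * ennreal ((norm w)\<^sup>2)
             + ennreal ((norm v)\<^sup>2) * (ennreal (\<rho> w) * indicator {v. n / 2 \<le> (norm v)\<^sup>2} w))" for v w
      proof -
        have i: "indicator S x = ennreal (indicator S x)" for S and x :: 'a by (simp add: indicator_def)
        have "norm (v - w) powr \<beta> * (err v w + err w v)
          \<le> 4 * (\<rho> v * indicator {v. n / 2 \<le> (norm v)\<^sup>2} v * (norm w)\<^sup>2 + (norm v)\<^sup>2 * (\<rho> w * indicator {v. n / 2 \<le> (norm v)\<^sup>2} w))"
          using sp[of v w] sp[of w v] by (simp add: norm_minus_commute[of w v] algebra_simps)
        then have "ennreal (norm (v - w) powr \<beta> * (err v w + err w v))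
          \<le> ennreal (4 * (\<rho> v * indicator {v. n / 2 \<le> (norm v)\<^sup>2} v * (norm w)\<^sup>2 + (norm v)\<^sup>2 * (\<rho> w * indicator {v. n / 2 \<le> (norm v)\<^sup>2} w)))"
          by (rule ennreal_leI)
        then show ?thesis
          by (simp add: err_def ennreal_mult i)
      qed
      have "(\<integral>\<^sup>+v. \<integral>\<^sup>+w. \<integral>\<^sup>+\<sigma>. kern \<beta> k v w \<sigma> * (F v * F w * ennreal (err v w + err w v)) \<partial>sph \<partial>lborel \<partial>lborel)
        = ennreal \<Lambda> * (\<integral>\<^sup>+v. \<integral>\<^sup>+w. F v * F w * (ennreal (norm (v - w) powr \<beta>) * ennreal (err v w + err w v)) \<partial>lborel \<partial>lborel)"
        by (simp add: nn_integral_multc nn_integral_kern mult.assoc nn_integral_cmult mult.left_commute[of "ennreal (norm _ powr _)"])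
      also have "\<dots> \<le> ennreal \<Lambda> * (\<integral>\<^sup>+v. \<integral>\<^sup>+w. 4 * (G v * H w + H v * G w) \<partial>lborel \<partial>lborel)"
      proof (intro mult_left_mono nn_integral_mono)
        fix v w
        have "F v * F w * (ennreal (norm (v - w) powr \<beta>) * ennreal (err v w + err w v))
          \<le> F v * F w * (4 * (ennreal (\<rho> v) * indicator {v. n / 2 \<le> (norm v)\<^sup>2} v * ennreal ((norm w)\<^sup>2)
             + ennreal ((norm v)\<^sup>2) * (ennreal (\<rho> w) * indicator {v. n / 2 \<le> (norm v)\<^sup>2} w)))"
          by (intro mult_left_mono sp2) auto
        also have "\<dots> = 4 * (G v * H w + H v * G w)"
          by (simp add: G_def H_def distrib_left mult_ac)
        finally show "F v * F w * (ennreal (norm (v - w) powr \<beta>) * ennreal (err v w + err w v)) \<le> 4 * (G v * H w + H v * G w)" .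
      qed auto
      also have "\<dots> = ennreal \<Lambda> * (4 * ((\<integral>\<^sup>+v. G v \<partial>lborel) * (\<integral>\<^sup>+v. H v \<partial>lborel) + (\<integral>\<^sup>+v. H v \<partial>lborel) * (\<integral>\<^sup>+v. G v \<partial>lborel)))"
        by (simp add: nn_integral_cmult nn_integral_add nn_integral_multc)
      also have "\<dots> = ennreal \<Lambda> * (4 * (2 * (ennreal E * fast_flux F (n / 2))))"
      proof -
        have "(\<integral>\<^sup>+v. G v \<partial>lborel) = fast_flux F (n / 2)" "(\<integral>\<^sup>+v. H v \<partial>lborel) = ennreal E"
          using FE by (simp_all add: G_def H_def fast_flux_def)
        then show ?thesis by (simp only: mult_2 mult.commute)
      qed
      also have "\<dots> = ennreal C * fast_flux F (n / 2)"
      proof -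
        have "ennreal C = 8 * ennreal \<Lambda> * ennreal E"
          using Lambda E by (simp add: C_def ennreal_mult)
        moreover have "(8::ennreal) = 4 * 2" by simp
        ultimately show ?thesis by (simp only: mult_ac)
      qed
      finally show ?thesis .
    qed
    have pos: "ennreal (c * n) * fast_flux F (K * n) \<le> (\<integral>\<^sup>+v. \<integral>\<^sup>+w. \<integral>\<^sup>+\<sigma>. kern \<beta> k v w \<sigma> * (F v * F w * ennreal (B v w \<sigma>)) \<partial>sph \<partial>lborel \<partial>lborel)"
    proof -
      have small: "ennreal (M / 2) \<le> (\<integral>\<^sup>+w. F w * indicator {w. (norm w)\<^sup>2 \<le> R} w \<partial>lborel)"
      proof -
        have "ennreal R * (\<integral>\<^sup>+w. F w * indicator {w. R < (norm w)\<^sup>2} w \<partial>lborel) = (\<integral>\<^sup>+w. ennreal R * (F w * indicator {w. R < (norm w)\<^sup>2} w) \<partial>lborel)"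
          by (simp add: nn_integral_cmult)
        also have "\<dots> \<le> (\<integral>\<^sup>+w. F w * ennreal ((norm w)\<^sup>2) \<partial>lborel)"
        proof (intro nn_integral_mono)
          fix w :: 'a
          show "ennreal R * (F w * indicator {w. R < (norm w)\<^sup>2} w) \<le> F w * ennreal ((norm w)\<^sup>2)"
            by (auto simp: indicator_def mult.commute[of "ennreal R"] intro!: mult_left_mono ennreal_leI)
        qed
        also have "\<dots> = ennreal E" by (rule FE)
        finally have 1: "ennreal R * (\<integral>\<^sup>+w. F w * indicator {w. R < (norm w)\<^sup>2} w \<partial>lborel) \<le> ennreal E" .
        have 2: "(\<integral>\<^sup>+w. F w * indicator {w. R < (norm w)\<^sup>2} w \<partial>lborel) + (\<integral>\<^sup>+w. F w * indicator {w. (norm w)\<^sup>2 \<le> R} w \<partial>lborel) = ennreal M"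
          unfolding FM[symmetric]
          by (subst nn_integral_add[symmetric]) (auto intro!: nn_integral_cong simp: indicator_def)
        obtain p where p: "0 \<le> p" "(\<integral>\<^sup>+w. F w * indicator {w. R < (norm w)\<^sup>2} w \<partial>lborel) = ennreal p"
          using 2 by (cases "\<integral>\<^sup>+w. F w * indicator {w. R < (norm w)\<^sup>2} w \<partial>lborel") (auto simp: top_add)
        obtain q where q: "0 \<le> q" "(\<integral>\<^sup>+w. F w * indicator {w. (norm w)\<^sup>2 \<le> R} w \<partial>lborel) = ennreal q"
          using 2 by (cases "\<integral>\<^sup>+w. F w * indicator {w. (norm w)\<^sup>2 \<le> R} w \<partial>lborel") (auto simp: top_add)
        have "R * p \<le> E" using 1 p R E by (simp add: ennreal_mult[symmetric])
        also have "E \<le> R * (M / 2)" using M by (simp add: R_def)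
        finally have "p \<le> M / 2" using R by simp
        moreover have "p + q = M" using 2 p q M by (simp flip: ennreal_plus)
        ultimately show ?thesis unfolding q(2) by (intro ennreal_leI) simp
      qed
      have inner: "ennreal (l0 / 8 * n) * (F v * ennreal (\<rho> v) * indicator {v. K * n \<le> (norm v)\<^sup>2} v * (F w * indicator {w. (norm w)\<^sup>2 \<le> R} w))
          \<le> (\<integral>\<^sup>+\<sigma>. kern \<beta> k v w \<sigma> * (F v * F w * ennreal (B v w \<sigma>)) \<partial>sph)" for v w
      proof (cases "A v w")
        case False
        then show ?thesis by (auto simp: A_def indicator_def)
      next
        case True
        have "\<rho> v / 4 \<le> norm (v - w) powr \<beta>"
          using rho_le_rel_speed[of v w] far(2)[OF True] by simp
        then have "l0 / 8 * n * \<rho> v \<le> norm (v - w) powr \<beta> * (l0 * (n / 2))"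
          using mult_left_mono[of "\<rho> v / 4" "norm (v - w) powr \<beta>" "l0 * n / 2"] \<delta> n1 by (simp add: field_simps)
        then have "ennreal (l0 / 8 * n * \<rho> v) \<le> ennreal (norm (v - w) powr \<beta> * (l0 * (n / 2)))"
          by (rule ennreal_leI)
        then have 1: "ennreal (l0 / 8 * n) * ennreal (\<rho> v) \<le> ennreal (norm (v - w) powr \<beta>) * (ennreal l0 * ennreal (n / 2))"
        proof -
          have "ennreal (l0 / 8 * n) * ennreal (\<rho> v) = ennreal (l0 / 8 * n * \<rho> v)"
            using \<delta> n1 by (intro ennreal_mult[symmetric]) auto
          moreover have "ennreal (norm (v - w) powr \<beta>) * (ennreal l0 * ennreal (n / 2)) = ennreal (norm (v - w) powr \<beta> * (l0 * (n / 2)))"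
          proof -
            have "ennreal (l0 * (n / 2)) = ennreal l0 * ennreal (n / 2)"
              using \<delta> n1 by (intro ennreal_mult) auto
            moreover have "ennreal (norm (v - w) powr \<beta> * (l0 * (n / 2))) = ennreal (norm (v - w) powr \<beta>) * ennreal (l0 * (n / 2))"
              using \<delta> n1 by (intro ennreal_mult) auto
            ultimately show ?thesis by simp
          qed
          ultimately show ?thesis
            using \<open>ennreal (l0 / 8 * n * \<rho> v) \<le> ennreal (norm (v - w) powr \<beta> * (l0 * (n / 2)))\<close> by simp
        qed
        have "ennreal (l0 / 8 * n) * (F v * ennreal (\<rho> v) * indicator {v. K * n \<le> (norm v)\<^sup>2} v * (F w * indicator {w. (norm w)\<^sup>2 \<le> R} w))
          = (ennreal (l0 / 8 * n) * ennreal (\<rho> v)) * (F v * F w)"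
          using True by (simp add: A_def mult_ac)
        also have "\<dots> \<le> (ennreal (norm (v - w) powr \<beta>) * (ennreal l0 * ennreal (n / 2))) * (F v * F w)"
          by (intro mult_right_mono 1) auto
        also have "\<dots> \<le> (ennreal (norm (v - w) powr \<beta>) * ((\<integral>\<^sup>+\<sigma>. k (cos_theta v w \<sigma>) * indicator {z. \<bar>z\<bar> \<le> 1 - 2 * \<delta>} (cos_theta v w \<sigma>) \<partial>sph) * ennreal (n / 2))) * (F v * F w)"
          unfolding cos_theta_def using far(3)[OF True] by (intro mult_right_mono mult_left_mono mid) auto
        also have "\<dots> = (\<integral>\<^sup>+\<sigma>. (ennreal (norm (v - w) powr \<beta>) * (k (cos_theta v w \<sigma>) * indicator {z. \<bar>z\<bar> \<le> 1 - 2 * \<delta>} (cos_theta v w \<sigma>) * ennreal (n / 2))) * (F v * F w) \<partial>sph)"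
          by (simp add: nn_integral_cmult nn_integral_multc)
        also have "\<dots> = (\<integral>\<^sup>+\<sigma>. kern \<beta> k v w \<sigma> * (F v * F w * ennreal (B v w \<sigma>)) \<partial>sph)"
          using True by (intro nn_integral_cong) (auto simp: kern_def B_def indicator_def mult_ac)
        finally show ?thesis .
      qed
      have "ennreal (c * n) * fast_flux F (K * n) = ennreal (l0 / 8 * n) * (fast_flux F (K * n) * ennreal (M / 2))"
      proof -
        have "ennreal (c * n) = ennreal (l0 / 8 * n) * ennreal (M / 2)"
          using \<delta> n1 M by (simp add: c_def ennreal_mult[symmetric])
        then show ?thesis by (simp only: mult_ac)
      qed
      also have "\<dots> \<le> ennreal (l0 / 8 * n) * (fast_flux F (K * n) * (\<integral>\<^sup>+w. F w * indicator {w. (norm w)\<^sup>2 \<le> R} w \<partial>lborel))"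
        by (intro mult_left_mono small) auto
      also have "\<dots> = (\<integral>\<^sup>+v. \<integral>\<^sup>+w. ennreal (l0 / 8 * n) * (F v * ennreal (\<rho> v) * indicator {v. K * n \<le> (norm v)\<^sup>2} v * (F w * indicator {w. (norm w)\<^sup>2 \<le> R} w)) \<partial>lborel \<partial>lborel)"
        unfolding fast_flux_def by (simp add: nn_integral_cmult nn_integral_multc)
      also have "\<dots> \<le> (\<integral>\<^sup>+v. \<integral>\<^sup>+w. \<integral>\<^sup>+\<sigma>. kern \<beta> k v w \<sigma> * (F v * F w * ennreal (B v w \<sigma>)) \<partial>sph \<partial>lborel \<partial>lborel)"
        by (intro nn_integral_mono inner)
      finally show ?thesis .
    qed
    show "2 * loss F (\<lambda>v. ennreal (min ((norm v)\<^sup>2) n)) + ennreal (c * n) * fast_flux F (K * n)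
       \<le> 2 * gain F (\<lambda>v. ennreal (min ((norm v)\<^sup>2) n)) + ennreal C * fast_flux F (n / 2)"
      unfolding \<phi>_def[symmetric]
      by (rule order_trans[OF add_left_mono[OF pos] order_trans[OF main add_left_mono[OF errle]]])
  qed
qed

end

section \<open>Weak form and tail energies\<close>

text \<open>Layer-cake bound over the dyadic shells \<open>2 ^ j * n1 \<le> x < 2 ^ Suc j * n1\<close>.\<close>
lemma moment_from_tail:
  fixes x :: "'x \<Rightarrow> real" and C p q G n1 :: real
  assumes [measurable]: "x \<in> borel_measurable N" and x: "\<And>y. 0 \<le> x y"
    and q: "0 \<le> q" "q < p" and n1: "1 \<le> n1" and C: "0 \<le> C" and G: "0 \<le> G"
  obtains B :: real where "\<And>g. g \<in> borel_measurable N \<Longrightarrow> (\<integral>\<^sup>+y. g y \<partial>N) \<le> ennreal G \<Longrightarrow>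
     (\<And>n. n1 \<le> n \<Longrightarrow> (\<integral>\<^sup>+y. g y * indicator {y. n \<le> x y} y \<partial>N) \<le> ennreal (C * n powr (- p))) \<Longrightarrow>
     (\<integral>\<^sup>+y. g y * ennreal (x y powr q) \<partial>N) \<le> ennreal B"
proof -
  define a where "a j = 2 ^ j * n1" for j :: nat
  have a: "1 \<le> a j" "n1 \<le> a j" "0 < a j" for j
  proof -
    have "1 * n1 \<le> 2 ^ j * n1" using n1 by (intro mult_right_mono) auto
    then have "n1 \<le> a j" by (simp add: a_def)
    then show "1 \<le> a j" "n1 \<le> a j" "0 < a j" using n1 by auto
  qed
  \<comment> \<open>The ratio of the geometric series over the shells; \<open>q < p\<close> makes it
    less than 1.\<close>
  define z where "z = (2::real) powr (q - p)"
  have z: "0 < z" "z < 1" using q powr_less_mono[of "q - p" 0 2] by (auto simp: z_def)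
  define c1 where "c1 = C * 2 powr q * n1 powr (q - p)"
  have c1: "0 \<le> c1" using C by (simp add: c1_def)
  have term_eq: "(a (Suc j)) powr q * (C * (a j) powr (- p)) = c1 * z ^ j" for j
  proof -
    have "a (Suc j) powr q = 2 powr q * (a j) powr q"
      using a[of j] by (simp add: a_def powr_mult mult.assoc)
    then have "(a (Suc j)) powr q * (C * (a j) powr (- p)) = C * 2 powr q * (a j) powr (q - p)"
      by (simp add: powr_diff powr_minus divide_inverse)
    also have "(a j) powr (q - p) = (2 ^ j) powr (q - p) * n1 powr (q - p)"
      using n1 by (simp add: a_def powr_mult)
    also have "(2 ^ j) powr (q - p) = z ^ j"
    proof -
      have "((2::real) ^ j) powr (q - p) = (2 powr real j) powr (q - p)" by (simp add: powr_realpow)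
      also have "\<dots> = (2 powr (q - p)) powr real j" by (simp add: powr_powr mult.commute)
      also have "\<dots> = z ^ j" using z by (simp add: z_def powr_realpow)
      finally show ?thesis .
    qed
    finally show ?thesis by (simp add: c1_def mult_ac)
  qed
  have pw: "ennreal (x y powr q) \<le> ennreal (n1 powr q) + (\<Sum>j. ennreal ((a (Suc j)) powr q) * indicator {y. a j \<le> x y} y)" for y
  proof (cases "x y < n1")
    case True
    then have "ennreal (x y powr q) \<le> ennreal (n1 powr q)"
      using x[of y] q by (intro ennreal_leI powr_mono2) auto
    then show ?thesis by (rule order_trans) simp
  next
    case False
    obtain m :: nat where m: "x y < 2 ^ m" using real_arch_pow[of 2 "x y"] by auto
    have ex: "x y < a m" 
    proof -
      have "2 ^ m * 1 \<le> a m" unfolding a_def using n1 by (intro mult_left_mono) auto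
      then show ?thesis using m by simp
    qed
    define j where "j = (LEAST j. x y < a j)"
    have j: "x y < a j" unfolding j_def by (rule LeastI[of "\<lambda>j. x y < a j", OF ex])
    have "j \<noteq> 0"
    proof
      assume "j = 0"
      then have "x y < n1" using j by (simp add: a_def)
      then show False using False by simp
    qed
    then obtain i where i: "j = Suc i" by (cases j) auto
    have "\<not> x y < a i" using not_less_Least[of i "\<lambda>j. x y < a j"] i by (simp add: j_def)
    then have ai: "a i \<le> x y" by simp
    have "ennreal (x y powr q) \<le> ennreal ((a (Suc i)) powr q)"
      using x[of y] q j i by (intro ennreal_leI powr_mono2) auto
    also have "\<dots> = ennreal ((a (Suc i)) powr q) * indicator {y. a i \<le> x y} y" using ai by simp
    also have "\<dots> \<le> (\<Sum>j. ennreal ((a (Suc j)) powr q) * indicator {y. a j \<le> x y} y)"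
    proof -
      have "h i \<le> (\<Sum>j. h j)" for h :: "nat \<Rightarrow> ennreal"
        using sum_le_suminf[of h "{i}"] by simp
      then show ?thesis .
    qed
    also have "\<dots> \<le> ennreal (n1 powr q) + \<dots>" by simp
    finally show ?thesis .
  qed
  \<comment> \<open>The bound contains only the data of the tail hypothesis, so one \<open>B\<close>
    serves every \<open>g\<close>; below it is uniform over a time interval.\<close>
  have "(\<integral>\<^sup>+y. g y * ennreal (x y powr q) \<partial>N) \<le> ennreal (n1 powr q * G + c1 * (1 / (1 - z)))"
    if [measurable]: "g \<in> borel_measurable N" and gG: "(\<integral>\<^sup>+y. g y \<partial>N) \<le> ennreal G"
      and tail: "\<And>n. n1 \<le> n \<Longrightarrow> (\<integral>\<^sup>+y. g y * indicator {y. n \<le> x y} y \<partial>N) \<le> ennreal (C * n powr (- p))" for g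
  proof -
    have "(\<integral>\<^sup>+y. g y * ennreal (x y powr q) \<partial>N)
      \<le> (\<integral>\<^sup>+y. g y * (ennreal (n1 powr q) + (\<Sum>j. ennreal ((a (Suc j)) powr q) * indicator {y. a j \<le> x y} y)) \<partial>N)"
      by (intro nn_integral_mono mult_left_mono pw) auto
    also have "\<dots> = (\<integral>\<^sup>+y. ennreal (n1 powr q) * g y + (\<Sum>j. ennreal ((a (Suc j)) powr q) * (g y * indicator {y. a j \<le> x y} y)) \<partial>N)"
    proof (rule nn_integral_cong)
      fix y
      have "(\<Sum>j. ennreal ((a (Suc j)) powr q) * (g y * indicator {y. a j \<le> x y} y))
        = (\<Sum>j. g y * (ennreal ((a (Suc j)) powr q) * indicator {y. a j \<le> x y} y))"
        by (intro suminf_cong) (rule mult.left_commute)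
      then show "g y * (ennreal (n1 powr q) + (\<Sum>j. ennreal ((a (Suc j)) powr q) * indicator {y. a j \<le> x y} y))
        = ennreal (n1 powr q) * g y + (\<Sum>j. ennreal ((a (Suc j)) powr q) * (g y * indicator {y. a j \<le> x y} y))"
        by (simp only: distrib_left ennreal_suminf_cmult mult.commute)
    qed
    also have "\<dots> = ennreal (n1 powr q) * (\<integral>\<^sup>+y. g y \<partial>N) + (\<Sum>j. ennreal ((a (Suc j)) powr q) * (\<integral>\<^sup>+y. g y * indicator {y. a j \<le> x y} y \<partial>N))"
      by (simp add: nn_integral_add nn_integral_cmult nn_integral_suminf)
    also have "\<dots> \<le> ennreal (n1 powr q) * ennreal G + (\<Sum>j. ennreal (c1 * z ^ j))"
    proof (intro add_mono mult_left_mono gG suminf_le)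
      fix j
      have "ennreal ((a (Suc j)) powr q) * (\<integral>\<^sup>+y. g y * indicator {y. a j \<le> x y} y \<partial>N)
        \<le> ennreal ((a (Suc j)) powr q) * ennreal (C * (a j) powr (- p))"
        using a by (intro mult_left_mono tail) auto
      also have "\<dots> = ennreal (c1 * z ^ j)"
        unfolding term_eq[symmetric] using C by (intro ennreal_mult[symmetric]) auto
      finally show "ennreal ((a (Suc j)) powr q) * (\<integral>\<^sup>+y. g y * indicator {y. a j \<le> x y} y \<partial>N) \<le> ennreal (c1 * z ^ j)" .
    qed auto
    also have "(\<Sum>j. ennreal (c1 * z ^ j)) = ennreal (c1 * (1 / (1 - z)))"
      using c1 z by (subst suminf_ennreal2) (auto simp: suminf_mult suminf_geometric intro!: summable_mult summable_geometric)
    also have "ennreal (n1 powr q) * ennreal G + ennreal (c1 * (1 / (1 - z))) = ennreal (n1 powr q * G + c1 * (1 / (1 - z)))"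
      using c1 z G by (simp add: ennreal_mult ennreal_plus)
    finally show ?thesis .
  qed
  then show thesis by (rule that)
qed

section \<open>Weak form, conservation of mass, and decay of excess energies\<close>

context boltzmann_flow
begin

text \<open>Gain and loss are placed on opposite sides before the weight is applied, so Tonelli
  suffices and either side may be infinite.\<close>

lemma weak_form:
  assumes t: "0 \<le> t0" "t0 \<le> t" and [measurable]: "\<phi> \<in> borel_measurable borel"
  shows "(\<integral>\<^sup>+v. F t v * \<phi> v \<partial>lborel) + (\<integral>\<^sup>+\<tau>. loss (F \<tau>) \<phi> * indicator {t0<..t} \<tau> \<partial>lborel)
    = (\<integral>\<^sup>+v. F t0 v * \<phi> v \<partial>lborel) + (\<integral>\<^sup>+\<tau>. gain (F \<tau>) \<phi> * indicator {t0<..t} \<tau> \<partial>lborel)"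
proof -
  have split: "(\<integral>\<^sup>+\<tau>. G \<tau> * indicator {0..t} \<tau> \<partial>lborel)
     = (\<integral>\<^sup>+\<tau>. G \<tau> * indicator {0..t0} \<tau> \<partial>lborel) + (\<integral>\<^sup>+\<tau>. G \<tau> * indicator {t0<..t} \<tau> \<partial>lborel)"
    if [measurable]: "G \<in> borel_measurable borel" for G :: "real \<Rightarrow> ennreal"
    by (subst nn_integral_add[symmetric]) (use t in \<open>auto intro!: nn_integral_cong simp: indicator_def\<close>)
  have pw: "AE v in lborel. F t v + (\<integral>\<^sup>+\<tau>. Qm (F \<tau>) v * indicator {t0<..t} \<tau> \<partial>lborel)
    = F t0 v + (\<integral>\<^sup>+\<tau>. Qp (F \<tau>) v * indicator {t0<..t} \<tau> \<partial>lborel)"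
    using mild_form_pointwise[OF order_trans[OF t]] mild_form_pointwise[OF t(1)]
  proof eventually_elim
    fix v :: 'a
    let ?I = "\<lambda>G S. \<integral>\<^sup>+\<tau>. G (F \<tau>) v * indicator S \<tau> \<partial>lborel"
    assume "?I Qp {0..t} < \<infinity> \<and> ?I Qm {0..t} < \<infinity> \<and> f t v = f0 v + (enn2real (?I Qp {0..t}) - enn2real (?I Qm {0..t}))"
      and "?I Qp {0..t0} < \<infinity> \<and> ?I Qm {0..t0} < \<infinity> \<and> f t0 v = f0 v + (enn2real (?I Qp {0..t0}) - enn2real (?I Qm {0..t0}))"
    note 1 = this
    \<comment> \<open>Splitting the time integrals at \<open>t0\<close> lets the mild forms at
      \<open>t\<close> and \<open>t0\<close> be subtracted as identities between finite
      reals.\<close>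
    have sp: "?I Qp {0..t} = ?I Qp {0..t0} + ?I Qp {t0<..t}" "?I Qm {0..t} = ?I Qm {0..t0} + ?I Qm {t0<..t}"
      by (rule split; measurable)+
    with 1 have fin: "?I Qp {t0<..t} < top" "?I Qm {t0<..t} < top" by auto
    obtain p0 where p0: "0 \<le> p0" "?I Qp {0..t0} = ennreal p0" using 1 by (cases "?I Qp {0..t0}") auto
    obtain p1 where p1: "0 \<le> p1" "?I Qp {t0<..t} = ennreal p1" using fin by (cases "?I Qp {t0<..t}") auto
    obtain m0 where m0: "0 \<le> m0" "?I Qm {0..t0} = ennreal m0" using 1 by (cases "?I Qm {0..t0}") auto
    obtain m1 where m1: "0 \<le> m1" "?I Qm {t0<..t} = ennreal m1" using fin by (cases "?I Qm {t0<..t}") auto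
    have "f t v + m1 = f t0 v + p1"
      using 1 unfolding sp p0(2) p1(2) m0(2) m1(2) using p0(1) p1(1) m0(1) m1(1) by (simp flip: ennreal_plus)
    moreover have "0 \<le> f t v" "0 \<le> f t0 v" using f_nonneg t by auto
    ultimately show "F t v + ?I Qm {t0<..t} = F t0 v + ?I Qp {t0<..t}"
      unfolding p1(2) m1(2) F_def using t p1(1) m1(1) by (simp add: max_absorb2 flip: ennreal_plus)
  qed
  have fub: "(\<integral>\<^sup>+v. (\<integral>\<^sup>+\<tau>. G (F \<tau>) v * indicator {t0<..t} \<tau> \<partial>lborel) * \<phi> v \<partial>lborel)
     = (\<integral>\<^sup>+\<tau>. (\<integral>\<^sup>+v. G (F \<tau>) v * \<phi> v \<partial>lborel) * indicator {t0<..t} \<tau> \<partial>lborel)"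
    if [measurable]: "(\<lambda>(\<tau>, v). G (F \<tau>) v) \<in> borel_measurable (borel \<Otimes>\<^sub>M borel)" for G
  proof -
    have "(\<integral>\<^sup>+v. (\<integral>\<^sup>+\<tau>. G (F \<tau>) v * indicator {t0<..t} \<tau> \<partial>lborel) * \<phi> v \<partial>lborel)
      = (\<integral>\<^sup>+v. \<integral>\<^sup>+\<tau>. G (F \<tau>) v * indicator {t0<..t} \<tau> * \<phi> v \<partial>lborel \<partial>lborel)"
      by (simp add: nn_integral_multc)
    also have "\<dots> = (\<integral>\<^sup>+\<tau>. \<integral>\<^sup>+v. G (F \<tau>) v * indicator {t0<..t} \<tau> * \<phi> v \<partial>lborel \<partial>lborel)"
      by (rule lborel_pair.Fubini') measurable
    also have "\<dots> = (\<integral>\<^sup>+\<tau>. \<integral>\<^sup>+v. G (F \<tau>) v * \<phi> v * indicator {t0<..t} \<tau> \<partial>lborel \<partial>lborel)"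
      by (simp only: mult_ac)
    also have "\<dots> = (\<integral>\<^sup>+\<tau>. (\<integral>\<^sup>+v. G (F \<tau>) v * \<phi> v \<partial>lborel) * indicator {t0<..t} \<tau> \<partial>lborel)"
      by (simp add: nn_integral_multc)
    finally show ?thesis .
  qed
  have "(\<integral>\<^sup>+v. (F t v + (\<integral>\<^sup>+\<tau>. Qm (F \<tau>) v * indicator {t0<..t} \<tau> \<partial>lborel)) * \<phi> v \<partial>lborel)
     = (\<integral>\<^sup>+v. (F t0 v + (\<integral>\<^sup>+\<tau>. Qp (F \<tau>) v * indicator {t0<..t} \<tau> \<partial>lborel)) * \<phi> v \<partial>lborel)"
    by (rule nn_integral_cong_AE, use pw in eventually_elim) simp
  then have "(\<integral>\<^sup>+v. F t v * \<phi> v \<partial>lborel) + (\<integral>\<^sup>+v. (\<integral>\<^sup>+\<tau>. Qm (F \<tau>) v * indicator {t0<..t} \<tau> \<partial>lborel) * \<phi> v \<partial>lborel)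
     = (\<integral>\<^sup>+v. F t0 v * \<phi> v \<partial>lborel) + (\<integral>\<^sup>+v. (\<integral>\<^sup>+\<tau>. Qp (F \<tau>) v * indicator {t0<..t} \<tau> \<partial>lborel) * \<phi> v \<partial>lborel)"
    by (simp add: distrib_right nn_integral_add)
  then show ?thesis
    by (simp add: fub nn_integral_Qp nn_integral_Qm case_prod_beta)
qed

text \<open>The weight 1 has equal gain and loss, and that common integral is finite and cancels. At
  time 0 the mild form integrates over a single instant, so \<open>f 0\<close> equals
  \<open>f0\<close> almost everywhere.\<close>

lemma F_mass: "(\<integral>\<^sup>+v. F t v \<partial>lborel) = ennreal mass"
proof -
  have "AE v in lborel. F 0 v = ennreal (f0 v)"
    using f_eq[of 0, simplified]
  proof eventually_elim
    case (elim v)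
    have "(\<integral>\<tau>\<in>{0}. collision_op (\<lambda>r z. r powr \<beta> * b z) (f \<tau>) v \<partial>lborel) = 0"
      unfolding set_lebesgue_integral_def
      by (rule integral_eq_zero_AE, use AE_lborel_singleton[of "0::real"] in eventually_elim) simp
    then show ?case using elim by (simp add: F_def)
  qed
  then have "(\<integral>\<^sup>+v. F 0 v \<partial>lborel) = (\<integral>\<^sup>+v. ennreal (f0 v) \<partial>lborel)"
    by (rule nn_integral_cong_AE)
  also have "\<dots> = ennreal mass"
    unfolding f0_mass[symmetric] using f0_nonneg by (intro nn_integral_eq_integral f0_integrable) auto
  finally have 0: "(\<integral>\<^sup>+v. F 0 v \<partial>lborel) = ennreal mass" .
  have "(\<integral>\<^sup>+v. F (max 0 t) v \<partial>lborel) = (\<integral>\<^sup>+v. F 0 v \<partial>lborel)"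
  proof -
    let ?L = "\<integral>\<^sup>+\<tau>. loss (F \<tau>) (\<lambda>_. 1) * indicator {0<..max 0 t} \<tau> \<partial>lborel"
    have "?L \<le> (\<integral>\<^sup>+\<tau>. loss (F \<tau>) (\<lambda>_. 1) * indicator {0..max 0 t} \<tau> \<partial>lborel)"
      by (intro nn_integral_mono mult_left_mono indicator_leI) auto
    also have "\<dots> < \<infinity>" by (rule loss_one_integral) simp
    finally have "?L \<noteq> top" by simp
    moreover have "(\<integral>\<^sup>+v. F (max 0 t) v \<partial>lborel) + ?L = (\<integral>\<^sup>+v. F 0 v \<partial>lborel) + ?L"
      using weak_form[of 0 "max 0 t" "\<lambda>_. 1"] by (simp add: gain_one)
    ultimately show ?thesis
      using ennreal_add_left_cancel[of ?L] by (simp add: add.commute[of _ ?L])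
  qed
  moreover have "F (max 0 t) = F t" by (simp add: F_def fun_eq_iff)
  ultimately show ?thesis using 0 by simp
qed

definition excess_energy :: "real \<Rightarrow> real \<Rightarrow> ennreal" where
  "excess_energy t n = (\<integral>\<^sup>+v. F t v * ennreal (max 0 ((norm v)\<^sup>2 - n)) \<partial>lborel)"

lemma excess_energy_plus_min:
  assumes "0 \<le> n"
  shows "excess_energy t n + (\<integral>\<^sup>+v. F t v * ennreal (min ((norm v)\<^sup>2) n) \<partial>lborel) = ennreal energy"
proof -
  have "ennreal (max 0 (x - n)) + ennreal (min x n) = ennreal x" if "0 \<le> x" for x
    using that assms by (auto simp: max_def min_def simp flip: ennreal_plus)
  then show ?thesis
    unfolding excess_energy_def F_energy[of t, symmetric]
    by (subst nn_integral_add[symmetric]) (simp_all add: distrib_left[symmetric])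
qed

lemma excess_energy_le_energy:
  assumes "0 \<le> n"
  shows "excess_energy t n \<le> ennreal energy"
  unfolding excess_energy_plus_min[OF assms, of t, symmetric] by simp

lemma measurable_fast_flux[measurable]: "(\<lambda>t. fast_flux (F t) n) \<in> borel_measurable borel"
  unfolding fast_flux_def by measurable

text \<open>For energies above \<open>n \<ge> 1\<close>, \<open>\<rho>\<close> is at most the
  energy, and the energy is at most twice its excess over \<open>n / 2\<close>.\<close>

lemma fast_flux_le_excess_energy:
  assumes "1 \<le> n"
  shows "fast_flux (F t) n \<le> 2 * excess_energy t (n / 2)"
proof -
  have "fast_flux (F t) n \<le> (\<integral>\<^sup>+v. 2 * (F t v * ennreal (max 0 ((norm v)\<^sup>2 - n / 2))) \<partial>lborel)"
    unfolding fast_flux_def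
  proof (rule nn_integral_mono)
    fix v :: 'a
    show "F t v * ennreal (\<rho> v) * indicator {v. n \<le> (norm v)\<^sup>2} v \<le> 2 * (F t v * ennreal (max 0 ((norm v)\<^sup>2 - n / 2)))"
    proof (cases "n \<le> (norm v)\<^sup>2")
      case True
      then have "1 \<le> (norm v)\<^sup>2" using assms by simp
      then have v1: "1 \<le> norm v" by (intro power2_le_imp_le[of 1]) simp_all
      have "\<rho> v \<le> norm v powr 2" unfolding \<rho>_def using beta v1 by (intro powr_mono) auto
      also have "\<dots> = (norm v)\<^sup>2" using v1 by simp
      also have "\<dots> \<le> 2 * max 0 ((norm v)\<^sup>2 - n / 2)"
        using True max.cobounded2[of "(norm v)\<^sup>2 - n / 2" 0] by argo
      finally have "ennreal (\<rho> v) \<le> ennreal (2 * max 0 ((norm v)\<^sup>2 - n / 2))" by (rule ennreal_leI)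
      also have "\<dots> = 2 * ennreal (max 0 ((norm v)\<^sup>2 - n / 2))" by (simp add: ennreal_mult)
      finally show ?thesis using True
        by (simp add: mult.left_commute[of 2] mult_left_mono)
    qed simp
  qed
  also have "\<dots> = 2 * excess_energy t (n / 2)"
    unfolding excess_energy_def by (simp add: nn_integral_cmult)
  finally show ?thesis .
qed

text \<open>The Povzner estimate is integrated in time against the weak form, and conservation of
  energy converts the truncated energy into the excess.\<close>

lemma tail_inequality:
  assumes "0 < mass"
  obtains K n0 c C :: real where "1 \<le> K" "1 \<le> n0" "0 < c" "0 \<le> C"
    "\<And>n t0 t. n0 \<le> n \<Longrightarrow> 0 \<le> t0 \<Longrightarrow> t0 \<le> t \<Longrightarrow>
      2 * excess_energy t n + ennreal (c * n) * (\<integral>\<^sup>+\<tau>. fast_flux (F \<tau>) (K * n) * indicator {t0<..t} \<tau> \<partial>lborel)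
      \<le> 2 * excess_energy t0 n + ennreal C * (\<integral>\<^sup>+\<tau>. fast_flux (F \<tau>) (n / 2) * indicator {t0<..t} \<tau> \<partial>lborel)"
proof (rule concave_povzner[OF assms energy_nonneg])
  fix K n0 c C :: real assume *: "1 \<le> K" "1 \<le> n0" "0 < c" "0 \<le> C"
    and pov: "\<And>F n. F \<in> borel_measurable borel \<Longrightarrow> (\<integral>\<^sup>+v. F v \<partial>lborel) = ennreal mass \<Longrightarrow>
      (\<integral>\<^sup>+v. F v * ennreal ((norm v)\<^sup>2) \<partial>lborel) = ennreal energy \<Longrightarrow> n0 \<le> n \<Longrightarrow>
      2 * loss F (\<lambda>v. ennreal (min ((norm v)\<^sup>2) n)) + ennreal (c * n) * fast_flux F (K * n)
       \<le> 2 * gain F (\<lambda>v. ennreal (min ((norm v)\<^sup>2) n)) + ennreal C * fast_flux F (n / 2)"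
  show thesis
  proof (rule that[OF *])
    fix n t0 t :: real assume n: "n0 \<le> n" and t: "0 \<le> t0" "t0 \<le> t"
    define \<psi> where "\<psi> v = ennreal (min ((norm v)\<^sup>2) n)" for v :: 'a
    have [measurable]: "\<psi> \<in> borel_measurable borel" unfolding \<psi>_def by measurable
    let ?J = "\<lambda>G. \<integral>\<^sup>+\<tau>. G \<tau> * indicator {t0<..t} \<tau> \<partial>lborel"
    define L where "L = ?J (\<lambda>\<tau>. loss (F \<tau>) \<psi>)"
    define G where "G = ?J (\<lambda>\<tau>. gain (F \<tau>) \<psi>)"
    define D1 where "D1 = ?J (\<lambda>\<tau>. fast_flux (F \<tau>) (K * n))"
    define D2 where "D2 = ?J (\<lambda>\<tau>. fast_flux (F \<tau>) (n / 2))"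
    define P where "P s = (\<integral>\<^sup>+v. F s v * \<psi> v \<partial>lborel)" for s
    have W: "P t + L = P t0 + G"
      unfolding P_def L_def G_def by (rule weak_form) (use t in auto)
    have AP: "excess_energy s n + P s = ennreal energy" for s
      unfolding P_def \<psi>_def using n * by (intro excess_energy_plus_min) auto
    have "2 * L + ennreal (c * n) * D1 = ?J (\<lambda>\<tau>. 2 * loss (F \<tau>) \<psi> + ennreal (c * n) * fast_flux (F \<tau>) (K * n))"
      unfolding L_def D1_def by (simp add: distrib_right mult.assoc nn_integral_add nn_integral_cmult)
    also have "\<dots> \<le> ?J (\<lambda>\<tau>. 2 * gain (F \<tau>) \<psi> + ennreal C * fast_flux (F \<tau>) (n / 2))"
      unfolding \<psi>_def by (intro nn_integral_mono mult_right_mono pov F_mass F_energy n) auto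
    also have "\<dots> = 2 * G + ennreal C * D2"
      unfolding G_def D2_def by (simp add: distrib_right mult.assoc nn_integral_add nn_integral_cmult)
    finally have S: "2 * L + ennreal (c * n) * D1 \<le> 2 * G + ennreal C * D2" .
    \<comment> \<open>The weight is at most \<open>n\<close>, so its loss is at most
      \<open>n\<close> times the finite collision count. This finiteness permits the cancellation
      that ends the proof.\<close>
    have "L \<le> ?J (\<lambda>\<tau>. ennreal n * loss (F \<tau>) (\<lambda>_. 1))"
      unfolding L_def
    proof (intro nn_integral_mono mult_right_mono)
      fix \<tau>
      have "loss (F \<tau>) \<psi> \<le> loss (F \<tau>) (\<lambda>_. ennreal n)"
        unfolding loss_def \<psi>_def by (intro nn_integral_mono mult_left_mono ennreal_leI) auto
      also have "\<dots> = ennreal n * loss (F \<tau>) (\<lambda>_. 1)"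
        unfolding loss_def by (simp add: nn_integral_cmult[symmetric]) (simp add: mult_ac)
      finally show "loss (F \<tau>) \<psi> \<le> ennreal n * loss (F \<tau>) (\<lambda>_. 1)" .
    qed simp
    also have "\<dots> = ennreal n * ?J (\<lambda>\<tau>. loss (F \<tau>) (\<lambda>_. 1))"
      by (simp add: mult.assoc nn_integral_cmult)
    also have "\<dots> \<le> ennreal n * (\<integral>\<^sup>+\<tau>. loss (F \<tau>) (\<lambda>_. 1) * indicator {0..t} \<tau> \<partial>lborel)"
      using t by (intro mult_left_mono nn_integral_mono indicator_leI) auto
    also have "\<dots> < \<infinity>"
      using loss_one_integral[of t] t by (simp add: ennreal_mult_less_top)
    finally have L: "L < top" by simp
    have P: "P s < top" for s
      using AP[of s] by (cases "P s = top") (auto simp: less_top)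
    have "2 * excess_energy t n + ennreal (c * n) * D1 + (2 * P t + 2 * L) = 2 * (excess_energy t n + P t) + (2 * L + ennreal (c * n) * D1)"
      by (simp add: distrib_left add_ac)
    also have "\<dots> \<le> 2 * (excess_energy t0 n + P t0) + (2 * G + ennreal C * D2)"
      unfolding AP by (intro add_left_mono S)
    also have "\<dots> = 2 * excess_energy t0 n + ennreal C * D2 + 2 * (P t0 + G)"
      by (simp add: distrib_left add_ac)
    also have "\<dots> = 2 * excess_energy t0 n + ennreal C * D2 + (2 * P t + 2 * L)"
      unfolding W[symmetric] by (simp add: distrib_left)
    finally have "2 * excess_energy t n + ennreal (c * n) * D1 + (2 * P t + 2 * L) \<le> 2 * excess_energy t0 n + ennreal C * D2 + (2 * P t + 2 * L)" .
    moreover have "2 * P t + 2 * L \<noteq> top" using P[of t] L by (simp add: ennreal_mult_eq_top_iff less_top)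
    ultimately have "2 * excess_energy t n + ennreal (c * n) * D1 \<le> 2 * excess_energy t0 n + ennreal C * D2"
      by (simp add: add.commute[of _ "2 * P t + 2 * L"] ennreal_add_left_cancel_le)
    then show "2 * excess_energy t n + ennreal (c * n) * ?J (\<lambda>\<tau>. fast_flux (F \<tau>) (K * n)) \<le> 2 * excess_energy t0 n + ennreal C * ?J (\<lambda>\<tau>. fast_flux (F \<tau>) (n / 2))"
      by (simp add: D1_def D2_def)
  qed
qed

end

section \<open>Appearance of polynomial moments\<close>

lemma div_powr_minus: "0 < x \<Longrightarrow> 0 < y \<Longrightarrow> (x / y) powr (- a) = y powr a * x powr (- a)"
  for x y a :: real
  by (subst powr_divide) (auto simp: powr_minus field_simps)

context boltzmann_flow
begin

text \<open>The constant is chosen after \<open>t0\<close> and \<open>T\<close> and may depend on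
  the solution; only the exponent is tracked.\<close>

definition decay :: "real \<Rightarrow> bool" where
  "decay r \<longleftrightarrow> (\<forall>t0>0. \<forall>T. \<exists>C\<ge>0. \<forall>t\<in>{t0..T}. \<forall>n\<ge>1. excess_energy t n \<le> ennreal (C * n powr (- r)))"

lemma decay_0: "decay 0"
  unfolding decay_def
proof (intro allI impI exI conjI ballI)
  show "0 \<le> energy" by (rule energy_nonneg)
  fix t n :: real assume "1 \<le> n"
  then show "excess_energy t n \<le> ennreal (energy * n powr - 0)"
    using excess_energy_le_energy[of n t] by simp
qed

text \<open>Rate \<open>r\<close> for the excess energy gives, through the dissipation, rate
  \<open>r + 1\<close> for the time-integrated flux. The flux carries the weight
  \<open>\<rho>\<close>, worth an extra exponent \<open>\<beta> / 2\<close> in the energy. Half of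
  it pays for the strict inequality in \<open>moment_from_tail\<close>; the other half is the
  improvement.\<close>

lemma decay_step:
  assumes mass: "0 < mass" and r: "0 \<le> r" and dec: "decay r"
  shows "decay (r + \<beta> / 4)"
  unfolding decay_def
proof (intro allI impI)
  fix t0 T :: real assume t0: "0 < t0"
  define r' where "r' = r + \<beta> / 4"
  show "\<exists>C\<ge>0. \<forall>t\<in>{t0..T}. \<forall>n\<ge>1. excess_energy t n \<le> ennreal (C * n powr (- (r + \<beta> / 4)))"
  proof (cases "t0 \<le> T")
    case False
    then show ?thesis by (intro exI[of _ 0]) auto
  next
    case T: True
    show ?thesis
    proof (rule tail_inequality[OF mass])
      fix K n0 c C :: real
      assume K: "1 \<le> K" and n0: "1 \<le> n0" and c: "0 < c" and C: "0 \<le> C"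
        and tail: "\<And>n t0 t. n0 \<le> n \<Longrightarrow> 0 \<le> t0 \<Longrightarrow> t0 \<le> t \<Longrightarrow>
          2 * excess_energy t n + ennreal (c * n) * (\<integral>\<^sup>+\<tau>. fast_flux (F \<tau>) (K * n) * indicator {t0<..t} \<tau> \<partial>lborel)
          \<le> 2 * excess_energy t0 n + ennreal C * (\<integral>\<^sup>+\<tau>. fast_flux (F \<tau>) (n / 2) * indicator {t0<..t} \<tau> \<partial>lborel)"
      \<comment> \<open>The known decay is used from \<open>s0\<close> on, leaving the interval up
        to \<open>t0\<close> in which to search for a good instant.\<close>
      define s0 where "s0 = t0 / 2"
      have s0: "0 < s0" "s0 < t0" "s0 \<le> T" using t0 T by (auto simp: s0_def)
      obtain C1 where C1: "0 \<le> C1" "\<And>t n. t \<in> {s0..T} \<Longrightarrow> 1 \<le> n \<Longrightarrow> excess_energy t n \<le> ennreal (C1 * n powr (- r))"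
        using dec s0(1) unfolding decay_def by meson
      define J where "J m = (\<integral>\<^sup>+\<tau>. fast_flux (F \<tau>) m * indicator {s0<..T} \<tau> \<partial>lborel)" for m
      define C2 where "C2 = 2 * C1 * 2 powr r"
      have half: "(n / 2) powr (- q) = 2 powr q * n powr (- q)" if "0 < n" for n q :: real
        using that by (simp add: div_powr_minus)
      have D2: "fast_flux (F \<tau>) n \<le> ennreal (C2 * n powr (- r))" if "\<tau> \<in> {s0..T}" "2 \<le> n" for \<tau> n
      proof -
        have "fast_flux (F \<tau>) n \<le> 2 * excess_energy \<tau> (n / 2)" using that by (intro fast_flux_le_excess_energy) auto
        also have "\<dots> \<le> 2 * ennreal (C1 * (n / 2) powr (- r))"
          using that by (intro mult_left_mono C1) auto
        also have "\<dots> = ennreal (2 * (C1 * (n / 2) powr (- r)))"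
          using C1(1) by (simp add: ennreal_mult)
        also have "2 * (C1 * (n / 2) powr (- r)) = C2 * n powr (- r)"
          using that half[of n r] by (simp add: C2_def)
        finally show ?thesis .
      qed
      have J2: "J n \<le> ennreal (C2 * n powr (- r) * T)" if "2 \<le> n" for n
      proof -
        have "J n \<le> (\<integral>\<^sup>+\<tau>. ennreal (C2 * n powr (- r)) * indicator {s0<..T} \<tau> \<partial>lborel)"
          unfolding J_def
        proof (intro nn_integral_mono)
          fix \<tau>
          show "fast_flux (F \<tau>) n * indicator {s0<..T} \<tau> \<le> ennreal (C2 * n powr (- r)) * indicator {s0<..T} \<tau>"
            using D2[OF _ that, of \<tau>] by (cases "\<tau> \<in> {s0<..T}") auto
        qed
        also have "\<dots> = ennreal (C2 * n powr (- r)) * ennreal (T - s0)"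
          using s0 by (simp add: nn_integral_cmult)
        also have "\<dots> \<le> ennreal (C2 * n powr (- r)) * ennreal T"
          using s0 by (intro mult_left_mono ennreal_leI) auto
        also have "\<dots> = ennreal (C2 * n powr (- r) * T)"
          using C1(1) s0 by (intro ennreal_mult[symmetric]) (auto simp: C2_def)
        finally show ?thesis .
      qed
      have C2: "0 \<le> C2" using C1 by (simp add: C2_def)
      define n1 where "n1 = max n0 4"
      have n1: "1 \<le> n1" "n0 \<le> n1" "4 \<le> n1" by (auto simp: n1_def)
      define C3 where "C3 = 2 * C1 + C * (C2 * 2 powr r * T)"
      have C3: "0 \<le> C3" using C1 C C2 s0 by (simp add: C3_def)
      \<comment> \<open>The excess energy at the final time is dropped from the left, and division
        by \<open>c * n\<close> gains the power of \<open>n\<close>.\<close>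
      have J3: "J (K * n) \<le> ennreal (C3 / c * n powr (- (r + 1)))" if "n1 \<le> n" for n
      proof -
        have n: "1 \<le> n" "2 \<le> n / 2" "n0 \<le> n" using that n1 by auto
        have "ennreal (c * n) * J (K * n) \<le> 2 * excess_energy T n + ennreal (c * n) * J (K * n)" by simp
        also have "\<dots> \<le> 2 * excess_energy s0 n + ennreal C * J (n / 2)"
          unfolding J_def using n s0 by (intro tail) auto
        also have "\<dots> \<le> 2 * ennreal (C1 * n powr (- r)) + ennreal C * ennreal (C2 * (n / 2) powr (- r) * T)"
          using n s0 by (intro add_mono mult_left_mono C1 J2) auto
        also have "\<dots> = ennreal (2 * (C1 * n powr (- r)) + C * (C2 * (n / 2) powr (- r) * T))"
        proof -
          have "2 * ennreal (C1 * n powr (- r)) = ennreal (2 * (C1 * n powr (- r)))"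
            using C1 by (simp add: ennreal_mult)
          moreover have "ennreal C * ennreal (C2 * (n / 2) powr (- r) * T) = ennreal (C * (C2 * (n / 2) powr (- r) * T))"
            using C C2 s0 by (intro ennreal_mult[symmetric]) auto
          moreover have "0 \<le> 2 * (C1 * n powr (- r))" "0 \<le> C * (C2 * (n / 2) powr (- r) * T)"
            using C1 C C2 s0 by auto
          ultimately show ?thesis by (simp only: ennreal_plus)
        qed
        also have "2 * (C1 * n powr (- r)) + C * (C2 * (n / 2) powr (- r) * T) = C3 * n powr (- r)"
          using n half[of n r] by (simp add: C3_def algebra_simps)
        finally have 1: "ennreal (c * n) * J (K * n) \<le> ennreal (C3 * n powr (- r))" .
        have cn: "0 < c * n" using c n by simp
        have "J (K * n) = ennreal (1 / (c * n)) * (ennreal (c * n) * J (K * n))"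
        proof -
          have "ennreal (1 / (c * n)) * ennreal (c * n) = 1"
            using c n by (simp add: ennreal_mult[symmetric])
          then show ?thesis by (simp add: mult.assoc[symmetric])
        qed
        also have "\<dots> \<le> ennreal (1 / (c * n)) * ennreal (C3 * n powr (- r))"
          by (intro mult_left_mono 1) auto
        also have "\<dots> = ennreal (1 / (c * n) * (C3 * n powr (- r)))"
          using cn C3 by (intro ennreal_mult[symmetric]) auto
        also have "1 / (c * n) * (C3 * n powr (- r)) = C3 / c * n powr (- (r + 1))"
        proof -
          have "n powr (- (r + 1)) = n powr (- r) / n"
            using n powr_diff[of n "- r" 1] by simp
          then show ?thesis by simp
        qed
        finally show ?thesis .
      qed
      define m1 where "m1 = K * n1"
      have m1: "1 \<le> m1" using K n1 mult_mono[of 1 K 1 n1] by (simp add: m1_def)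
      define C4 where "C4 = C3 / c * K powr (r + 1)"
      have C4: "0 \<le> C4" using C3 c by (simp add: C4_def)
      have J4: "J m \<le> ennreal (C4 * m powr (- (r + 1)))" if "m1 \<le> m" for m
      proof -
        have "n1 \<le> m / K" using that K by (simp add: m1_def field_simps)
        then have "J (K * (m / K)) \<le> ennreal (C3 / c * (m / K) powr (- (r + 1)))" by (rule J3)
        also have "(m / K) powr (- (r + 1)) = K powr (r + 1) * m powr (- (r + 1))"
          using K that m1 by (intro div_powr_minus) auto
        finally show ?thesis using K by (simp add: C4_def mult.assoc)
      qed
      \<comment> \<open>The largest loss still useful: \<open>q\<close> stays strictly below
        \<open>r + 1\<close>, and \<open>\<beta> / 2 + q = 1 + r'\<close>.\<close>
      define q where "q = r + 1 - \<beta> / 4"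
      have q: "0 \<le> q" "q < r + 1" using beta r by (auto simp: q_def)
      define g where "g y = F (fst y) (snd y) * ennreal (\<rho> (snd y)) * indicator {s0<..T} (fst y)" for y :: "real \<times> 'a"
      have gm: "g \<in> borel_measurable (lborel \<Otimes>\<^sub>M lborel)" unfolding g_def by measurable
      have gi: "(\<integral>\<^sup>+y. g y * h (snd y) \<partial>(lborel \<Otimes>\<^sub>M lborel))
        = (\<integral>\<^sup>+\<tau>. (\<integral>\<^sup>+v. F \<tau> v * ennreal (\<rho> v) * h v \<partial>lborel) * indicator {s0<..T} \<tau> \<partial>lborel)"
        if [measurable]: "h \<in> borel_measurable borel" for h
      proof -
        have "(\<integral>\<^sup>+y. g y * h (snd y) \<partial>(lborel \<Otimes>\<^sub>M lborel)) = (\<integral>\<^sup>+\<tau>. \<integral>\<^sup>+v. g (\<tau>, v) * h v \<partial>lborel \<partial>lborel)"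
          using gm by (subst lborel.nn_integral_fst[symmetric]) simp_all
        also have "\<dots> = (\<integral>\<^sup>+\<tau>. \<integral>\<^sup>+v. F \<tau> v * ennreal (\<rho> v) * h v * indicator {s0<..T} \<tau> \<partial>lborel \<partial>lborel)"
          unfolding g_def by (simp only: fst_conv snd_conv mult_ac)
        finally show ?thesis by (simp add: nn_integral_multc)
      qed
      have gG: "(\<integral>\<^sup>+y. g y \<partial>(lborel \<Otimes>\<^sub>M lborel)) \<le> ennreal ((mass + energy) * T)"
      proof -
        have "(\<integral>\<^sup>+y. g y \<partial>(lborel \<Otimes>\<^sub>M lborel)) = (\<integral>\<^sup>+\<tau>. (\<integral>\<^sup>+v. F \<tau> v * ennreal (\<rho> v) \<partial>lborel) * indicator {s0<..T} \<tau> \<partial>lborel)"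
          using gi[of "\<lambda>_. 1"] by simp
        also have "\<dots> \<le> (\<integral>\<^sup>+\<tau>. ennreal (mass + energy) * indicator {s0<..T} \<tau> \<partial>lborel)"
          using F_rho_le by (intro nn_integral_mono mult_right_mono) (simp_all add: F_mass mass_nonneg energy_nonneg)
        also have "\<dots> = ennreal (mass + energy) * ennreal (T - s0)"
          using s0 by (simp add: nn_integral_cmult)
        also have "\<dots> \<le> ennreal (mass + energy) * ennreal T"
          using s0 by (intro mult_left_mono ennreal_leI) auto
        also have "\<dots> = ennreal ((mass + energy) * T)"
          using s0 mass_nonneg energy_nonneg by (intro ennreal_mult[symmetric]) auto
        finally show ?thesis .
      qed
      have gt: "(\<integral>\<^sup>+y. g y * indicator {y. n \<le> (norm (snd y))\<^sup>2} y \<partial>(lborel \<Otimes>\<^sub>M lborel)) \<le> ennreal (C4 * n powr (- (r + 1)))"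
        if "m1 \<le> n" for n
      proof -
        have "(\<integral>\<^sup>+y. g y * indicator {y. n \<le> (norm (snd y))\<^sup>2} y \<partial>(lborel \<Otimes>\<^sub>M lborel))
          = (\<integral>\<^sup>+y. g y * indicator {v. n \<le> (norm v)\<^sup>2} (snd y) \<partial>(lborel \<Otimes>\<^sub>M lborel))"
          by (simp add: indicator_def)
        also have "\<dots> = J n"
          by (subst gi) (simp_all add: J_def fast_flux_def)
        also note J4[OF that]
        finally show ?thesis .
      qed
      have "\<exists>B. (\<integral>\<^sup>+y. g y * ennreal ((norm (snd y))\<^sup>2 powr q) \<partial>(lborel \<Otimes>\<^sub>M lborel)) \<le> ennreal B"
        by (rule moment_from_tail[where x="\<lambda>y. (norm (snd y))\<^sup>2" and N="lborel \<Otimes>\<^sub>M lborel" and ?n1.0=m1 and C=C4 and p="r + 1" and q=q and G="(mass + energy) * T"])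
          (use q m1 C4 s0 mass_nonneg energy_nonneg gm gG gt in auto)
      then obtain B where B: "(\<integral>\<^sup>+\<tau>. (\<integral>\<^sup>+v. F \<tau> v * ennreal (\<rho> v) * ennreal ((norm v)\<^sup>2 powr q) \<partial>lborel) * indicator {s0<..T} \<tau> \<partial>lborel) \<le> ennreal B"
        using gi[of "\<lambda>v. ennreal ((norm v)\<^sup>2 powr q)"] by auto
      define mu where "mu \<tau> = (\<integral>\<^sup>+v. F \<tau> v * ennreal (\<rho> v) * ennreal ((norm v)\<^sup>2 powr q) \<partial>lborel)" for \<tau>
      \<comment> \<open>A finite time integral cannot have an infinite integrand throughout an
        interval of positive length.\<close>
      have "\<exists>t1\<in>{s0<..t0}. mu t1 < top"
      proof (rule ccontr)
        assume "\<not> (\<exists>t1\<in>{s0<..t0}. mu t1 < top)"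
        then have inf: "mu \<tau> = top" if "\<tau> \<in> {s0<..t0}" for \<tau> using that by (auto simp: less_top[symmetric])
        have "top = top * ennreal (t0 - s0)" using s0 by (simp add: ennreal_top_mult)
        also have "\<dots> = (\<integral>\<^sup>+\<tau>. top * indicator {s0<..t0} \<tau> \<partial>lborel)"
          using s0 by (subst nn_integral_cmult_indicator) auto
        also have "\<dots> \<le> (\<integral>\<^sup>+\<tau>. mu \<tau> * indicator {s0<..T} \<tau> \<partial>lborel)"
          using inf T by (intro nn_integral_mono) (auto simp: indicator_def)
        also have "\<dots> \<le> ennreal B" using B by (simp add: mu_def)
        finally show False by (simp add: top_unique)
      qed
      then obtain t1 where t1: "s0 < t1" "t1 \<le> t0" "mu t1 < top" by auto
      obtain m where m: "0 \<le> m" "mu t1 = ennreal m" using t1(3) by (cases "mu t1") auto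
      \<comment> \<open>For energies \<open>x \<ge> n\<close> one has
        \<open>x \<le> n powr (- r') * x powr (1 + r')\<close>, and the last power is exactly the
        weight of \<open>mu\<close>.\<close>
      have A1: "excess_energy t1 n \<le> ennreal (m * n powr (- r'))" if "1 \<le> n" for n
      proof -
        have "excess_energy t1 n \<le> (\<integral>\<^sup>+v. ennreal (n powr (- r')) * (F t1 v * ennreal (\<rho> v) * ennreal ((norm v)\<^sup>2 powr q)) \<partial>lborel)"
          unfolding excess_energy_def
        proof (intro nn_integral_mono)
          fix v :: 'a
          have "max 0 ((norm v)\<^sup>2 - n) \<le> n powr (- r') * (\<rho> v * (norm v)\<^sup>2 powr q)"
          proof (cases "n \<le> (norm v)\<^sup>2")
            case True
            define x where "x = (norm v)\<^sup>2"
            have x: "1 \<le> x" "n \<le> x" using True that by (auto simp: x_def)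
            have "norm v \<noteq> 0" using x by (auto simp: x_def)
            then have "\<rho> v = x powr (\<beta> / 2)" unfolding \<rho>_def x_def by (simp add: powr_powr flip: powr_numeral)
            then have "\<rho> v * (norm v)\<^sup>2 powr q = x powr (\<beta> / 2 + q)" by (simp add: x_def powr_add)
            also have "\<beta> / 2 + q = 1 + r'" by (simp add: q_def r'_def)
            also have "x powr (1 + r') = x * x powr r'" using x by (simp add: powr_add)
            finally have e: "\<rho> v * (norm v)\<^sup>2 powr q = x * x powr r'" .
            have r'0: "0 \<le> r'" using r beta by (simp add: r'_def)
            have "x * (n powr (- r') * n powr r') \<le> x * (n powr (- r') * x powr r')"
              using x that r'0 by (intro mult_left_mono powr_mono2) auto
            moreover have "n powr (- r') * n powr r' = 1" using that by (simp add: powr_add[symmetric])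
            ultimately have "x \<le> n powr (- r') * (x * x powr r')" by (simp add: mult_ac)
            moreover have "max 0 ((norm v)\<^sup>2 - n) \<le> x" using x that by (simp add: x_def)
            ultimately show ?thesis unfolding e by (rule order_trans[rotated])
          qed (simp add: max_def)
          then have "ennreal (max 0 ((norm v)\<^sup>2 - n)) \<le> ennreal (n powr (- r') * (\<rho> v * (norm v)\<^sup>2 powr q))"
            by (rule ennreal_leI)
          also have "\<dots> = ennreal (n powr (- r')) * (ennreal (\<rho> v) * ennreal ((norm v)\<^sup>2 powr q))"
            by (simp add: ennreal_mult)
          finally have "F t1 v * ennreal (max 0 ((norm v)\<^sup>2 - n)) \<le> F t1 v * (ennreal (n powr (- r')) * (ennreal (\<rho> v) * ennreal ((norm v)\<^sup>2 powr q)))"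
            by (rule mult_left_mono) simp
          then show "F t1 v * ennreal (max 0 ((norm v)\<^sup>2 - n)) \<le> ennreal (n powr (- r')) * (F t1 v * ennreal (\<rho> v) * ennreal ((norm v)\<^sup>2 powr q))"
            by (simp only: mult_ac)
        qed
        also have "\<dots> = ennreal (n powr (- r')) * ennreal m"
          using m(2) by (simp add: nn_integral_cmult mu_def)
        also have "\<dots> = ennreal (m * n powr (- r'))"
          using m(1) by (simp add: ennreal_mult mult.commute)
        finally show ?thesis .
      qed
      define n2 where "n2 = max n1 (2 * m1)"
      define C5 where "C5 = 2 * m + C * (C4 * 2 powr (r + 1))"
      have C5: "0 \<le> C5" using m C C4 by (simp add: C5_def)
      \<comment> \<open>The tail inequality is restarted at \<open>t1\<close>. Its error decays with
        rate \<open>r + 1\<close>, which is at least \<open>r'\<close>, so the decay at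
        \<open>t1\<close> is inherited by all later times.\<close>
      have big: "excess_energy t n \<le> ennreal (C5 * n powr (- r'))" if "t \<in> {t0..T}" "n2 \<le> n" for t n
      proof -
        have n: "1 \<le> n" "n0 \<le> n" "m1 \<le> n / 2" using that n1 m1 by (auto simp: n2_def)
        have "excess_energy t n \<le> 2 * excess_energy t n + ennreal (c * n) * (\<integral>\<^sup>+\<tau>. fast_flux (F \<tau>) (K * n) * indicator {t1<..t} \<tau> \<partial>lborel)"
          by (simp add: mult_2 add.assoc)
        also have "\<dots> \<le> 2 * excess_energy t1 n + ennreal C * (\<integral>\<^sup>+\<tau>. fast_flux (F \<tau>) (n / 2) * indicator {t1<..t} \<tau> \<partial>lborel)"
          using that n t1 s0 by (intro tail) auto
        also have "\<dots> \<le> 2 * excess_energy t1 n + ennreal C * J (n / 2)"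
          unfolding J_def using that t1 by (intro add_left_mono mult_left_mono nn_integral_mono indicator_leI) auto
        also have "\<dots> \<le> 2 * ennreal (m * n powr (- r')) + ennreal C * ennreal (C4 * (n / 2) powr (- (r + 1)))"
          using n by (intro add_mono mult_left_mono A1 J4) auto
        also have "\<dots> = ennreal (2 * (m * n powr (- r')) + C * (C4 * (n / 2) powr (- (r + 1))))"
        proof -
          have "2 * ennreal (m * n powr (- r')) = ennreal (2 * (m * n powr (- r')))"
            using m by (simp add: ennreal_mult)
          moreover have "ennreal C * ennreal (C4 * (n / 2) powr (- (r + 1))) = ennreal (C * (C4 * (n / 2) powr (- (r + 1))))"
            using C C4 by (intro ennreal_mult[symmetric]) auto
          moreover have "0 \<le> 2 * (m * n powr (- r'))" "0 \<le> C * (C4 * (n / 2) powr (- (r + 1)))"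
            using m C C4 by auto
          ultimately show ?thesis by (simp only: ennreal_plus)
        qed
        also have "\<dots> \<le> ennreal (C5 * n powr (- r'))"
        proof (rule ennreal_leI)
          have "n powr (- (r + 1)) \<le> n powr (- r')"
            using n beta by (intro powr_mono) (auto simp: r'_def)
          then have "C * (C4 * (2 powr (r + 1) * n powr (- (r + 1)))) \<le> C * (C4 * (2 powr (r + 1) * n powr (- r')))"
            using C C4 by (intro mult_left_mono) auto
          then show "2 * (m * n powr (- r')) + C * (C4 * (n / 2) powr (- (r + 1))) \<le> C5 * n powr (- r')"
            using n half[of n "r + 1"] by (simp add: C5_def distrib_right mult.assoc)
        qed
        finally show ?thesis .
      qed
      \<comment> \<open>For the bounded range of \<open>n\<close> not covered by the tail
        inequality, conserved energy is enough.\<close>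
      have small: "excess_energy t n \<le> ennreal (energy * n2 powr r' * n powr (- r'))" if "1 \<le> n" "n \<le> n2" for t n
      proof -
        have r'0: "0 \<le> r'" using r beta by (simp add: r'_def)
        have "energy * (n powr r' * n powr (- r')) \<le> energy * (n2 powr r' * n powr (- r'))"
          using that energy_nonneg r'0 by (intro mult_left_mono mult_right_mono powr_mono2) auto
        moreover have "n powr r' * n powr (- r') = 1" using that by (simp add: powr_add[symmetric])
        ultimately have "energy \<le> energy * n2 powr r' * n powr (- r')" by (simp add: mult.assoc)
        then have "ennreal energy \<le> ennreal (energy * n2 powr r' * n powr (- r'))" by (rule ennreal_leI)
        with excess_energy_le_energy[of n t] that show ?thesis by (meson order_trans zero_le_one)
      qed
      show ?thesis
      proof (intro exI[of _ "C5 + energy * n2 powr r'"] conjI ballI allI impI)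
        show "0 \<le> C5 + energy * n2 powr r'" using C5 energy_nonneg by simp
        fix t n :: real assume tn: "t \<in> {t0..T}" "1 \<le> n"
        show "excess_energy t n \<le> ennreal ((C5 + energy * n2 powr r') * n powr (- (r + \<beta> / 4)))"
        proof (cases "n2 \<le> n")
          case True
          have "C5 * n powr (- r') \<le> (C5 + energy * n2 powr r') * n powr (- r')"
            using energy_nonneg by (intro mult_right_mono) auto
          then show ?thesis using big[OF tn(1) True] order_trans ennreal_leI unfolding r'_def[symmetric] by blast
        next
          case False
          have "energy * n2 powr r' * n powr (- r') \<le> (C5 + energy * n2 powr r') * n powr (- r')"
            using C5 by (intro mult_right_mono) auto
          then show ?thesis using small[OF tn(2), of t] False order_trans ennreal_leI unfolding r'_def[symmetric]
            by (metis linorder_le_cases)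
        qed
      qed
    qed
  qed
qed

lemma decay_all:
  assumes "0 < mass"
  shows "decay (real j * (\<beta> / 4))"
proof (induction j)
  case 0
  then show ?case using decay_0 by simp
next
  case (Suc j)
  have "0 \<le> real j * (\<beta> / 4)" using beta by simp
  from decay_step[OF assms this Suc] show ?case by (simp add: algebra_simps add_divide_distrib)
qed

text \<open>The bound is not uniform in the solution or as \<open>t0\<close> tends to 0; it
  justifies the manipulations of the exponential stage without entering its constants. The order 0
  is separate because \<open>0 ^ 0 = 1\<close> while \<open>0 powr 0 = 0\<close>.\<close>

lemma moments_finite:
  assumes "0 < mass" "0 < t0"
  shows "\<exists>K\<ge>0. \<forall>t\<in>{t0..T}. (\<integral>\<^sup>+v. F t v * ennreal (\<rho> v ^ p) \<partial>lborel) \<le> ennreal K"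
proof (cases "p = 0")
  case True
  then show ?thesis using mass_nonneg by (intro exI[of _ mass]) (simp add: F_mass)
next
  case False
  \<comment> \<open>This is \<open>q + \<beta> / 4\<close>, one iteration step beyond the order of
    the moment.\<close>
  define r where "r = real (2 * p + 1) * (\<beta> / 4)"
  define q where "q = \<beta> * real p / 2"
  have q: "0 \<le> q" "q < r" using beta by (auto simp: q_def r_def algebra_simps)
  obtain C where C: "0 \<le> C" "\<And>t n. t \<in> {t0..T} \<Longrightarrow> 1 \<le> n \<Longrightarrow> excess_energy t n \<le> ennreal (C * n powr (- r))"
    using decay_all[OF assms(1), of "2 * p + 1"] assms(2) unfolding decay_def r_def[symmetric] by meson
  have tail: "(\<integral>\<^sup>+v. F t v * indicator {v. n \<le> (norm v)\<^sup>2} v \<partial>lborel) \<le> ennreal (2 * C * 2 powr r * n powr (- r))"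
    if t: "t \<in> {t0..T}" and n: "2 \<le> n" for t n
  proof -
    have "(\<integral>\<^sup>+v. F t v * indicator {v. n \<le> (norm v)\<^sup>2} v \<partial>lborel) \<le> (\<integral>\<^sup>+v. F t v * ennreal (max 0 ((norm v)\<^sup>2 - n / 2)) \<partial>lborel)"
    proof (intro nn_integral_mono mult_left_mono)
      fix v :: 'a
      show "indicator {v. n \<le> (norm v)\<^sup>2} v \<le> ennreal (max 0 ((norm v)\<^sup>2 - n / 2))"
        using n by (auto simp: indicator_def max_def)
    qed simp
    also have "\<dots> \<le> ennreal (C * (n / 2) powr (- r))"
      unfolding excess_energy_def[symmetric] using n by (intro C t) auto
    also have "\<dots> \<le> ennreal (2 * C * 2 powr r * n powr (- r))"
    proof (rule ennreal_leI)
      have "(n / 2) powr (- r) = 2 powr r * n powr (- r)"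
        using n by (intro div_powr_minus) auto
      moreover have "0 \<le> C * (2 powr r * n powr (- r))" using C by simp
      ultimately show "C * (n / 2) powr (- r) \<le> 2 * C * 2 powr r * n powr (- r)"
        by (simp only: mult.assoc)
    qed
    finally show ?thesis .
  qed
  have "\<exists>B. \<forall>t\<in>{t0..T}. (\<integral>\<^sup>+v. F t v * ennreal ((norm v)\<^sup>2 powr q) \<partial>lborel) \<le> ennreal B"
  proof (rule moment_from_tail[where x="\<lambda>v::'a. (norm v)\<^sup>2" and N=lborel and ?n1.0=2 and C="2 * C * 2 powr r" and p=r and q=q and G=mass])
    fix B
    assume *: "\<And>g. g \<in> borel_measurable lborel \<Longrightarrow> (\<integral>\<^sup>+v. g v \<partial>lborel) \<le> ennreal mass \<Longrightarrow>
      (\<And>n. 2 \<le> n \<Longrightarrow> (\<integral>\<^sup>+y. g y * indicator {y::'a. n \<le> (norm y)\<^sup>2} y \<partial>lborel) \<le> ennreal (2 * C * 2 powr r * n powr (- r))) \<Longrightarrow>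
      (\<integral>\<^sup>+v. g v * ennreal ((norm v)\<^sup>2 powr q) \<partial>lborel) \<le> ennreal B"
    show "\<exists>B. \<forall>t\<in>{t0..T}. (\<integral>\<^sup>+v. F t v * ennreal ((norm v)\<^sup>2 powr q) \<partial>lborel) \<le> ennreal B"
      by (intro exI[of _ B] ballI *) (use tail F_mass in auto)
  qed (use q C mass_nonneg in auto)
  then obtain B where B: "\<And>t. t \<in> {t0..T} \<Longrightarrow> (\<integral>\<^sup>+v. F t v * ennreal ((norm v)\<^sup>2 powr q) \<partial>lborel) \<le> ennreal B"
    by blast
  have "\<rho> v ^ p = (norm v)\<^sup>2 powr q" for v :: 'a
  proof (cases "v = 0")
    case True
    then show ?thesis using False by (simp add: \<rho>_def)
  next
    case v: False
    then have "\<rho> v ^ p = (norm v powr \<beta>) powr real p" by (simp add: \<rho>_def powr_realpow)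
    also have "\<dots> = norm v powr (2 * q)" unfolding powr_powr by (simp add: q_def)
    also have "\<dots> = (norm v powr 2) powr q" by (rule powr_powr[symmetric])
    also have "norm v powr 2 = (norm v)\<^sup>2" using v by simp
    finally show ?thesis .
  qed
  then have "\<forall>t\<in>{t0..T}. (\<integral>\<^sup>+v. F t v * ennreal (\<rho> v ^ p) \<partial>lborel) \<le> ennreal (max 0 B)"
    using B order_trans[OF _ ennreal_leI[of B "max 0 B"]] by simp
  then show ?thesis by (intro exI[of _ "max 0 B"]) auto
qed

end

section \<open>The exponential moment balance\<close>

definition esum :: "nat \<Rightarrow> nat \<Rightarrow> real \<Rightarrow> real" where
  "esum m N x = (\<Sum>p\<in>{m..N}. x ^ p / fact p)"

lemma esum_nonneg: "0 \<le> x \<Longrightarrow> 0 \<le> esum m N x"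
  unfolding esum_def by (intro sum_nonneg) auto

lemma measurable_esum[measurable]: "esum m N \<in> borel_measurable borel"
  unfolding esum_def by measurable

lemma esum_le_esum_0: "0 \<le> x \<Longrightarrow> esum m N x \<le> esum 0 N x"
  unfolding esum_def by (intro sum_mono2) auto

text \<open>The addition formula of the exponential: after the binomial expansion, the pairs with
  \<open>i + j \<le> N\<close> form a triangle inside the square of the product.\<close>

lemma esum_add_le:
  assumes "0 \<le> x" "0 \<le> y"
  shows "esum 0 N (x + y) \<le> esum 0 N x * esum 0 N y"
proof -
  have "(x + y) ^ p / fact p = (\<Sum>i\<le>p. (x ^ i / fact i) * (y ^ (p - i) / fact (p - i)))" for p
  proof -
    have "(x + y) ^ p / fact p = (\<Sum>i\<le>p. (of_nat (p choose i) * x ^ i * y ^ (p - i)) / fact p)"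
      by (simp add: binomial_ring sum_divide_distrib)
    also have "\<dots> = (\<Sum>i\<le>p. (x ^ i / fact i) * (y ^ (p - i) / fact (p - i)))"
      by (intro sum.cong refl) (simp add: binomial_fact)
    finally show ?thesis .
  qed
  then have "esum 0 N (x + y) = (\<Sum>p\<le>N. \<Sum>i\<le>p. (x ^ i / fact i) * (y ^ (p - i) / fact (p - i)))"
    by (simp add: esum_def atLeast0AtMost)
  also have "\<dots> = (\<Sum>(i, j)\<in>{(i, j). i + j \<le> N}. (x ^ i / fact i) * (y ^ j / fact j))"
    by (rule sum.triangle_reindex_eq[symmetric])
  also have "\<dots> \<le> (\<Sum>(i, j)\<in>{..N} \<times> {..N}. (x ^ i / fact i) * (y ^ j / fact j))"
    using assms by (intro sum_mono2) auto
  also have "\<dots> = esum 0 N x * esum 0 N y"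
    by (simp add: esum_def atLeast0AtMost sum_product sum.cartesian_product)
  finally show ?thesis .
qed

text \<open>For large \<open>x\<close> the orders below \<open>p0\<close> are dominated by the order
  \<open>p0\<close> itself; for bounded \<open>x\<close> they are bounded. The second estimate has
  constant term exactly 1, so after integration only the mass remains at
  \<open>s = 0\<close>.\<close>

lemma low_order_terms:
  assumes "1 \<le> p0"
  obtains C0 :: real where "1 \<le> C0"
    "\<And>x N. 0 \<le> x \<Longrightarrow> p0 \<le> N \<Longrightarrow> esum 0 N x \<le> C0 + 2 * esum p0 N x"
    "\<And>x N. 0 \<le> x \<Longrightarrow> p0 \<le> N \<Longrightarrow> esum 0 N x \<le> 1 + C0 * x + 2 * esum p0 N x"
proof -
  define R0 :: real where "R0 = real p0 * fact p0"
  have R0: "1 \<le> R0"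
  proof -
    have "1 * 1 \<le> real p0 * fact p0" using assms by (intro mult_mono) auto
    then show ?thesis by (simp add: R0_def)
  qed
  define C0 where "C0 = (\<Sum>p<p0. R0 ^ p)"
  have C0: "1 \<le> C0"
  proof -
    have "(\<Sum>p\<in>{0}. R0 ^ p) \<le> C0" unfolding C0_def using assms R0 by (intro sum_mono2) auto
    then show ?thesis by simp
  qed
  define low where "low x = (\<Sum>p<p0. x ^ p / fact p)" for x :: real
  have split: "esum 0 N x = low x + esum p0 N x" if "p0 \<le> N" for N x
  proof -
    have "{0..N} = {..<p0} \<union> {p0..N}" using that by auto
    then show ?thesis unfolding esum_def low_def by (simp add: sum.union_disjoint ivl_disj_int)
  qed
  have top: "x ^ p0 / fact p0 \<le> esum p0 N x" if "0 \<le> x" "p0 \<le> N" for x N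
  proof -
    have "(\<Sum>p\<in>{p0}. x ^ p / fact p) \<le> esum p0 N x"
      unfolding esum_def using that by (intro sum_mono2) auto
    then show ?thesis by simp
  qed
  have big: "low x \<le> x ^ p0 / fact p0" if x: "R0 \<le> x" for x
  proof -
    have x1: "1 \<le> x" using x R0 by simp
    have "low x \<le> (\<Sum>p<p0. x ^ (p0 - 1))" unfolding low_def
    proof (rule sum_mono)
      fix p assume "p \<in> {..<p0}"
      then have "x ^ p \<le> x ^ (p0 - 1)" using x1 by (intro power_increasing) auto
      moreover have "x ^ p / fact p \<le> x ^ p" using x1 fact_ge_1[of p, where 'a=real] by (simp add: divide_le_eq mult_le_cancel_left1)
      ultimately show "x ^ p / fact p \<le> x ^ (p0 - 1)" by simp
    qed
    also have "\<dots> = real p0 * x ^ (p0 - 1)" by simp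
    also have "\<dots> \<le> x / fact p0 * x ^ (p0 - 1)"
      using x x1 by (intro mult_right_mono) (auto simp: R0_def le_divide_eq)
    also have "\<dots> = x ^ p0 / fact p0" using assms by (cases p0) auto
    finally show ?thesis .
  qed
  have small: "low x \<le> 1 + C0 * x" "low x \<le> C0" if x: "0 \<le> x" "x \<le> R0" for x
  proof -
    have f: "x ^ p / fact p \<le> x ^ p" for p
      using x fact_ge_1[of p, where 'a=real] by (simp add: divide_le_eq mult_le_cancel_left1)
    show "low x \<le> C0" unfolding low_def C0_def
      using x f by (intro sum_mono order_trans[OF f] power_mono) auto
    have "low x \<le> (\<Sum>p<p0. (if p = 0 then 1 else 0) + x * R0 ^ p)" unfolding low_def
    proof (rule sum_mono)
      fix p
      show "x ^ p / fact p \<le> (if p = 0 then 1 else 0) + x * R0 ^ p"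
      proof (cases p)
        case (Suc m)
        have "x ^ m \<le> R0 ^ m" using x by (intro power_mono) auto
        also have "\<dots> \<le> R0 ^ Suc m" using R0 by (intro power_increasing) auto
        finally have "x * x ^ m \<le> x * R0 ^ Suc m" using x by (intro mult_left_mono) auto
        then show ?thesis using f[of p] Suc by simp
      qed (use x R0 in simp)
    qed
    also have "\<dots> = 1 + C0 * x"
      using assms by (simp add: sum.distrib C0_def sum_distrib_left[symmetric] mult.commute)
    finally show "low x \<le> 1 + C0 * x" .
  qed
  show thesis
  proof (rule that[OF C0])
    fix x N assume xN: "0 \<le> (x::real)" "p0 \<le> N"
    have nn: "0 \<le> esum p0 N x" "0 \<le> C0 * x" using xN C0 by (auto intro: esum_nonneg)
    have "low x \<le> C0 + esum p0 N x \<and> low x \<le> 1 + C0 * x + esum p0 N x"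
    proof (cases "R0 \<le> x")
      case True
      then show ?thesis using big[of x] top[OF xN] nn C0 by linarith
    next
      case False
      then show ?thesis using small[of x] xN nn by linarith
    qed
    then show "esum 0 N x \<le> C0 + 2 * esum p0 N x" "esum 0 N x \<le> 1 + C0 * x + 2 * esum p0 N x"
      unfolding split[OF xN(2)] by auto
  qed
qed

context hard_potential
begin

text \<open>The energy transferred is governed by \<open>norm (v - w) * norm (v + w)\<close>, at
  most the total energy, times the cosine of \<open>\<sigma>\<close> with \<open>v + w\<close>.
  Assuming only a factorisation of \<open>v + w\<close> along \<open>V\<close> leaves
  \<open>V\<close> free when \<open>v + w = 0\<close>.\<close>

lemma rho_post_le:
  fixes v w \<sigma> V :: 'a
  assumes s: "norm \<sigma> = 1" and V: "norm V = 1" "v + w = norm (v + w) *\<^sub>R V"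
  shows "\<rho> (post_v v w \<sigma>) \<le> angular_factor (V \<bullet> \<sigma>) * (\<rho> v + \<rho> w)"
proof -
  define x y z where "x = (norm v)\<^sup>2" and "y = (norm w)\<^sup>2" and "z = \<bar>V \<bullet> \<sigma>\<bar>"
  have z: "0 \<le> z" "z \<le> 1" using Cauchy_Schwarz_ineq2[of V \<sigma>] s V by (auto simp: z_def)
  have xy: "0 \<le> x" "0 \<le> y" by (auto simp: x_def y_def)
  have par: "norm (v - w) * norm (v + w) \<le> x + y"
  proof -
    have "2 * (norm (v - w) * norm (v + w)) \<le> (norm (v - w))\<^sup>2 + (norm (v + w))\<^sup>2"
      using sum_squares_bound[of "norm (v - w)" "norm (v + w)"] by simp
    also have "\<dots> = 2 * (x + y)"
      unfolding x_def y_def power2_norm_eq_inner by (simp add: inner_simps inner_commute)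
    finally show ?thesis by simp
  qed
  have "(v + w) \<bullet> \<sigma> = norm (v + w) * (V \<bullet> \<sigma>)" by (subst V(2)) simp
  then have "norm (v - w) * ((v + w) \<bullet> \<sigma>) \<le> norm (v - w) * norm (v + w) * z"
    by (simp add: z_def mult.assoc mult_left_mono)
  also have "\<dots> \<le> (x + y) * z" using par z by (intro mult_right_mono) auto
  finally have "(norm (post_v v w \<sigma>))\<^sup>2 \<le> (1 + z) / 2 * (x + y)"
    unfolding norm_post(1)[OF s] x_def[symmetric] y_def[symmetric] by (simp add: field_simps)
  moreover note sq = square_powr_half
  ultimately have "\<rho> (post_v v w \<sigma>) \<le> ((1 + z) / 2 * (x + y)) powr (\<beta> / 2)"
    unfolding \<rho>_def sq[OF norm_ge_zero, symmetric] using beta by (intro powr_mono2) auto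
  also have "\<dots> = angular_factor (V \<bullet> \<sigma>) * (x + y) powr (\<beta> / 2)"
    using z xy by (subst powr_mult) (auto simp: angular_factor_def z_def)
  also have "\<dots> \<le> angular_factor (V \<bullet> \<sigma>) * (x powr (\<beta> / 2) + y powr (\<beta> / 2))"
    using angular_factor_bounds[of "V \<bullet> \<sigma>"] xy beta by (intro mult_left_mono powr_subadditive) auto
  also have "\<dots> = angular_factor (V \<bullet> \<sigma>) * (\<rho> v + \<rho> w)"
    unfolding x_def y_def \<rho>_def by (simp add: sq)
  finally show ?thesis .
qed

text \<open>Every order \<open>p \<ge> p0\<close> carries at least \<open>p0\<close> angular
  factors, so one factor comes out of the whole sum. The 4 is 2 from splitting the relative speed
  times 2 from the symmetry of the pair.\<close>

lemma gain_esum_le: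
  fixes F :: "'a \<Rightarrow> ennreal"
  assumes [measurable]: "F \<in> borel_measurable borel" and A: "0 \<le> a"
    and \<gamma>: "\<And>u V::'a. norm u = 1 \<Longrightarrow> norm V = 1 \<Longrightarrow>
      (\<integral>\<^sup>+\<sigma>. k (u \<bullet> \<sigma>) * ennreal (angular_factor (V \<bullet> \<sigma>) ^ p0) \<partial>sph) \<le> ennreal \<gamma>"
  shows "gain F (\<lambda>v. ennreal (esum p0 N (a * \<rho> v))) \<le>
    4 * ennreal \<gamma> * (\<integral>\<^sup>+v. F v * ennreal (\<rho> v * esum 0 N (a * \<rho> v)) \<partial>lborel) * (\<integral>\<^sup>+v. F v * ennreal (esum 0 N (a * \<rho> v)) \<partial>lborel)"
proof -
  define e where "e v = esum 0 N (a * \<rho> v)" for v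
  have e: "0 \<le> e v" for v unfolding e_def using A by (intro esum_nonneg) auto
  have [measurable]: "e \<in> borel_measurable borel" unfolding e_def by measurable
  define H where "H v = F v * ennreal (e v)" for v
  have [measurable]: "H \<in> borel_measurable borel" unfolding H_def by measurable
  have inner: "(\<integral>\<^sup>+\<sigma>. kern \<beta> k v w \<sigma> * (F v * F w * ennreal (esum p0 N (a * \<rho> (post_v v w \<sigma>)))) \<partial>sph)
      \<le> ennreal \<gamma> * (ennreal (norm (v - w) powr \<beta>) * (H v * H w))" for v w
  proof (cases "v = w")
    case True
    then show ?thesis by (simp add: kern_def)
  next
    case False
    \<comment> \<open>If \<open>v + w = 0\<close>, any unit vector is admissible;
      \<open>\<gamma>\<close> is uniform in \<open>V\<close>.\<close>
    obtain V :: 'a where V: "norm V = 1" "v + w = norm (v + w) *\<^sub>R V"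
    proof (cases "v + w = 0")
      case True
      obtain e :: 'a where "e \<in> Basis" using nonempty_Basis by blast
      then show ?thesis using that[of e] True by simp
    next
      case False
      then show ?thesis using that[of "(v + w) /\<^sub>R norm (v + w)"] by simp
    qed
    define u where "u = (v - w) /\<^sub>R norm (v - w)"
    have u: "norm u = 1" using False by (simp add: u_def)
    have pw: "esum p0 N (a * \<rho> (post_v v w \<sigma>)) \<le> angular_factor (V \<bullet> \<sigma>) ^ p0 * (e v * e w)" if s: "norm \<sigma> = 1" for \<sigma>
    proof -
      let ?c = "angular_factor (V \<bullet> \<sigma>)" and ?y = "a * \<rho> v + a * \<rho> w"
      have y: "0 \<le> ?y" using A by simp
      have "esum p0 N (a * \<rho> (post_v v w \<sigma>)) \<le> (\<Sum>p\<in>{p0..N}. ?c ^ p0 * (?y ^ p / fact p))"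
        unfolding esum_def
      proof (rule sum_mono)
        fix p assume p: "p \<in> {p0..N}"
        have "a * \<rho> (post_v v w \<sigma>) \<le> a * (?c * (\<rho> v + \<rho> w))"
          using A by (intro mult_left_mono rho_post_le s V)
        then have "(a * \<rho> (post_v v w \<sigma>)) ^ p \<le> (?c * ?y) ^ p"
          using A by (intro power_mono) (auto simp: algebra_simps)
        also have "\<dots> = ?c ^ p * ?y ^ p" by (rule power_mult_distrib)
        also have "\<dots> \<le> ?c ^ p0 * ?y ^ p"
          using p y angular_factor_bounds[of "V \<bullet> \<sigma>"] by (intro mult_right_mono power_decreasing) auto
        finally have "(a * \<rho> (post_v v w \<sigma>)) ^ p / fact p \<le> (?c ^ p0 * ?y ^ p) / fact p"
          by (intro divide_right_mono) auto
        then show "(a * \<rho> (post_v v w \<sigma>)) ^ p / fact p \<le> ?c ^ p0 * (?y ^ p / fact p)" by simp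
      qed
      also have "\<dots> = ?c ^ p0 * esum p0 N ?y" by (simp add: esum_def sum_distrib_left)
      also have "\<dots> \<le> ?c ^ p0 * (e v * e w)"
        unfolding e_def using A angular_factor_bounds[of "V \<bullet> \<sigma>"]
        by (intro mult_left_mono order_trans[OF esum_le_esum_0[OF y] esum_add_le]) auto
      finally show ?thesis .
    qed
    have "(\<integral>\<^sup>+\<sigma>. kern \<beta> k v w \<sigma> * (F v * F w * ennreal (esum p0 N (a * \<rho> (post_v v w \<sigma>)))) \<partial>sph)
      \<le> (\<integral>\<^sup>+\<sigma>. ennreal (norm (v - w) powr \<beta>) * (H v * H w) * (k (u \<bullet> \<sigma>) * ennreal (angular_factor (V \<bullet> \<sigma>) ^ p0)) \<partial>sph)"
    proof (rule nn_integral_mono_AE, use AE_sph in eventually_elim)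
      case (elim \<sigma>)
      have "ennreal (esum p0 N (a * \<rho> (post_v v w \<sigma>))) \<le> ennreal (angular_factor (V \<bullet> \<sigma>) ^ p0 * (e v * e w))"
        by (rule ennreal_leI[OF pw[OF elim]])
      also have "\<dots> = ennreal (angular_factor (V \<bullet> \<sigma>) ^ p0) * (ennreal (e v) * ennreal (e w))"
        using e angular_factor_bounds[of "V \<bullet> \<sigma>"] by (simp add: ennreal_mult)
      finally have "kern \<beta> k v w \<sigma> * (F v * F w * ennreal (esum p0 N (a * \<rho> (post_v v w \<sigma>))))
        \<le> kern \<beta> k v w \<sigma> * (F v * F w * (ennreal (angular_factor (V \<bullet> \<sigma>) ^ p0) * (ennreal (e v) * ennreal (e w))))"
        by (intro mult_left_mono) auto
      also have "\<dots> = ennreal (norm (v - w) powr \<beta>) * (H v * H w) * (k (u \<bullet> \<sigma>) * ennreal (angular_factor (V \<bullet> \<sigma>) ^ p0))"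
        unfolding kern_def H_def cos_theta_def u_def by (simp only: mult_ac)
      finally show ?case .
    qed
    also have "\<dots> = ennreal (norm (v - w) powr \<beta>) * (H v * H w) * (\<integral>\<^sup>+\<sigma>. k (u \<bullet> \<sigma>) * ennreal (angular_factor (V \<bullet> \<sigma>) ^ p0) \<partial>sph)"
      by (rule nn_integral_cmult) measurable
    also have "\<dots> \<le> ennreal (norm (v - w) powr \<beta>) * (H v * H w) * ennreal \<gamma>"
      by (intro mult_left_mono \<gamma> u V) auto
    finally show ?thesis by (simp only: mult_ac)
  qed
  have "gain F (\<lambda>v. ennreal (esum p0 N (a * \<rho> v))) \<le> (\<integral>\<^sup>+v. \<integral>\<^sup>+w. ennreal \<gamma> * (ennreal (norm (v - w) powr \<beta>) * (H v * H w)) \<partial>lborel \<partial>lborel)"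
    unfolding gain_def by (rule nn_integral_mono, rule nn_integral_mono, rule inner)
  also have "\<dots> = ennreal \<gamma> * (\<integral>\<^sup>+v. \<integral>\<^sup>+w. ennreal (norm (v - w) powr \<beta>) * (H v * H w) \<partial>lborel \<partial>lborel)"
    by (simp add: nn_integral_cmult)
  also have "\<dots> \<le> ennreal \<gamma> * (2 * ((\<integral>\<^sup>+v. H v * ennreal (\<rho> v) \<partial>lborel) * (\<integral>\<^sup>+w. H w \<partial>lborel)
        + (\<integral>\<^sup>+v. H v \<partial>lborel) * (\<integral>\<^sup>+w. H w * ennreal (\<rho> w) \<partial>lborel)))"
    by (intro mult_left_mono rel_speed_integral_le) auto
  also have "\<dots> = ennreal \<gamma> * (2 * (2 * ((\<integral>\<^sup>+v. H v * ennreal (\<rho> v) \<partial>lborel) * (\<integral>\<^sup>+w. H w \<partial>lborel))))"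
    by (simp only: mult_2 mult.commute)
  also have "\<dots> = 4 * ennreal \<gamma> * (\<integral>\<^sup>+v. H v * ennreal (\<rho> v) \<partial>lborel) * (\<integral>\<^sup>+v. H v \<partial>lborel)"
  proof -
    have "(4::ennreal) = 2 * 2" by simp
    then show ?thesis by (simp only: mult_ac)
  qed
  also have "(\<integral>\<^sup>+v. H v * ennreal (\<rho> v) \<partial>lborel) = (\<integral>\<^sup>+v. F v * ennreal (\<rho> v * e v) \<partial>lborel)"
    using e by (simp add: H_def ennreal_mult mult_ac)
  finally show ?thesis unfolding H_def e_def .
qed

text \<open>From \<open>\<rho> v \<le> 2 * (norm (v - w) powr \<beta> + \<rho> w)\<close>: the loss
  controls a moment with the additional weight \<open>\<rho>\<close>, up to a product of lower
  ones.\<close>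

lemma loss_lower:
  fixes F :: "'a \<Rightarrow> ennreal"
  assumes [measurable]: "F \<in> borel_measurable borel" "\<phi> \<in> borel_measurable borel"
  shows "ennreal \<Lambda> * ((\<integral>\<^sup>+v. F v \<partial>lborel) * (\<integral>\<^sup>+v. F v * (ennreal (\<rho> v) * \<phi> v) \<partial>lborel))
    \<le> 2 * loss F \<phi> + 2 * ennreal \<Lambda> * ((\<integral>\<^sup>+v. F v * ennreal (\<rho> v) \<partial>lborel) * (\<integral>\<^sup>+v. F v * \<phi> v \<partial>lborel))"
proof -
  have "(\<integral>\<^sup>+v. F v \<partial>lborel) * (\<integral>\<^sup>+v. F v * (ennreal (\<rho> v) * \<phi> v) \<partial>lborel)
     = (\<integral>\<^sup>+v. \<integral>\<^sup>+w. ennreal (\<rho> v) * (F v * F w * \<phi> v) \<partial>lborel \<partial>lborel)"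
  proof -
    have "(\<integral>\<^sup>+v. \<integral>\<^sup>+w. ennreal (\<rho> v) * (F v * F w * \<phi> v) \<partial>lborel \<partial>lborel)
      = (\<integral>\<^sup>+v. \<integral>\<^sup>+w. (F v * (ennreal (\<rho> v) * \<phi> v)) * F w \<partial>lborel \<partial>lborel)"
      by (simp only: mult_ac)
    then show ?thesis by (simp add: nn_integral_cmult nn_integral_multc mult.commute)
  qed
  also have "\<dots> \<le> (\<integral>\<^sup>+v. \<integral>\<^sup>+w. 2 * (ennreal (norm (v - w) powr \<beta>) * (F v * F w * \<phi> v)) + 2 * ((F v * \<phi> v) * (F w * ennreal (\<rho> w))) \<partial>lborel \<partial>lborel)"
  proof (rule nn_integral_mono, rule nn_integral_mono)
    fix v w
    have "ennreal (\<rho> v) \<le> ennreal (2 * (norm (v - w) powr \<beta> + \<rho> w))"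
      by (intro ennreal_leI rho_le_rel_speed)
    also have "\<dots> = 2 * ennreal (norm (v - w) powr \<beta>) + 2 * ennreal (\<rho> w)"
      by (simp add: ennreal_mult distrib_left)
    finally have "ennreal (\<rho> v) * (F v * F w * \<phi> v) \<le> (2 * ennreal (norm (v - w) powr \<beta>) + 2 * ennreal (\<rho> w)) * (F v * F w * \<phi> v)"
      by (intro mult_right_mono) auto
    then show "ennreal (\<rho> v) * (F v * F w * \<phi> v) \<le> 2 * (ennreal (norm (v - w) powr \<beta>) * (F v * F w * \<phi> v)) + 2 * ((F v * \<phi> v) * (F w * ennreal (\<rho> w)))"
      by (simp only: distrib_left distrib_right mult_ac)
  qed
  also have "\<dots> = 2 * (\<integral>\<^sup>+v. \<integral>\<^sup>+w. ennreal (norm (v - w) powr \<beta>) * (F v * F w * \<phi> v) \<partial>lborel \<partial>lborel)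
      + 2 * ((\<integral>\<^sup>+v. F v * \<phi> v \<partial>lborel) * (\<integral>\<^sup>+w. F w * ennreal (\<rho> w) \<partial>lborel))"
    by (simp add: nn_integral_add nn_integral_cmult nn_integral_multc)
  finally have "ennreal \<Lambda> * ((\<integral>\<^sup>+v. F v \<partial>lborel) * (\<integral>\<^sup>+v. F v * (ennreal (\<rho> v) * \<phi> v) \<partial>lborel))
    \<le> ennreal \<Lambda> * (2 * (\<integral>\<^sup>+v. \<integral>\<^sup>+w. ennreal (norm (v - w) powr \<beta>) * (F v * F w * \<phi> v) \<partial>lborel \<partial>lborel)
      + 2 * ((\<integral>\<^sup>+v. F v * \<phi> v \<partial>lborel) * (\<integral>\<^sup>+w. F w * ennreal (\<rho> w) \<partial>lborel)))"
    by (intro mult_left_mono) auto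
  also have "\<dots> = 2 * loss F \<phi> + 2 * ennreal \<Lambda> * ((\<integral>\<^sup>+v. F v * ennreal (\<rho> v) \<partial>lborel) * (\<integral>\<^sup>+v. F v * \<phi> v \<partial>lborel))"
    by (subst loss_eq) (simp_all only: assms distrib_left mult_ac)
  finally show ?thesis .
qed

text \<open>The gain and the share reserved for the time derivative are each at most
  \<open>\<Lambda> * M / 8\<close> times the \<open>\<rho>\<close>-weighted exponential sum. Doubled
  and reduced to orders from \<open>p0\<close> on, they amount to \<open>\<Lambda> * M\<close> times
  its high part, exactly what \<open>loss_lower\<close> supplies. In the constant,
  \<open>C0 / 4\<close> stems from the low orders and 4 from the correction in
  \<open>loss_lower\<close>.\<close>

lemma exponential_balance:
  fixes M E C0 \<gamma> :: real and F :: "'a \<Rightarrow> ennreal"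
  assumes F[measurable]: "F \<in> borel_measurable borel" and M: "0 < M" and E: "0 \<le> E" and a: "0 \<le> a" and C0: "1 \<le> C0"
    and FM: "(\<integral>\<^sup>+v. F v \<partial>lborel) = ennreal M"
    and Fr: "(\<integral>\<^sup>+v. F v * ennreal (\<rho> v) \<partial>lborel) \<le> ennreal (M + E)"
    and \<gamma>: "\<And>u V::'a. norm u = 1 \<Longrightarrow> norm V = 1 \<Longrightarrow>
      (\<integral>\<^sup>+\<sigma>. k (u \<bullet> \<sigma>) * ennreal (angular_factor (V \<bullet> \<sigma>) ^ p0) \<partial>sph) \<le> ennreal (\<Lambda> / 128)"
    and low: "\<And>x. 0 \<le> x \<Longrightarrow> esum 0 N x \<le> C0 + 2 * esum p0 N x"
    and J: "(\<integral>\<^sup>+v. F v * ennreal (esum 0 N (a * \<rho> v)) \<partial>lborel) \<le> ennreal (4 * M)"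
  shows "ennreal (\<Lambda> * M / 8) * (\<integral>\<^sup>+v. F v * ennreal (\<rho> v * esum 0 N (a * \<rho> v)) \<partial>lborel)
      + gain F (\<lambda>v. ennreal (esum p0 N (a * \<rho> v)))
    \<le> ennreal ((M + E) * (\<Lambda> * M * (4 + C0 / 4))) + loss F (\<lambda>v. ennreal (esum p0 N (a * \<rho> v)))"
proof -
  let ?\<phi> = "\<lambda>v. ennreal (esum p0 N (a * \<rho> v))"
  define I where "I = (\<integral>\<^sup>+v. F v * ennreal (\<rho> v * esum 0 N (a * \<rho> v)) \<partial>lborel)"
  define R where "R = (\<integral>\<^sup>+v. F v * (ennreal (\<rho> v) * ?\<phi> v) \<partial>lborel)"
  define m1 where "m1 = (\<integral>\<^sup>+v. F v * ennreal (\<rho> v) \<partial>lborel)"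
  define X where "X = (\<integral>\<^sup>+v. F v * ?\<phi> v \<partial>lborel)"
  have L0: "0 < \<Lambda>" by (rule Lambda)
  have num: "(2::ennreal) = ennreal 2" "(4::ennreal) = ennreal 4" by simp_all
  have nn: "0 \<le> esum m N (a * \<rho> v)" for m v using a by (intro esum_nonneg) auto
  have XJ: "X \<le> ennreal (4 * M)"
    unfolding X_def using a by (intro order_trans[OF _ J] nn_integral_mono mult_left_mono ennreal_leI esum_le_esum_0) auto
  have I: "I \<le> ennreal C0 * m1 + 2 * R"
  proof -
    have "I \<le> (\<integral>\<^sup>+v. ennreal C0 * (F v * ennreal (\<rho> v)) + 2 * (F v * (ennreal (\<rho> v) * ?\<phi> v)) \<partial>lborel)"
      unfolding I_def
    proof (rule nn_integral_mono)
      fix v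
      have "\<rho> v * esum 0 N (a * \<rho> v) \<le> \<rho> v * (C0 + 2 * esum p0 N (a * \<rho> v))"
        using a by (intro mult_left_mono low) auto
      then have "ennreal (\<rho> v * esum 0 N (a * \<rho> v)) \<le> ennreal (\<rho> v * (C0 + 2 * esum p0 N (a * \<rho> v)))"
        by (rule ennreal_leI)
      also have "\<dots> = ennreal (\<rho> v) * (ennreal C0 + 2 * ?\<phi> v)"
        using C0 nn[of p0 v] by (simp add: ennreal_mult)
      finally have "F v * ennreal (\<rho> v * esum 0 N (a * \<rho> v)) \<le> F v * (ennreal (\<rho> v) * (ennreal C0 + 2 * ?\<phi> v))"
        by (intro mult_left_mono) auto
      then show "F v * ennreal (\<rho> v * esum 0 N (a * \<rho> v)) \<le> ennreal C0 * (F v * ennreal (\<rho> v)) + 2 * (F v * (ennreal (\<rho> v) * ?\<phi> v))"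
        by (simp only: distrib_left mult_ac)
    qed
    also have "\<dots> = ennreal C0 * m1 + 2 * R"
      unfolding m1_def R_def by (simp add: nn_integral_add nn_integral_cmult)
    finally show ?thesis .
  qed
  \<comment> \<open>The threshold \<open>\<Lambda> / 128\<close> is fixed here:
    \<open>4 * (\<Lambda> / 128) * (4 * M) = \<Lambda> * M / 8\<close>.\<close>
  have G: "gain F ?\<phi> \<le> ennreal (\<Lambda> * M / 8) * I"
  proof -
    have "gain F ?\<phi> \<le> 4 * ennreal (\<Lambda> / 128) * I * (\<integral>\<^sup>+v. F v * ennreal (esum 0 N (a * \<rho> v)) \<partial>lborel)"
      unfolding I_def using a by (intro gain_esum_le \<gamma>) auto
    also have "\<dots> \<le> 4 * ennreal (\<Lambda> / 128) * I * ennreal (4 * M)"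
      by (intro mult_left_mono J) auto
    also have "\<dots> = 4 * ennreal (\<Lambda> / 128) * ennreal (4 * M) * I" by (simp only: mult_ac)
    also have "4 * ennreal (\<Lambda> / 128) * ennreal (4 * M) = ennreal (4 * (\<Lambda> / 128) * (4 * M))"
      unfolding num using L0 M by (subst ennreal_mult[symmetric], simp, simp)+ simp
    also have "4 * (\<Lambda> / 128) * (4 * M) = \<Lambda> * M / 8" by simp
    finally show ?thesis .
  qed
  have "2 * (ennreal (\<Lambda> * M / 8) * I + gain F ?\<phi>) \<le> 2 * (ennreal (\<Lambda> * M / 8) * I + ennreal (\<Lambda> * M / 8) * I)"
    by (intro mult_left_mono add_left_mono G) auto
  also have "\<dots> = ennreal (\<Lambda> * M / 2) * I"
  proof -
    have "2 * (x + x) = 4 * x" for x :: ennreal by (simp add: mult_2[symmetric] mult.assoc[symmetric])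
    moreover have "4 * ennreal (\<Lambda> * M / 8) = ennreal (\<Lambda> * M / 2)"
      unfolding num using L0 M by (subst ennreal_mult[symmetric]) auto
    ultimately show ?thesis by (metis mult.assoc)
  qed
  also have "\<dots> \<le> ennreal (\<Lambda> * M / 2) * (ennreal C0 * m1 + 2 * R)"
    by (intro mult_left_mono I) auto
  also have "\<dots> = ennreal (\<Lambda> * M / 2) * ennreal C0 * m1 + ennreal \<Lambda> * (ennreal M * R)"
  proof -
    have "ennreal (\<Lambda> * M / 2) * 2 = ennreal \<Lambda> * ennreal M"
      using L0 M ennreal_mult[of "\<Lambda> * M / 2" 2] by (simp add: ennreal_mult)
    then have "ennreal (\<Lambda> * M / 2) * (2 * R) = ennreal \<Lambda> * (ennreal M * R)"
      by (metis mult.assoc)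
    then show ?thesis by (simp add: distrib_left mult.assoc)
  qed
  also have "\<dots> \<le> ennreal (\<Lambda> * M / 2) * ennreal C0 * m1 + (2 * loss F ?\<phi> + 2 * ennreal \<Lambda> * (m1 * X))"
    using loss_lower[OF F, of ?\<phi>] unfolding FM R_def[symmetric] m1_def[symmetric] X_def[symmetric]
    by (intro add_left_mono) simp
  also have "\<dots> \<le> ennreal (\<Lambda> * M / 2) * ennreal C0 * ennreal (M + E) + (2 * loss F ?\<phi> + 2 * ennreal \<Lambda> * (ennreal (M + E) * ennreal (4 * M)))"
    using Fr XJ unfolding m1_def[symmetric] by (intro add_mono mult_mono) auto
  also have "\<dots> = 2 * (ennreal ((M + E) * (\<Lambda> * M * (4 + C0 / 4))) + loss F ?\<phi>)"
  proof -
    have "ennreal (\<Lambda> * M / 2) * ennreal C0 * ennreal (M + E) = ennreal (\<Lambda> * M / 2 * C0 * (M + E))"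
      using L0 M C0 E by (subst ennreal_mult[symmetric], simp, simp)+ simp
    moreover have "2 * ennreal \<Lambda> * (ennreal (M + E) * ennreal (4 * M)) = ennreal (2 * \<Lambda> * ((M + E) * (4 * M)))"
      unfolding num using L0 M E by (subst ennreal_mult[symmetric], simp, simp)+ simp
    moreover have "2 * ennreal ((M + E) * (\<Lambda> * M * (4 + C0 / 4))) = ennreal (\<Lambda> * M / 2 * C0 * (M + E) + 2 * \<Lambda> * ((M + E) * (4 * M)))"
    proof -
      have "\<Lambda> * M / 2 * C0 * (M + E) + 2 * \<Lambda> * ((M + E) * (4 * M)) = 2 * ((M + E) * (\<Lambda> * M * (4 + C0 / 4)))"
        by (simp add: algebra_simps)
      moreover have "0 \<le> (M + E) * (\<Lambda> * M * (4 + C0 / 4))" using L0 M E C0 by simp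
      ultimately show ?thesis unfolding num by (simp only: ennreal_mult[OF zero_le_numeral])
    qed
    moreover have "ennreal (\<Lambda> * M / 2 * C0 * (M + E) + 2 * \<Lambda> * ((M + E) * (4 * M))) = ennreal (\<Lambda> * M / 2 * C0 * (M + E)) + ennreal (2 * \<Lambda> * ((M + E) * (4 * M)))"
      using L0 M E C0 by (intro ennreal_plus) auto
    ultimately show ?thesis by (simp only: distrib_left add_ac)
  qed
  finally have "2 * (ennreal (\<Lambda> * M / 8) * I + gain F ?\<phi>) \<le> 2 * (ennreal ((M + E) * (\<Lambda> * M * (4 + C0 / 4))) + loss F ?\<phi>)" .
  then show ?thesis
    unfolding I_def by (subst (asm) ennreal_mult_le_mult_iff) auto
qed

end

section \<open>Time-weighted moments\<close>

lemma nn_integral_power_shift: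
  fixes t0 r :: real
  assumes "t0 \<le> r" "1 \<le> p"
  shows "(\<integral>\<^sup>+\<tau>. ennreal (real p * (\<tau> - t0) ^ (p - 1)) * indicator {t0<..<r} \<tau> \<partial>lborel) = ennreal ((r - t0) ^ p)"
proof -
  have "(\<integral>\<^sup>+\<tau>. ennreal (real p * (\<tau> - t0) ^ (p - 1)) * indicator {t0<..<r} \<tau> \<partial>lborel)
     = (\<integral>\<^sup>+\<tau>. ennreal (real p * \<tau> ^ (p - 1)) * indicator {0<..<r - t0} \<tau> \<partial>lborel)"
  proof -
    have "(\<integral>\<^sup>+\<tau>. (\<lambda>s. ennreal (real p * s ^ (p - 1)) * indicator {0<..<r - t0} s) (\<tau> + - t0) \<partial>lborel)
      = (\<integral>\<^sup>+s. ennreal (real p * s ^ (p - 1)) * indicator {0<..<r - t0} s \<partial>lborel)"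
      by (rule nn_integral_lborel_translate) measurable
    moreover have "indicator {0<..<r - t0} (\<tau> + - t0) = (indicator {t0<..<r} \<tau> :: ennreal)" for \<tau>
      by (auto simp: indicator_def)
    ultimately show ?thesis by simp
  qed
  also have "\<dots> = (\<integral>\<^sup>+\<tau>. ennreal (real p) * (ennreal (\<tau> ^ (p - 1)) * indicator {0<..<r - t0} \<tau>) \<partial>lborel)"
    by (intro nn_integral_cong) (auto simp: indicator_def ennreal_mult)
  also have "\<dots> = ennreal (real p) * ennreal ((r - t0) ^ Suc (p - 1) / Suc (p - 1))"
    using assms by (simp add: nn_integral_cmult nn_integral_power_interval)
  also have "\<dots> = ennreal ((r - t0) ^ p)"
    using assms by (subst ennreal_mult[symmetric]) (auto simp: Suc_diff_1)
  finally show ?thesis .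
qed

lemma esum_tendsto_exp: "(\<lambda>N. esum 0 N x) \<longlonglongrightarrow> exp x"
proof -
  have "(\<lambda>n. x ^ n / fact n) sums exp x"
    using exp_converges[of x] by (simp add: divide_inverse mult.commute)
  then show ?thesis by (simp add: sums_def_le esum_def atLeast0AtMost)
qed

text \<open>At the first time with \<open>h \<ge> 4 * M\<close> the hypothesis of
  \<open>step\<close> holds at all earlier times, and its conclusion contradicts that value.\<close>

lemma continuity_bootstrap:
  fixes h :: "real \<Rightarrow> real"
  assumes cont: "continuous_on {t0..t1} h" and M: "0 < M"
    and step: "\<And>t. t0 \<le> t \<Longrightarrow> t \<le> t1 \<Longrightarrow> (\<And>\<tau>. t0 < \<tau> \<Longrightarrow> \<tau> < t \<Longrightarrow> h \<tau> \<le> 4 * M) \<Longrightarrow> h t \<le> 2 * M"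
    and t: "t0 \<le> t" "t \<le> t1"
  shows "h t \<le> 2 * M"
proof -
  define S where "S = {\<tau> \<in> {t0..t1}. 4 * M \<le> h \<tau>}"
  have "S = {}"
  proof (rule ccontr)
    assume "S \<noteq> {}"
    have "closed S"
      unfolding S_def using continuous_on_closed_Collect_le[OF continuous_on_const cont closed_atLeastAtMost, of "4 * M"] by simp
    moreover have "bounded S" unfolding S_def by (rule bounded_subset[OF bounded_closed_interval[of t0 t1]]) auto
    ultimately have "compact S" by (simp add: compact_eq_bounded_closed)
    from compact_attains_inf[OF this \<open>S \<noteq> {}\<close>] obtain s where s: "s \<in> S" "\<And>\<tau>. \<tau> \<in> S \<Longrightarrow> s \<le> \<tau>" by blast
    have "h s \<le> 2 * M"
    proof (rule step)
      fix \<tau> assume "t0 < \<tau>" "\<tau> < s"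
      then have "\<tau> \<notin> S" using s(2)[of \<tau>] by auto
      moreover have "\<tau> \<in> {t0..t1}" using s(1) \<open>t0 < \<tau>\<close> \<open>\<tau> < s\<close> by (auto simp: S_def)
      ultimately show "h \<tau> \<le> 4 * M" by (auto simp: S_def)
    qed (use s(1) in \<open>auto simp: S_def\<close>)
    then show False using s(1) M by (simp add: S_def)
  qed
  have "h \<tau> \<le> 4 * M" if "t0 < \<tau>" "\<tau> < t" for \<tau>
  proof -
    have "\<tau> \<notin> S" using \<open>S = {}\<close> by simp
    then show ?thesis using that t by (auto simp: S_def)
  qed
  then show ?thesis using step[OF t] by blast
qed

context hard_potential
begin

lemma gain_sum:
  assumes [measurable]: "F \<in> borel_measurable borel" "\<And>p. \<phi> p \<in> borel_measurable borel"
  shows "gain F (\<lambda>v. \<Sum>p\<in>P. c p * \<phi> p v) = (\<Sum>p\<in>P. c p * gain F (\<phi> p))"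
proof -
  have "gain F (\<lambda>v. \<Sum>p\<in>P. c p * \<phi> p v)
    = (\<integral>\<^sup>+v. \<integral>\<^sup>+w. \<integral>\<^sup>+\<sigma>. (\<Sum>p\<in>P. c p * (kern \<beta> k v w \<sigma> * (F v * F w * \<phi> p (post_v v w \<sigma>)))) \<partial>sph \<partial>lborel \<partial>lborel)"
    unfolding gain_def by (simp only: sum_distrib_left mult_ac)
  also have "\<dots> = (\<Sum>p\<in>P. c p * gain F (\<phi> p))"
    unfolding gain_def by (simp add: nn_integral_sum nn_integral_cmult)
  finally show ?thesis .
qed

lemma loss_sum:
  assumes [measurable]: "F \<in> borel_measurable borel" "\<And>p. \<phi> p \<in> borel_measurable borel"
  shows "loss F (\<lambda>v. \<Sum>p\<in>P. c p * \<phi> p v) = (\<Sum>p\<in>P. c p * loss F (\<phi> p))"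
proof -
  have "loss F (\<lambda>v. \<Sum>p\<in>P. c p * \<phi> p v)
    = (\<integral>\<^sup>+v. \<integral>\<^sup>+w. \<integral>\<^sup>+\<sigma>. (\<Sum>p\<in>P. c p * (kern \<beta> k v w \<sigma> * (F v * F w * \<phi> p v))) \<partial>sph \<partial>lborel \<partial>lborel)"
    unfolding loss_def by (simp only: sum_distrib_left mult_ac)
  also have "\<dots> = (\<Sum>p\<in>P. c p * loss F (\<phi> p))"
    unfolding loss_def by (simp add: nn_integral_sum nn_integral_cmult)
  finally show ?thesis .
qed

lemma ennreal_esum:
  assumes "0 \<le> a"
  shows "ennreal (esum m N (a * \<rho> v)) = (\<Sum>p\<in>{m..N}. ennreal (a ^ p / fact p) * ennreal (\<rho> v ^ p))"
  using assms unfolding esum_def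
  by (subst sum_ennreal[symmetric]) (auto simp: power_mult_distrib ennreal_mult[symmetric])

end

section \<open>Evolution of the moments in time\<close>

context boltzmann_flow
begin

definition mom :: "nat \<Rightarrow> real \<Rightarrow> ennreal" where
  "mom p t = (\<integral>\<^sup>+v. F t v * ennreal (\<rho> v ^ p) \<partial>lborel)"

lemma measurable_mom[measurable]: "mom p \<in> borel_measurable borel"
  unfolding mom_def by measurable

lemma mom_esum:
  assumes "0 \<le> a"
  shows "(\<integral>\<^sup>+v. F t v * ennreal (esum m N (a * \<rho> v)) \<partial>lborel) = (\<Sum>p\<in>{m..N}. ennreal (a ^ p / fact p) * mom p t)"
  unfolding ennreal_esum[OF assms] mom_def
  by (simp add: sum_distrib_left mult.left_commute[of "F t _"] nn_integral_sum nn_integral_cmult)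

lemma mom_rho_esum:
  assumes "0 \<le> a"
  shows "(\<integral>\<^sup>+v. F t v * ennreal (\<rho> v * esum m N (a * \<rho> v)) \<partial>lborel) = (\<Sum>p\<in>{m..N}. ennreal (a ^ p / fact p) * mom (Suc p) t)"
proof -
  have "ennreal (\<rho> v * esum m N (a * \<rho> v)) = (\<Sum>p\<in>{m..N}. ennreal (a ^ p / fact p) * ennreal (\<rho> v ^ Suc p))" for v
  proof -
    have "ennreal (\<rho> v * esum m N (a * \<rho> v)) = ennreal (\<rho> v) * ennreal (esum m N (a * \<rho> v))"
      using assms by (intro ennreal_mult) (simp_all add: esum_nonneg)
    also have "\<dots> = (\<Sum>p\<in>{m..N}. ennreal (a ^ p / fact p) * ennreal (\<rho> v ^ Suc p))"
      unfolding ennreal_esum[OF assms] sum_distrib_left by (intro sum.cong refl) (simp add: ennreal_mult mult_ac)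
    finally show ?thesis .
  qed
  then show ?thesis
    unfolding mom_def by (simp add: sum_distrib_left mult.left_commute[of "F t _"] nn_integral_sum nn_integral_cmult del: power_Suc)
qed

lemma mom_weak:
  assumes "0 \<le> s" "s \<le> t"
  shows "mom p t + (\<integral>\<^sup>+\<tau>. loss (F \<tau>) (\<lambda>v. ennreal (\<rho> v ^ p)) * indicator {s<..t} \<tau> \<partial>lborel)
    = mom p s + (\<integral>\<^sup>+\<tau>. gain (F \<tau>) (\<lambda>v. ennreal (\<rho> v ^ p)) * indicator {s<..t} \<tau> \<partial>lborel)"
  unfolding mom_def by (rule weak_form[OF assms]) measurable

text \<open>Integrating the weak form between \<open>\<tau>\<close> and \<open>t\<close> against \<open>d (\<tau> - t0) ^ p\<close> replaces the product
  rule for \<open>(t - t0) ^ p * mom p t\<close>.\<close>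
lemma weighted_mom_weak:
  assumes t: "0 \<le> t0" "t0 \<le> t" and p: "1 \<le> p"
  shows "ennreal ((t - t0) ^ p) * mom p t
      + (\<integral>\<^sup>+r. ennreal ((r - t0) ^ p) * loss (F r) (\<lambda>v. ennreal (\<rho> v ^ p)) * indicator {t0<..t} r \<partial>lborel)
    = (\<integral>\<^sup>+\<tau>. ennreal (real p * (\<tau> - t0) ^ (p - 1)) * mom p \<tau> * indicator {t0<..<t} \<tau> \<partial>lborel)
      + (\<integral>\<^sup>+r. ennreal ((r - t0) ^ p) * gain (F r) (\<lambda>v. ennreal (\<rho> v ^ p)) * indicator {t0<..t} r \<partial>lborel)"
proof -
  define w where "w \<tau> = ennreal (real p * (\<tau> - t0) ^ (p - 1)) * indicator {t0<..<t} \<tau>" for \<tau>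
  have [measurable]: "w \<in> borel_measurable borel" unfolding w_def by measurable
  let ?L = "\<lambda>\<tau>. loss (F \<tau>) (\<lambda>v. ennreal (\<rho> v ^ p))" and ?G = "\<lambda>\<tau>. gain (F \<tau>) (\<lambda>v. ennreal (\<rho> v ^ p))"
  \<comment> \<open>After exchanging the integrals, only \<open>\<tau> < r\<close> contributes, and
    \<open>w\<close> integrates to \<open>(r - t0) ^ p\<close> there.\<close>
  have fub: "(\<integral>\<^sup>+\<tau>. w \<tau> * (\<integral>\<^sup>+r. H r * indicator {\<tau><..t} r \<partial>lborel) \<partial>lborel)
      = (\<integral>\<^sup>+r. ennreal ((r - t0) ^ p) * H r * indicator {t0<..t} r \<partial>lborel)"
    if [measurable]: "H \<in> borel_measurable borel" for H :: "real \<Rightarrow> ennreal"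
  proof -
    have ind: "(indicator {\<tau><..t} r :: ennreal) = indicator {..t} r * (if \<tau> < r then 1 else 0)" for \<tau> r
      by (auto simp: indicator_def)
    have [measurable]: "(\<lambda>x. indicator {fst x<..t} (snd x) :: ennreal) \<in> borel_measurable (borel \<Otimes>\<^sub>M borel)"
      unfolding ind by measurable
    have [measurable]: "(\<lambda>x. indicator {snd x<..t} (fst x) :: ennreal) \<in> borel_measurable (borel \<Otimes>\<^sub>M borel)"
      unfolding ind by measurable
    have "(\<integral>\<^sup>+\<tau>. w \<tau> * (\<integral>\<^sup>+r. H r * indicator {\<tau><..t} r \<partial>lborel) \<partial>lborel)
      = (\<integral>\<^sup>+\<tau>. \<integral>\<^sup>+r. w \<tau> * (H r * indicator {\<tau><..t} r) \<partial>lborel \<partial>lborel)"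
      by (simp add: nn_integral_cmult)
    also have "\<dots> = (\<integral>\<^sup>+r. \<integral>\<^sup>+\<tau>. w \<tau> * (H r * indicator {\<tau><..t} r) \<partial>lborel \<partial>lborel)"
      by (rule lborel_pair.Fubini') (simp add: case_prod_beta)
    also have "\<dots> = (\<integral>\<^sup>+r. ennreal ((r - t0) ^ p) * H r * indicator {t0<..t} r \<partial>lborel)"
    proof (rule nn_integral_cong)
      fix r :: real
      show "(\<integral>\<^sup>+\<tau>. w \<tau> * (H r * indicator {\<tau><..t} r) \<partial>lborel) = ennreal ((r - t0) ^ p) * H r * indicator {t0<..t} r"
      proof (cases "r \<in> {t0<..t}")
        case True
        have "(\<integral>\<^sup>+\<tau>. w \<tau> * (H r * indicator {\<tau><..t} r) \<partial>lborel)
          = (\<integral>\<^sup>+\<tau>. ennreal (real p * (\<tau> - t0) ^ (p - 1)) * indicator {t0<..<r} \<tau> * H r \<partial>lborel)"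
          using True by (intro nn_integral_cong) (auto simp: w_def indicator_def)
        also have "\<dots> = ennreal ((r - t0) ^ p) * H r"
          using True p nn_integral_power_shift[of t0 r p] by (simp add: nn_integral_multc)
        finally show ?thesis using True by simp
      next
        case False
        then have "(\<integral>\<^sup>+\<tau>. w \<tau> * (H r * indicator {\<tau><..t} r) \<partial>lborel) = (\<integral>\<^sup>+\<tau>. 0 \<partial>(lborel :: real measure))"
          by (intro nn_integral_cong) (auto simp: w_def indicator_def)
        then show ?thesis using False by simp
      qed
    qed
    finally show ?thesis .
  qed
  have w: "(\<integral>\<^sup>+\<tau>. w \<tau> \<partial>lborel) = ennreal ((t - t0) ^ p)"
    unfolding w_def using t p by (intro nn_integral_power_shift) auto
  have [measurable]: "(\<lambda>\<tau>. \<integral>\<^sup>+r. H r * indicator {\<tau><..t} r \<partial>lborel) \<in> borel_measurable borel"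
    if [measurable]: "H \<in> borel_measurable borel" for H :: "real \<Rightarrow> ennreal"
  proof -
    have ind: "(indicator {\<tau><..t} r :: ennreal) = indicator {..t} r * (if \<tau> < r then 1 else 0)" for \<tau> r
      by (auto simp: indicator_def)
    show ?thesis unfolding ind by measurable
  qed
  have "(\<integral>\<^sup>+\<tau>. w \<tau> * (mom p t + (\<integral>\<^sup>+r. ?L r * indicator {\<tau><..t} r \<partial>lborel)) \<partial>lborel)
     = (\<integral>\<^sup>+\<tau>. w \<tau> * (mom p \<tau> + (\<integral>\<^sup>+r. ?G r * indicator {\<tau><..t} r \<partial>lborel)) \<partial>lborel)"
  proof (rule nn_integral_cong)
    fix \<tau>
    show "w \<tau> * (mom p t + (\<integral>\<^sup>+r. ?L r * indicator {\<tau><..t} r \<partial>lborel))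
      = w \<tau> * (mom p \<tau> + (\<integral>\<^sup>+r. ?G r * indicator {\<tau><..t} r \<partial>lborel))"
    proof (cases "\<tau> \<in> {t0<..<t}")
      case True
      then show ?thesis using mom_weak[of \<tau> t p] t by simp
    qed (simp add: w_def)
  qed
  then have "(\<integral>\<^sup>+\<tau>. w \<tau> \<partial>lborel) * mom p t + (\<integral>\<^sup>+\<tau>. w \<tau> * (\<integral>\<^sup>+r. ?L r * indicator {\<tau><..t} r \<partial>lborel) \<partial>lborel)
    = (\<integral>\<^sup>+\<tau>. w \<tau> * mom p \<tau> \<partial>lborel) + (\<integral>\<^sup>+\<tau>. w \<tau> * (\<integral>\<^sup>+r. ?G r * indicator {\<tau><..t} r \<partial>lborel) \<partial>lborel)"
    by (simp add: distrib_left nn_integral_add nn_integral_multc)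
  then show ?thesis
    unfolding w by (simp add: fub) (simp add: w_def mult_ac)
qed

lemma gain_mom_bound:
  assumes "0 < mass" "0 < t0"
  shows "\<exists>K\<ge>0. \<forall>t\<in>{t0..T}. gain (F t) (\<lambda>v. ennreal (\<rho> v ^ p)) \<le> ennreal K \<and> loss (F t) (\<lambda>v. ennreal (\<rho> v ^ p)) \<le> ennreal K"
proof -
  have "\<forall>q. \<exists>K\<ge>0. \<forall>t\<in>{t0..T}. mom q t \<le> ennreal K"
    unfolding mom_def using moments_finite[OF assms] by blast
  then obtain Km where Km: "\<And>q. 0 \<le> Km q" "\<And>q t. t \<in> {t0..T} \<Longrightarrow> mom q t \<le> ennreal (Km q)"
    by metis
  define J where "J = (\<Sum>q\<in>{0..p}. 1 / fact q * Km q)"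
  define I where "I = (\<Sum>q\<in>{0..p}. 1 / fact q * Km (Suc q))"
  have IJ: "0 \<le> I" "0 \<le> J" unfolding I_def J_def using Km(1) by (auto intro!: sum_nonneg)
  have bJ: "(\<integral>\<^sup>+v. F t v * ennreal (esum 0 p (1 * \<rho> v)) \<partial>lborel) \<le> ennreal J" if t: "t \<in> {t0..T}" for t
  proof -
    have "(\<integral>\<^sup>+v. F t v * ennreal (esum 0 p (1 * \<rho> v)) \<partial>lborel) = (\<Sum>q\<in>{0..p}. ennreal (1 ^ q / fact q) * mom q t)"
      by (rule mom_esum) simp
    also have "\<dots> \<le> (\<Sum>q\<in>{0..p}. ennreal (1 / fact q) * ennreal (Km q))"
      by (intro sum_mono mult_mono Km t) auto
    also have "\<dots> = ennreal J"
      unfolding J_def using Km(1) by (subst sum_ennreal[symmetric]) (auto simp: ennreal_mult[symmetric])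
    finally show ?thesis .
  qed
  have bI: "(\<integral>\<^sup>+v. F t v * ennreal (\<rho> v * esum 0 p (1 * \<rho> v)) \<partial>lborel) \<le> ennreal I" if t: "t \<in> {t0..T}" for t
  proof -
    have "(\<integral>\<^sup>+v. F t v * ennreal (\<rho> v * esum 0 p (1 * \<rho> v)) \<partial>lborel) = (\<Sum>q\<in>{0..p}. ennreal (1 / fact q) * mom (Suc q) t)"
      using mom_rho_esum[of 1 t 0 p] by simp
    also have "\<dots> \<le> (\<Sum>q\<in>{0..p}. ennreal (1 / fact q) * ennreal (Km (Suc q)))"
      by (intro sum_mono mult_mono Km t) auto
    also have "\<dots> = ennreal I"
      unfolding I_def using Km(1) by (subst sum_ennreal[symmetric]) (auto simp: ennreal_mult[symmetric])
    finally show ?thesis .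
  qed
  define KG where "KG = fact p * (4 * \<Lambda> * I * J)"
  define KL where "KL = \<Lambda> * (2 * (Km (Suc p) * mass + Km p * (mass + energy)))"
  have nn: "0 \<le> KG" "0 \<le> KL"
    using IJ Km(1) Lambda mass_nonneg energy_nonneg by (auto simp: KG_def KL_def)
  have num: "(2::ennreal) = ennreal 2" "(4::ennreal) = ennreal 4" by simp_all
  have G: "gain (F t) (\<lambda>v. ennreal (\<rho> v ^ p)) \<le> ennreal KG" if t: "t \<in> {t0..T}" for t
  proof -
    have "gain (F t) (\<lambda>v. ennreal (\<rho> v ^ p)) \<le> gain (F t) (\<lambda>v. ennreal (fact p) * ennreal (esum p p (1 * \<rho> v)))"
      unfolding gain_def by (intro nn_integral_mono mult_left_mono) (auto simp: esum_def ennreal_mult[symmetric])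
    also have "\<dots> = ennreal (fact p) * gain (F t) (\<lambda>v. ennreal (esum p p (1 * \<rho> v)))"
      using gain_sum[of "F t" "\<lambda>_ v. ennreal (esum p p (1 * \<rho> v))" "\<lambda>_. ennreal (fact p)" "{0::nat}"] by simp
    also have "\<dots> \<le> ennreal (fact p) * (4 * ennreal \<Lambda> * (\<integral>\<^sup>+v. F t v * ennreal (\<rho> v * esum 0 p (1 * \<rho> v)) \<partial>lborel) * (\<integral>\<^sup>+v. F t v * ennreal (esum 0 p (1 * \<rho> v)) \<partial>lborel))"
    proof (intro mult_left_mono gain_esum_le)
      fix u V :: 'a assume u: "norm u = 1"
      have "(\<integral>\<^sup>+\<sigma>. k (u \<bullet> \<sigma>) * ennreal (angular_factor (V \<bullet> \<sigma>) ^ p) \<partial>sph) \<le> (\<integral>\<^sup>+\<sigma>. k (u \<bullet> \<sigma>) * 1 \<partial>sph)"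
        using angular_factor_power_le_1 by (intro nn_integral_mono mult_left_mono) (simp_all add: ennreal_le_1)
      then show "(\<integral>\<^sup>+\<sigma>. k (u \<bullet> \<sigma>) * ennreal (angular_factor (V \<bullet> \<sigma>) ^ p) \<partial>sph) \<le> ennreal \<Lambda>"
        using nn_integral_k[OF u] by simp
    qed auto
    also have "\<dots> \<le> ennreal (fact p) * (4 * ennreal \<Lambda> * ennreal I * ennreal J)"
      by (intro mult_left_mono mult_mono bI bJ t) auto
    also have "\<dots> = ennreal KG"
      unfolding num KG_def using Lambda IJ by (subst ennreal_mult[symmetric], simp, simp)+ simp
    finally show ?thesis .
  qed
  have L: "loss (F t) (\<lambda>v. ennreal (\<rho> v ^ p)) \<le> ennreal KL" if t: "t \<in> {t0..T}" for t
  proof -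
    have "loss (F t) (\<lambda>v. ennreal (\<rho> v ^ p)) = ennreal \<Lambda> * (\<integral>\<^sup>+v. \<integral>\<^sup>+w. ennreal (norm (v - w) powr \<beta>) * ((F t v * ennreal (\<rho> v ^ p)) * F t w) \<partial>lborel \<partial>lborel)"
      by (subst loss_eq) (simp_all add: mult_ac)
    also have "\<dots> \<le> ennreal \<Lambda> * (2 * ((\<integral>\<^sup>+v. F t v * ennreal (\<rho> v ^ p) * ennreal (\<rho> v) \<partial>lborel) * (\<integral>\<^sup>+w. F t w \<partial>lborel)
        + (\<integral>\<^sup>+v. F t v * ennreal (\<rho> v ^ p) \<partial>lborel) * (\<integral>\<^sup>+w. F t w * ennreal (\<rho> w) \<partial>lborel)))"
      by (intro mult_left_mono rel_speed_integral_le) auto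
    also have "(\<integral>\<^sup>+v. F t v * ennreal (\<rho> v ^ p) * ennreal (\<rho> v) \<partial>lborel) = mom (Suc p) t"
      unfolding mom_def by (simp add: ennreal_mult mult_ac)
    also have "ennreal \<Lambda> * (2 * (mom (Suc p) t * (\<integral>\<^sup>+w. F t w \<partial>lborel)
        + (\<integral>\<^sup>+v. F t v * ennreal (\<rho> v ^ p) \<partial>lborel) * (\<integral>\<^sup>+w. F t w * ennreal (\<rho> w) \<partial>lborel)))
      \<le> ennreal \<Lambda> * (2 * (ennreal (Km (Suc p)) * ennreal mass + ennreal (Km p) * ennreal (mass + energy)))"
      using Km(2)[OF t, of p, unfolded mom_def] F_rho_le[of t]
      by (intro mult_left_mono add_mono mult_mono Km t) (simp_all add: F_mass mass_nonneg energy_nonneg)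
    also have "\<dots> = ennreal KL"
    proof -
      have "ennreal (Km (Suc p)) * ennreal mass + ennreal (Km p) * ennreal (mass + energy) = ennreal (Km (Suc p) * mass + Km p * (mass + energy))"
        using Km(1) mass_nonneg energy_nonneg by (subst ennreal_plus) (auto simp: ennreal_mult)
      then show ?thesis
        unfolding num KL_def using Km(1) mass_nonneg energy_nonneg Lambda by (simp only:) ((subst ennreal_mult[symmetric], simp, simp)+, rule refl)
    qed
    finally show ?thesis .
  qed
  show ?thesis
  proof (intro exI[of _ "KG + KL"] conjI ballI)
    fix t assume t: "t \<in> {t0..T}"
    show "gain (F t) (\<lambda>v. ennreal (\<rho> v ^ p)) \<le> ennreal (KG + KL)" "loss (F t) (\<lambda>v. ennreal (\<rho> v ^ p)) \<le> ennreal (KG + KL)"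
      using G[OF t] L[OF t] nn order_trans[OF _ ennreal_leI[of KG "KG + KL"]] order_trans[OF _ ennreal_leI[of KL "KG + KL"]] by simp_all
  qed (use nn in simp)
qed

lemma mom_finite: "0 < mass \<Longrightarrow> 0 < t \<Longrightarrow> mom p t < top"
  using moments_finite[of t t p] unfolding mom_def by (auto intro: order_le_less_trans)

text \<open>Bounded gain and loss make each moment Lipschitz away from time 0. The bootstrap needs
  this continuity.\<close>

lemma continuous_on_mom:
  assumes "0 < mass" "0 < t0"
  shows "continuous_on {t0..T} (\<lambda>t. enn2real (mom p t))"
proof -
  obtain K where K: "0 \<le> K" "\<And>t. t \<in> {t0..T} \<Longrightarrow> gain (F t) (\<lambda>v. ennreal (\<rho> v ^ p)) \<le> ennreal K"
    "\<And>t. t \<in> {t0..T} \<Longrightarrow> loss (F t) (\<lambda>v. ennreal (\<rho> v ^ p)) \<le> ennreal K"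
    using gain_mom_bound[OF assms, of T p] by blast
  have key: "\<bar>enn2real (mom p t) - enn2real (mom p s)\<bar> \<le> K * (t - s)" if st: "s \<in> {t0..T}" "t \<in> {t0..T}" "s \<le> t" for s t
  proof -
    have int: "(\<integral>\<^sup>+\<tau>. H \<tau> * indicator {s<..t} \<tau> \<partial>lborel) \<le> ennreal (K * (t - s))"
      if H: "\<And>\<tau>. \<tau> \<in> {t0..T} \<Longrightarrow> H \<tau> \<le> ennreal K" for H :: "real \<Rightarrow> ennreal"
    proof -
      have "(\<integral>\<^sup>+\<tau>. H \<tau> * indicator {s<..t} \<tau> \<partial>lborel) \<le> (\<integral>\<^sup>+\<tau>. ennreal K * indicator {s<..t} \<tau> \<partial>lborel)"
        using H st by (intro nn_integral_mono) (auto simp: indicator_def)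
      also have "\<dots> = ennreal K * ennreal (t - s)"
        using st by (simp add: nn_integral_cmult)
      also have "\<dots> = ennreal (K * (t - s))"
        using st K by (intro ennreal_mult[symmetric]) auto
      finally show ?thesis .
    qed
    obtain x where x: "0 \<le> x" "mom p s = ennreal x" using mom_finite[of s p] assms st by (cases "mom p s") auto
    obtain y where y: "0 \<le> y" "mom p t = ennreal y" using mom_finite[of t p] assms st by (cases "mom p t") auto
    have W: "mom p t + (\<integral>\<^sup>+\<tau>. loss (F \<tau>) (\<lambda>v. ennreal (\<rho> v ^ p)) * indicator {s<..t} \<tau> \<partial>lborel)
      = mom p s + (\<integral>\<^sup>+\<tau>. gain (F \<tau>) (\<lambda>v. ennreal (\<rho> v ^ p)) * indicator {s<..t} \<tau> \<partial>lborel)"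
      using st assms by (intro mom_weak) auto
    have Kst: "0 \<le> K * (t - s)" using K st by simp
    have "ennreal y \<le> ennreal x + ennreal (K * (t - s))"
    proof -
      have "mom p t \<le> mom p t + (\<integral>\<^sup>+\<tau>. loss (F \<tau>) (\<lambda>v. ennreal (\<rho> v ^ p)) * indicator {s<..t} \<tau> \<partial>lborel)" by simp
      also have "\<dots> \<le> mom p s + ennreal (K * (t - s))" unfolding W by (intro add_left_mono int K)
      finally show ?thesis unfolding x(2) y(2) .
    qed
    moreover have "ennreal x \<le> ennreal y + ennreal (K * (t - s))"
    proof -
      have "mom p s \<le> mom p s + (\<integral>\<^sup>+\<tau>. gain (F \<tau>) (\<lambda>v. ennreal (\<rho> v ^ p)) * indicator {s<..t} \<tau> \<partial>lborel)" by simp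
      also have "\<dots> \<le> mom p t + ennreal (K * (t - s))" unfolding W[symmetric] by (intro add_left_mono int K)
      finally show ?thesis unfolding x(2) y(2) .
    qed
    ultimately have "y \<le> x + K * (t - s)" "x \<le> y + K * (t - s)"
      using x(1) y(1) Kst by (simp_all flip: ennreal_plus)
    then show ?thesis unfolding x(2) y(2) using x(1) y(1) by simp
  qed
  have "K-lipschitz_on {t0..T} (\<lambda>t. enn2real (mom p t))"
  proof (rule lipschitz_onI)
    fix s t assume "s \<in> {t0..T}" "t \<in> {t0..T}"
    then show "dist (enn2real (mom p s)) (enn2real (mom p t)) \<le> K * dist s t"
      using key[of s t] key[of t s] by (cases "s \<le> t") (auto simp: dist_real_def abs_minus_commute)
  qed (rule K)
  then show ?thesis by (rule lipschitz_on_continuous_on)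
qed

end

section \<open>Exponential moments\<close>

lemma ennreal_plus3: "0 \<le> x \<Longrightarrow> 0 \<le> y \<Longrightarrow> 0 \<le> z \<Longrightarrow> ennreal (x + (y + z)) = ennreal x + (ennreal y + ennreal z)"
  by simp

lemma nn_integral_Ioc_eq_Ioo:
  fixes s t :: real
  shows "(\<integral>\<^sup>+\<tau>. H \<tau> * indicator {s<..t} \<tau> \<partial>lborel) = (\<integral>\<^sup>+\<tau>. H \<tau> * indicator {s<..<t} \<tau> \<partial>lborel)"
  by (rule nn_integral_cong_AE, use AE_lborel_singleton[of t] in eventually_elim) (auto simp: indicator_def)

context boltzmann_flow
begin

text \<open>The weighted moment identities are summed with coefficients
  \<open>a ^ p / fact p\<close>. The time derivatives then collect into \<open>a\<close> times an
  exponential sum weighted by \<open>\<rho>\<close>, which the balance absorbs.\<close>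

lemma exponential_growth:
  fixes a Cb :: real
  assumes M: "0 < mass" and t: "0 < t0" "t0 \<le> t" and a: "0 \<le> a" and p0: "1 \<le> p0" and Cb: "0 \<le> Cb"
    and balance: "\<And>\<tau>. t0 < \<tau> \<Longrightarrow> \<tau> < t \<Longrightarrow>
      ennreal a * (\<integral>\<^sup>+v. F \<tau> v * ennreal (\<rho> v * esum 0 N (a * (\<tau> - t0) * \<rho> v)) \<partial>lborel)
        + gain (F \<tau>) (\<lambda>v. ennreal (esum p0 N (a * (\<tau> - t0) * \<rho> v)))
      \<le> ennreal Cb + loss (F \<tau>) (\<lambda>v. ennreal (esum p0 N (a * (\<tau> - t0) * \<rho> v)))"
  shows "(\<integral>\<^sup>+v. F t v * ennreal (esum p0 N (a * (t - t0) * \<rho> v)) \<partial>lborel) \<le> ennreal (Cb * (t - t0))"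
proof -
  define c where "c p = ennreal (a ^ p / fact p)" for p :: nat
  let ?ind = "indicator {t0<..<t} :: real \<Rightarrow> ennreal"
  define L where "L p r = loss (F r) (\<lambda>v. ennreal (\<rho> v ^ p))" for p r
  define G where "G p r = gain (F r) (\<lambda>v. ennreal (\<rho> v ^ p))" for p r
  have [measurable]: "L p \<in> borel_measurable borel" "G p \<in> borel_measurable borel" for p
    unfolding L_def G_def by measurable
  define Ls where "Ls r = loss (F r) (\<lambda>v. ennreal (esum p0 N (a * (r - t0) * \<rho> v)))" for r
  define Gs where "Gs r = gain (F r) (\<lambda>v. ennreal (esum p0 N (a * (r - t0) * \<rho> v)))" for r
  define X where "X = (\<integral>\<^sup>+v. F t v * ennreal (esum p0 N (a * (t - t0) * \<rho> v)) \<partial>lborel)"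
  have cpow: "ennreal ((a * s) ^ p / fact p) = c p * ennreal (s ^ p)" if "0 \<le> s" for s p
    using that a by (simp add: c_def ennreal_mult[symmetric] power_mult_distrib)
  have LsGs: "Ls r = (\<Sum>p\<in>{p0..N}. c p * (ennreal ((r - t0) ^ p) * L p r))"
    "Gs r = (\<Sum>p\<in>{p0..N}. c p * (ennreal ((r - t0) ^ p) * G p r))" if r: "t0 < r" for r
  proof -
    have e: "(\<lambda>v. ennreal (esum p0 N (a * (r - t0) * \<rho> v))) = (\<lambda>v. \<Sum>p\<in>{p0..N}. (c p * ennreal ((r - t0) ^ p)) * ennreal (\<rho> v ^ p))"
      using a r by (subst ennreal_esum) (auto simp: cpow)
    show "Ls r = (\<Sum>p\<in>{p0..N}. c p * (ennreal ((r - t0) ^ p) * L p r))"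
      unfolding Ls_def L_def e by (subst loss_sum) (simp_all add: mult.assoc)
    show "Gs r = (\<Sum>p\<in>{p0..N}. c p * (ennreal ((r - t0) ^ p) * G p r))"
      unfolding Gs_def G_def e by (subst gain_sum) (simp_all add: mult.assoc)
  qed
  have X: "X = (\<Sum>p\<in>{p0..N}. c p * (ennreal ((t - t0) ^ p) * mom p t))"
    unfolding X_def using t a by (subst mom_esum) (auto simp: cpow mult.assoc)
  have intL: "(\<integral>\<^sup>+r. Ls r * ?ind r \<partial>lborel) = (\<Sum>p\<in>{p0..N}. c p * (\<integral>\<^sup>+r. ennreal ((r - t0) ^ p) * L p r * ?ind r \<partial>lborel))"
  proof -
    have "(\<integral>\<^sup>+r. Ls r * ?ind r \<partial>lborel) = (\<integral>\<^sup>+r. (\<Sum>p\<in>{p0..N}. c p * (ennreal ((r - t0) ^ p) * L p r * ?ind r)) \<partial>lborel)"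
      by (intro nn_integral_cong) (auto simp: indicator_def LsGs)
    then show ?thesis by (simp add: nn_integral_sum nn_integral_cmult)
  qed
  have intG: "(\<integral>\<^sup>+r. Gs r * ?ind r \<partial>lborel) = (\<Sum>p\<in>{p0..N}. c p * (\<integral>\<^sup>+r. ennreal ((r - t0) ^ p) * G p r * ?ind r \<partial>lborel))"
  proof -
    have "(\<integral>\<^sup>+r. Gs r * ?ind r \<partial>lborel) = (\<integral>\<^sup>+r. (\<Sum>p\<in>{p0..N}. c p * (ennreal ((r - t0) ^ p) * G p r * ?ind r)) \<partial>lborel)"
      by (intro nn_integral_cong) (auto simp: indicator_def LsGs)
    then show ?thesis by (simp add: nn_integral_sum nn_integral_cmult)
  qed
  define I where "I \<tau> = (\<integral>\<^sup>+v. F \<tau> v * ennreal (\<rho> v * esum 0 N (a * (\<tau> - t0) * \<rho> v)) \<partial>lborel)" for \<tau>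
  have deriv: "(\<Sum>p\<in>{p0..N}. c p * (ennreal (real p * (\<tau> - t0) ^ (p - 1)) * mom p \<tau>)) \<le> ennreal a * I \<tau>" if \<tau>: "t0 < \<tau>" for \<tau>
  proof -
    let ?s = "\<tau> - t0"
    \<comment> \<open>Differentiating the factor of order \<open>p\<close> lowers it to order
      \<open>p - 1\<close> but keeps the moment of order \<open>p\<close>. The shifted range starts
      at \<open>p0 - 1\<close>, which is why the balance involves the sum from order 0.\<close>
    have "(\<Sum>p\<in>{p0..N}. c p * (ennreal (real p * ?s ^ (p - 1)) * mom p \<tau>))
      = (\<Sum>p\<in>{p0..N}. ennreal a * (ennreal ((a * ?s) ^ (p - 1) / fact (p - 1)) * mom (Suc (p - 1)) \<tau>))"
    proof (intro sum.cong refl)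
      fix p assume "p \<in> {p0..N}"
      then obtain q where q: "p = Suc q" using p0 by (cases p) auto
      have "a ^ p / fact p * (real p * ?s ^ (p - 1)) = a * ((a * ?s) ^ q / fact q)"
      proof -
        have fq: "real (Suc q) / fact (Suc q) = 1 / fact q" by (simp del: of_nat_Suc)
        have "a ^ Suc q / fact (Suc q) * (real (Suc q) * x) = a * (a ^ q * x) * (real (Suc q) / fact (Suc q))" for x
          by (simp del: of_nat_Suc fact_Suc)
        then show ?thesis unfolding q fq by (simp add: power_mult_distrib)
      qed
      moreover have "0 \<le> a ^ p / fact p" "0 \<le> real p * ?s ^ (p - 1)" "0 \<le> (a * ?s) ^ q / fact q" using a \<tau> by auto
      ultimately have "c p * ennreal (real p * ?s ^ (p - 1)) = ennreal a * ennreal ((a * ?s) ^ q / fact q)"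
        unfolding c_def using a by (simp only: ennreal_mult[symmetric])
      then show "c p * (ennreal (real p * ?s ^ (p - 1)) * mom p \<tau>) = ennreal a * (ennreal ((a * ?s) ^ (p - 1) / fact (p - 1)) * mom (Suc (p - 1)) \<tau>)"
        unfolding mult.assoc[symmetric] by (simp add: q)
    qed
    also have "\<dots> = (\<Sum>q\<in>(\<lambda>p. p - 1) ` {p0..N}. ennreal a * (ennreal ((a * ?s) ^ q / fact q) * mom (Suc q) \<tau>))"
      using p0 by (subst sum.reindex) (auto intro!: inj_onI)
    also have "\<dots> \<le> (\<Sum>q\<in>{0..N}. ennreal a * (ennreal ((a * ?s) ^ q / fact q) * mom (Suc q) \<tau>))"
      by (intro sum_mono2) auto
    also have "\<dots> = ennreal a * I \<tau>"
      unfolding I_def using a \<tau> by (subst mom_rho_esum) (auto simp: sum_distrib_left)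
    finally show ?thesis .
  qed
  have Im: "I \<in> borel_measurable borel" unfolding I_def by measurable
  have Gsm: "Gs \<in> borel_measurable borel" and Lsm: "Ls \<in> borel_measurable borel"
    unfolding Gs_def Ls_def gain_def loss_def by measurable
  note [measurable] = Im Gsm Lsm
  \<comment> \<open>Each moment has bounded loss after \<open>t0\<close>, so the total loss is
    finite and can be cancelled at the end.\<close>
  have fin: "(\<integral>\<^sup>+r. Ls r * ?ind r \<partial>lborel) < top"
  proof -
    have "c p * (\<integral>\<^sup>+r. ennreal ((r - t0) ^ p) * L p r * ?ind r \<partial>lborel) < top" for p
    proof -
      obtain K where K: "0 \<le> K" "\<And>r. r \<in> {t0..t} \<Longrightarrow> L p r \<le> ennreal K"
        using gain_mom_bound[OF M t(1), of t p] unfolding L_def by blast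
      have "(\<integral>\<^sup>+r. ennreal ((r - t0) ^ p) * L p r * ?ind r \<partial>lborel) \<le> (\<integral>\<^sup>+r. ennreal ((t - t0) ^ p) * ennreal K * ?ind r \<partial>lborel)"
      proof (rule nn_integral_mono)
        fix r show "ennreal ((r - t0) ^ p) * L p r * ?ind r \<le> ennreal ((t - t0) ^ p) * ennreal K * ?ind r"
        proof (cases "r \<in> {t0<..<t}")
          case True
          then show ?thesis by (intro mult_right_mono mult_mono ennreal_leI power_mono K) auto
        qed simp
      qed
      also have "\<dots> < top" using t by (simp add: nn_integral_cmult ennreal_mult_less_top)
      finally show ?thesis by (simp add: c_def ennreal_mult_less_top)
    qed
    then show ?thesis unfolding intL by simp
  qed
  have "X + (\<integral>\<^sup>+r. Ls r * ?ind r \<partial>lborel)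
    = (\<Sum>p\<in>{p0..N}. c p * (ennreal ((t - t0) ^ p) * mom p t + (\<integral>\<^sup>+r. ennreal ((r - t0) ^ p) * L p r * ?ind r \<partial>lborel)))"
    unfolding X intL by (simp add: sum.distrib distrib_left)
  also have "\<dots> = (\<Sum>p\<in>{p0..N}. c p * ((\<integral>\<^sup>+\<tau>. ennreal (real p * (\<tau> - t0) ^ (p - 1)) * mom p \<tau> * ?ind \<tau> \<partial>lborel)
      + (\<integral>\<^sup>+r. ennreal ((r - t0) ^ p) * G p r * ?ind r \<partial>lborel)))"
  proof (intro sum.cong refl arg_cong2[where f="(*)"])
    fix p assume "p \<in> {p0..N}"
    then have "1 \<le> p" using p0 by simp
    from weighted_mom_weak[OF less_imp_le[OF t(1)] t(2) this]
    show "ennreal ((t - t0) ^ p) * mom p t + (\<integral>\<^sup>+r. ennreal ((r - t0) ^ p) * L p r * ?ind r \<partial>lborel)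
      = (\<integral>\<^sup>+\<tau>. ennreal (real p * (\<tau> - t0) ^ (p - 1)) * mom p \<tau> * ?ind \<tau> \<partial>lborel) + (\<integral>\<^sup>+r. ennreal ((r - t0) ^ p) * G p r * ?ind r \<partial>lborel)"
      unfolding L_def G_def nn_integral_Ioc_eq_Ioo .
  qed
  also have "\<dots> = (\<integral>\<^sup>+\<tau>. (\<Sum>p\<in>{p0..N}. c p * (ennreal (real p * (\<tau> - t0) ^ (p - 1)) * mom p \<tau>)) * ?ind \<tau> \<partial>lborel) + (\<integral>\<^sup>+r. Gs r * ?ind r \<partial>lborel)"
  proof -
    have "(\<integral>\<^sup>+\<tau>. (\<Sum>p\<in>{p0..N}. c p * (ennreal (real p * (\<tau> - t0) ^ (p - 1)) * mom p \<tau>)) * ?ind \<tau> \<partial>lborel)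
      = (\<Sum>p\<in>{p0..N}. c p * (\<integral>\<^sup>+\<tau>. ennreal (real p * (\<tau> - t0) ^ (p - 1)) * mom p \<tau> * ?ind \<tau> \<partial>lborel))"
      by (simp add: sum_distrib_right nn_integral_sum mult.assoc nn_integral_cmult)
    then show ?thesis unfolding intG by (simp add: sum.distrib distrib_left)
  qed
  also have "\<dots> \<le> (\<integral>\<^sup>+\<tau>. ennreal a * I \<tau> * ?ind \<tau> \<partial>lborel) + (\<integral>\<^sup>+r. Gs r * ?ind r \<partial>lborel)"
    using deriv by (intro add_right_mono nn_integral_mono) (auto simp: indicator_def)
  also have "\<dots> = (\<integral>\<^sup>+\<tau>. (ennreal a * I \<tau> + Gs \<tau>) * ?ind \<tau> \<partial>lborel)"
    by (simp add: distrib_right nn_integral_add)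
  also have "\<dots> \<le> (\<integral>\<^sup>+\<tau>. (ennreal Cb + Ls \<tau>) * ?ind \<tau> \<partial>lborel)"
    using balance by (intro nn_integral_mono) (auto simp: indicator_def I_def Gs_def Ls_def)
  also have "\<dots> = ennreal (Cb * (t - t0)) + (\<integral>\<^sup>+r. Ls r * ?ind r \<partial>lborel)"
    using t Cb by (simp add: distrib_right nn_integral_add nn_integral_cmult ennreal_mult)
  finally have "X + (\<integral>\<^sup>+r. Ls r * ?ind r \<partial>lborel) \<le> ennreal (Cb * (t - t0)) + (\<integral>\<^sup>+r. Ls r * ?ind r \<partial>lborel)" .
  then show ?thesis
    using fin unfolding X_def by (auto simp: add.commute[of _ "\<integral>\<^sup>+r. Ls r * ?ind r \<partial>lborel"] ennreal_add_left_cancel_le)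
qed

text \<open>The bound starts from \<open>mass\<close> at \<open>t0\<close> and grows at most
  linearly; \<open>t1\<close> is the time in which the growth uses up one further
  \<open>mass\<close>. Neither slope nor \<open>t1\<close> involves \<open>N\<close> or
  \<open>t0\<close>.\<close>

lemma exponential_sum_bound:
  fixes C0 t1 :: real
  assumes M: "0 < mass" and p0: "1 \<le> p0" "p0 \<le> N" and C0: "1 \<le> C0"
    and \<gamma>: "\<And>u V::'a. norm u = 1 \<Longrightarrow> norm V = 1 \<Longrightarrow>
      (\<integral>\<^sup>+\<sigma>. k (u \<bullet> \<sigma>) * ennreal (angular_factor (V \<bullet> \<sigma>) ^ p0) \<partial>sph) \<le> ennreal (\<Lambda> / 128)"
    and low: "\<And>x. 0 \<le> x \<Longrightarrow> esum 0 N x \<le> C0 + 2 * esum p0 N x"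
      "\<And>x. 0 \<le> x \<Longrightarrow> esum 0 N x \<le> 1 + C0 * x + 2 * esum p0 N x"
    and a: "a = \<Lambda> * mass / 8" and Cb: "Cb = (mass + energy) * (\<Lambda> * mass * (4 + C0 / 4))"
    and t1: "(C0 * a * (mass + energy) + 2 * Cb) * t1 \<le> mass"
    and t: "0 < t0" "t0 \<le> t" "t \<le> t0 + t1"
  shows "(\<integral>\<^sup>+v. F t v * ennreal (esum 0 N (a * (t - t0) * \<rho> v)) \<partial>lborel) \<le> ennreal (2 * mass)"
proof -
  have E: "0 \<le> energy" by (rule energy_nonneg)
  have a0: "0 < a" unfolding a using Lambda M by simp
  have Cb0: "0 \<le> Cb" unfolding Cb using Lambda M E C0 by simp
  \<comment> \<open>A finite combination of finite real moments, so that continuity can be used;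
    \<open>h\<close> identifies it with the integral.\<close>
  define h where "h s = (\<Sum>p\<in>{0..N}. (a * (s - t0)) ^ p / fact p * enn2real (mom p s))" for s
  have h0: "0 \<le> h s" if "t0 \<le> s" for s unfolding h_def using that a0 by (intro sum_nonneg) auto
  have h: "(\<integral>\<^sup>+v. F s v * ennreal (esum 0 N (a * (s - t0) * \<rho> v)) \<partial>lborel) = ennreal (h s)" if s: "t0 \<le> s" for s
  proof -
    have "(\<integral>\<^sup>+v. F s v * ennreal (esum 0 N (a * (s - t0) * \<rho> v)) \<partial>lborel) = (\<Sum>p\<in>{0..N}. ennreal ((a * (s - t0)) ^ p / fact p) * mom p s)"
      using s a0 by (intro mom_esum) auto
    also have "\<dots> = (\<Sum>p\<in>{0..N}. ennreal ((a * (s - t0)) ^ p / fact p * enn2real (mom p s)))"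
    proof (intro sum.cong refl)
      fix p
      have "mom p s = ennreal (enn2real (mom p s))" using mom_finite[OF M, of s p] s t by simp
      then show "ennreal ((a * (s - t0)) ^ p / fact p) * mom p s = ennreal ((a * (s - t0)) ^ p / fact p * enn2real (mom p s))"
        using s a0 by (subst ennreal_mult) auto
    qed
    also have "\<dots> = ennreal (h s)"
      unfolding h_def using s a0 by (intro sum_ennreal) auto
    finally show ?thesis .
  qed
  have cont: "continuous_on {t0..t0 + t1} h"
    unfolding h_def by (intro continuous_intros continuous_on_mom M t) auto
  have "h t \<le> 2 * mass"
  proof (rule continuity_bootstrap[OF cont M _ t(2,3)])
    fix s assume s: "t0 \<le> s" "s \<le> t0 + t1" and small: "\<And>\<tau>. t0 < \<tau> \<Longrightarrow> \<tau> < s \<Longrightarrow> h \<tau> \<le> 4 * mass"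
    let ?X = "\<integral>\<^sup>+v. F s v * ennreal (esum p0 N (a * (s - t0) * \<rho> v)) \<partial>lborel"
    have X: "?X \<le> ennreal (Cb * (s - t0))"
    proof (rule exponential_growth[OF M t(1) s(1) _ p0(1) Cb0])
      fix \<tau> assume \<tau>: "t0 < \<tau>" "\<tau> < s"
      have J: "(\<integral>\<^sup>+v. F \<tau> v * ennreal (esum 0 N (a * (\<tau> - t0) * \<rho> v)) \<partial>lborel) \<le> ennreal (4 * mass)"
        using h[of \<tau>] small[OF \<tau>] \<tau> by (simp add: ennreal_leI)
      have Fr: "(\<integral>\<^sup>+v. F \<tau> v * ennreal (\<rho> v) \<partial>lborel) \<le> ennreal (mass + energy)"
        using F_rho_le[of \<tau>] M E by (simp add: F_mass)
      show "ennreal a * (\<integral>\<^sup>+v. F \<tau> v * ennreal (\<rho> v * esum 0 N (a * (\<tau> - t0) * \<rho> v)) \<partial>lborel)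
        + gain (F \<tau>) (\<lambda>v. ennreal (esum p0 N (a * (\<tau> - t0) * \<rho> v)))
      \<le> ennreal Cb + loss (F \<tau>) (\<lambda>v. ennreal (esum p0 N (a * (\<tau> - t0) * \<rho> v)))"
      proof (subst a(1), subst Cb, rule exponential_balance[OF _ M E _ C0 F_mass Fr _ _ J])
        show "F \<tau> \<in> borel_measurable borel" by measurable
        show "0 \<le> a * (\<tau> - t0)" using \<tau> a0 by simp
        show "(\<integral>\<^sup>+\<sigma>. k (u \<bullet> \<sigma>) * ennreal (angular_factor (V \<bullet> \<sigma>) ^ p0) \<partial>sph) \<le> ennreal (\<Lambda> / 128)"
          if "norm u = 1" "norm V = 1" for u V :: 'a by (rule \<gamma>[OF that])
        show "esum 0 N x \<le> C0 + 2 * esum p0 N x" if "0 \<le> x" for x by (rule low(1)[OF that])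
      qed
    qed (use a0 in simp)
    \<comment> \<open>The second estimate of \<open>low\<close> is essential: its constant 1
      integrates to \<open>mass\<close>, whereas \<open>C0\<close> could already exceed the target
      \<open>2 * mass\<close>.\<close>
    have "ennreal (h s) \<le> (\<integral>\<^sup>+v. F s v + (ennreal (C0 * (a * (s - t0))) * (F s v * ennreal (\<rho> v)) + 2 * (F s v * ennreal (esum p0 N (a * (s - t0) * \<rho> v)))) \<partial>lborel)"
      unfolding h[OF s(1), symmetric]
    proof (rule nn_integral_mono)
      fix v
      define x where "x = a * (s - t0) * \<rho> v"
      have x: "0 \<le> x" using a0 s by (simp add: x_def)
      have C0x: "0 \<le> C0 * (a * (s - t0))" using a0 s C0 by simp
      have "ennreal (esum 0 N x) \<le> ennreal (1 + (C0 * (a * (s - t0)) * \<rho> v + 2 * esum p0 N x))"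
        using low(2)[OF x] by (intro ennreal_leI) (simp add: x_def mult.assoc add.assoc)
      also have "\<dots> = 1 + (ennreal (C0 * (a * (s - t0))) * ennreal (\<rho> v) + 2 * ennreal (esum p0 N x))"
      proof -
        have "ennreal (C0 * (a * (s - t0)) * \<rho> v) = ennreal (C0 * (a * (s - t0))) * ennreal (\<rho> v)"
          using C0x by (intro ennreal_mult) auto
        moreover have "ennreal (2 * esum p0 N x) = 2 * ennreal (esum p0 N x)"
          using esum_nonneg[OF x, of p0 N] by (subst ennreal_mult) auto
        moreover have "ennreal (1 + (C0 * (a * (s - t0)) * \<rho> v + 2 * esum p0 N x))
          = ennreal 1 + (ennreal (C0 * (a * (s - t0)) * \<rho> v) + ennreal (2 * esum p0 N x))"
          using C0x esum_nonneg[OF x, of p0 N] by (intro ennreal_plus3) auto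
        ultimately show ?thesis by simp
      qed
      finally have "F s v * ennreal (esum 0 N x) \<le> F s v * (1 + (ennreal (C0 * (a * (s - t0))) * ennreal (\<rho> v) + 2 * ennreal (esum p0 N x)))"
        by (intro mult_left_mono) auto
      then show "F s v * ennreal (esum 0 N (a * (s - t0) * \<rho> v)) \<le> F s v + (ennreal (C0 * (a * (s - t0))) * (F s v * ennreal (\<rho> v)) + 2 * (F s v * ennreal (esum p0 N (a * (s - t0) * \<rho> v))))"
        unfolding x_def by (simp add: distrib_left mult_ac)
    qed
    also have "\<dots> = ennreal mass + (ennreal (C0 * (a * (s - t0))) * (\<integral>\<^sup>+v. F s v * ennreal (\<rho> v) \<partial>lborel) + 2 * ?X)"
      by (simp add: nn_integral_add nn_integral_cmult F_mass)
    also have "\<dots> \<le> ennreal mass + (ennreal (C0 * (a * (s - t0))) * ennreal (mass + energy) + 2 * ennreal (Cb * (s - t0)))"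
      using F_rho_le[of s] M E by (intro add_left_mono add_mono mult_left_mono X) (simp_all add: F_mass)
    also have "\<dots> = ennreal (mass + (C0 * a * (mass + energy) + 2 * Cb) * (s - t0))"
    proof -
      have nn: "0 \<le> C0 * (a * (s - t0)) * (mass + energy)" "0 \<le> 2 * (Cb * (s - t0))" "0 \<le> Cb * (s - t0)" "0 \<le> C0 * (a * (s - t0))"
        using M E a0 C0 Cb0 s by auto
      have "ennreal (C0 * (a * (s - t0))) * ennreal (mass + energy) = ennreal (C0 * (a * (s - t0)) * (mass + energy))"
        using nn M E by (intro ennreal_mult[symmetric]) auto
      moreover have "2 * ennreal (Cb * (s - t0)) = ennreal (2 * (Cb * (s - t0)))"
        using nn by (subst ennreal_mult) auto
      moreover have "mass + (C0 * a * (mass + energy) + 2 * Cb) * (s - t0) = mass + (C0 * (a * (s - t0)) * (mass + energy) + 2 * (Cb * (s - t0)))"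
        by (simp add: algebra_simps)
      moreover have "ennreal (mass + (C0 * (a * (s - t0)) * (mass + energy) + 2 * (Cb * (s - t0))))
        = ennreal mass + (ennreal (C0 * (a * (s - t0)) * (mass + energy)) + ennreal (2 * (Cb * (s - t0))))"
        using nn M by (intro ennreal_plus3) auto
      ultimately show ?thesis by (simp only:)
    qed
    finally have 1: "ennreal (h s) \<le> ennreal (mass + (C0 * a * (mass + energy) + 2 * Cb) * (s - t0))" .
    have "(C0 * a * (mass + energy) + 2 * Cb) * (s - t0) \<le> (C0 * a * (mass + energy) + 2 * Cb) * t1"
      using M E a0 C0 Cb0 s by (intro mult_left_mono) auto
    with t1 have "mass + (C0 * a * (mass + energy) + 2 * Cb) * (s - t0) \<le> 2 * mass" by simp
    moreover have "0 \<le> mass + (C0 * a * (mass + energy) + 2 * Cb) * (s - t0)"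
      using M E a0 C0 Cb0 s by auto
    ultimately show "h s \<le> 2 * mass" using 1 by (simp add: ennreal_le_iff)
  qed
  then show ?thesis unfolding h[OF t(2)] by (rule ennreal_leI)
qed

text \<open>The bound for the truncated sums is uniform in \<open>N\<close>, so monotone convergence
  passes it to the exponential.\<close>

lemma exponential_moment:
  fixes C0 t1 :: real
  assumes M: "0 < mass" and p0: "1 \<le> p0" and C0: "1 \<le> C0"
    and \<gamma>: "\<And>u V::'a. norm u = 1 \<Longrightarrow> norm V = 1 \<Longrightarrow>
      (\<integral>\<^sup>+\<sigma>. k (u \<bullet> \<sigma>) * ennreal (angular_factor (V \<bullet> \<sigma>) ^ p0) \<partial>sph) \<le> ennreal (\<Lambda> / 128)"
    and low: "\<And>x N. 0 \<le> x \<Longrightarrow> p0 \<le> N \<Longrightarrow> esum 0 N x \<le> C0 + 2 * esum p0 N x"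
      "\<And>x N. 0 \<le> x \<Longrightarrow> p0 \<le> N \<Longrightarrow> esum 0 N x \<le> 1 + C0 * x + 2 * esum p0 N x"
    and a: "a = \<Lambda> * mass / 8" and Cb: "Cb = (mass + energy) * (\<Lambda> * mass * (4 + C0 / 4))"
    and t1: "0 < t1" "(C0 * a * (mass + energy) + 2 * Cb) * t1 \<le> mass"
    and t: "0 \<le> t"
  shows "(\<integral>\<^sup>+v. F t v * ennreal (exp (a * min (1/2) t1 * min t 1 * \<rho> v)) \<partial>lborel) \<le> ennreal (2 * mass)"
proof (cases "t = 0")
  case True
  then show ?thesis using M by (simp add: F_mass)
next
  case False
  \<comment> \<open>Positive, so that the moments are finite from \<open>t0\<close> on, and at most
    \<open>t1\<close> before \<open>t\<close>. The elapsed time \<open>t - t0\<close> is then the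
    smaller of \<open>t / 2\<close> and \<open>t1\<close>.\<close>
  define t0 where "t0 = max (t / 2) (t - t1)"
  have t0: "0 < t0" "t0 \<le> t" "t \<le> t0 + t1" using t False t1 by (auto simp: t0_def)
  have a0: "0 < a" unfolding a using Lambda M by simp
  have le: "min (1/2) t1 * min t 1 \<le> t - t0"
  proof -
    have "min (1/2) t1 * min t 1 \<le> (1/2) * t" using t t1 by (intro mult_mono) auto
    moreover have "min (1/2) t1 * min t 1 \<le> t1 * 1" using t t1 by (intro mult_mono) auto
    ultimately show ?thesis by (auto simp: t0_def)
  qed
  have "(\<lambda>N. \<integral>\<^sup>+v. F t v * ennreal (esum 0 N (a * (t - t0) * \<rho> v)) \<partial>lborel)
      \<longlonglongrightarrow> (\<integral>\<^sup>+v. F t v * ennreal (exp (a * (t - t0) * \<rho> v)) \<partial>lborel)"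
  proof (rule nn_integral_LIMSEQ)
    have nn: "0 \<le> a * (t - t0) * \<rho> v" for v using a0 t0 by simp
    show "incseq (\<lambda>N v. F t v * ennreal (esum 0 N (a * (t - t0) * \<rho> v)))"
      unfolding esum_def by (intro incseq_SucI le_funI mult_left_mono ennreal_leI sum_mono2) (use nn in auto)
    show "(\<lambda>N. F t v * ennreal (esum 0 N (a * (t - t0) * \<rho> v))) \<longlonglongrightarrow> F t v * ennreal (exp (a * (t - t0) * \<rho> v))" for v
      by (intro ennreal_tendsto_cmult tendsto_ennrealI esum_tendsto_exp) (simp add: F_def)
  qed measurable
  then have lim: "(\<integral>\<^sup>+v. F t v * ennreal (exp (a * (t - t0) * \<rho> v)) \<partial>lborel) \<le> ennreal (2 * mass)"
  proof (rule LIMSEQ_le_const2)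
    show "\<exists>n. \<forall>N\<ge>n. (\<integral>\<^sup>+v. F t v * ennreal (esum 0 N (a * (t - t0) * \<rho> v)) \<partial>lborel) \<le> ennreal (2 * mass)"
    proof (intro exI[of _ p0] allI impI)
      fix N assume N: "p0 \<le> N"
      show "(\<integral>\<^sup>+v. F t v * ennreal (esum 0 N (a * (t - t0) * \<rho> v)) \<partial>lborel) \<le> ennreal (2 * mass)"
      proof (rule exponential_sum_bound[OF M p0 N C0 _ _ _ a Cb t1(2) t0])
        show "(\<integral>\<^sup>+\<sigma>. k (u \<bullet> \<sigma>) * ennreal (angular_factor (V \<bullet> \<sigma>) ^ p0) \<partial>sph) \<le> ennreal (\<Lambda> / 128)"
          if "norm u = 1" "norm V = 1" for u V :: 'a by (rule \<gamma>[OF that])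
        show "esum 0 N x \<le> C0 + 2 * esum p0 N x" "esum 0 N x \<le> 1 + C0 * x + 2 * esum p0 N x" if "0 \<le> x" for x
          by (rule low[OF that N])+
      qed
    qed
  qed
  have "(\<integral>\<^sup>+v. F t v * ennreal (exp (a * min (1/2) t1 * min t 1 * \<rho> v)) \<partial>lborel) \<le> (\<integral>\<^sup>+v. F t v * ennreal (exp (a * (t - t0) * \<rho> v)) \<partial>lborel)"
  proof (intro nn_integral_mono mult_left_mono ennreal_leI)
    fix v
    have "a * (min (1/2) t1 * min t 1) * \<rho> v \<le> a * (t - t0) * \<rho> v"
      using le a0 by (intro mult_right_mono mult_left_mono) auto
    then show "exp (a * min (1/2) t1 * min t 1 * \<rho> v) \<le> exp (a * (t - t0) * \<rho> v)" by (simp add: mult.assoc)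
  qed simp
  with lim show ?thesis by (rule order_trans[rotated])
qed

end

section \<open>Choice of the constants\<close>

theorem theorem1:
  fixes b :: "real \<Rightarrow> real" and \<beta> mass energy :: real
  assumes dim: "DIM('a::euclidean_space) \<ge> 2"
    and beta: "0 < \<beta>" "\<beta> \<le> 2"
    and b_nonneg: "\<And>z. z \<in> {-1..1} \<Longrightarrow> 0 \<le> b z"
    and b_nonzero: "\<not> (AE z\<in>{-1..1} in lborel. b z = 0)"
    and b_L1: "set_integrable lborel {-1..1}
                 (\<lambda>z. b z * (1 - z\<^sup>2) powr ((real DIM('a) - 3) / 2))"
  shows "\<exists>C>0. \<exists>a>0. \<forall>(f0 :: 'a \<Rightarrow> real) f.
           (\<forall>v. 0 \<le> f0 v) \<longrightarrow>
           integrable lborel (\<lambda>v. (1 + (norm v)\<^sup>2) * f0 v) \<longrightarrow>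
           (\<integral>v. f0 v \<partial>lborel) = mass \<longrightarrow>
           (\<integral>v. (norm v)\<^sup>2 * f0 v \<partial>lborel) = energy \<longrightarrow>
           boltzmann_solution (\<lambda>r z. r powr \<beta> * b z) f0 f \<longrightarrow>
           energy_conserving f0 f \<longrightarrow>
           (\<forall>t\<ge>0. (\<integral>\<^sup>+v. ennreal (f t v * exp (a * min t 1 * norm v powr \<beta>)) \<partial>lborel)
                    \<le> ennreal C)"
proof -
  interpret hp: hard_potential "TYPE('a)" b \<beta>
    using assms by unfold_locales
  \<comment> \<open>All hypotheses on the data and the solution are packed into one predicate, so
    that \<open>C\<close> and \<open>a\<close> can be fixed before either is introduced.\<close>
  define adm where "adm f0 f \<longleftrightarrow> boltzmann_flow b \<beta> f0 f mass energy" for f0 :: "'a \<Rightarrow> real" and f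
  have "\<exists>C>0. \<exists>a>0. \<forall>(f0 :: 'a \<Rightarrow> real) f. adm f0 f \<longrightarrow>
      (\<forall>t\<ge>0. (\<integral>\<^sup>+v. ennreal (f t v * exp (a * min t 1 * norm v powr \<beta>)) \<partial>lborel) \<le> ennreal C)"
  proof (cases "0 < mass \<and> 0 \<le> energy")
    \<comment> \<open>Existing data have nonnegative mass and energy, so only
      \<open>mass = 0\<close> remains, and then the solution vanishes almost everywhere at each
      time.\<close>
    case False
    have "(\<integral>\<^sup>+v. ennreal (f t v * exp (1 * min t 1 * norm v powr \<beta>)) \<partial>lborel) \<le> ennreal 1"
      if "adm f0 f" "0 \<le> t" for f0 :: "'a \<Rightarrow> real" and f and t :: real
    proof -
      interpret boltzmann_flow "TYPE('a)" b \<beta> f0 f mass energy using that(1) by (simp add: adm_def)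
      have "mass = 0" using False mass_nonneg energy_nonneg by auto
      then have "(\<integral>\<^sup>+v. F t v \<partial>lborel) = 0" using F_mass[of t] by simp
      then have "AE v in lborel. F t v = 0" by (subst (asm) nn_integral_0_iff_AE) auto
      then have "(\<integral>\<^sup>+v. ennreal (f t v * exp (1 * min t 1 * norm v powr \<beta>)) \<partial>lborel) = (\<integral>\<^sup>+v. 0 \<partial>(lborel :: 'a measure))"
        by (intro nn_integral_cong_AE, elim eventually_mono)
          (use that(2) in \<open>auto simp: F_def max_def ennreal_eq_0_iff mult_nonpos_nonneg\<close>)
      then show ?thesis by simp
    qed
    then show ?thesis by (intro exI[of _ 1] conjI) auto
  next
    case True
    then have M: "0 < mass" and E: "0 \<le> energy" by auto
    obtain q where q: "\<And>u V::'a. norm u = 1 \<Longrightarrow> norm V = 1 \<Longrightarrow>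
      (\<integral>\<^sup>+\<sigma>. hp.k (u \<bullet> \<sigma>) * ennreal (hp.angular_factor (V \<bullet> \<sigma>) ^ q) \<partial>sph) \<le> ennreal (hp.\<Lambda> / 128)"
      using hp.angular_small[of "hp.\<Lambda> / 128"] hp.Lambda(1) by auto
    \<comment> \<open>The successor guarantees order at least 1, and raising the power only
      decreases the angular average.\<close>
    define p0 where "p0 = Suc q"
    have \<gamma>: "(\<integral>\<^sup>+\<sigma>. hp.k (u \<bullet> \<sigma>) * ennreal (hp.angular_factor (V \<bullet> \<sigma>) ^ p0) \<partial>sph) \<le> ennreal (hp.\<Lambda> / 128)"
      if "norm u = 1" "norm V = 1" for u V :: 'a
    proof (rule order_trans[OF _ q[OF that]], intro nn_integral_mono mult_left_mono ennreal_leI)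
      fix \<sigma>
      show "hp.angular_factor (V \<bullet> \<sigma>) ^ p0 \<le> hp.angular_factor (V \<bullet> \<sigma>) ^ q"
        unfolding p0_def using hp.angular_factor_bounds[of "V \<bullet> \<sigma>"] by (intro power_decreasing) auto
    qed simp
    have p0: "1 \<le> p0" by (simp add: p0_def)
    show ?thesis
    proof (rule low_order_terms[OF p0])
      fix C0 :: real
      assume C0: "1 \<le> C0" and low: "\<And>x N. 0 \<le> x \<Longrightarrow> p0 \<le> N \<Longrightarrow> esum 0 N x \<le> C0 + 2 * esum p0 N x"
        "\<And>x N. 0 \<le> x \<Longrightarrow> p0 \<le> N \<Longrightarrow> esum 0 N x \<le> 1 + C0 * x + 2 * esum p0 N x"
      define a where "a = hp.\<Lambda> * mass / 8"
      define Cb where "Cb = (mass + energy) * (hp.\<Lambda> * mass * (4 + C0 / 4))"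
      define S where "S = C0 * a * (mass + energy) + 2 * Cb"
      have a: "0 < a" using hp.Lambda(1) M by (simp add: a_def)
      have "0 < Cb" unfolding Cb_def using hp.Lambda(1) M E C0 by (intro mult_pos_pos) auto
      then have S: "0 < S" unfolding S_def using a M E C0 by (intro add_nonneg_pos) auto
      \<comment> \<open>\<open>S\<close> is the linear growth rate of the exponential sums, so over
        a time \<open>t1\<close> they gain at most \<open>mass\<close>.\<close>
      define t1 where "t1 = mass / S"
      have t1: "0 < t1" "S * t1 \<le> mass" using S M by (auto simp: t1_def)
      have "(\<integral>\<^sup>+v. ennreal (f t v * exp (a * min (1/2) t1 * min t 1 * norm v powr \<beta>)) \<partial>lborel) \<le> ennreal (2 * mass)"
        if "adm f0 f" "0 \<le> t" for f0 :: "'a \<Rightarrow> real" and f and t :: real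
      proof -
        interpret boltzmann_flow "TYPE('a)" b \<beta> f0 f mass energy using that(1) by (simp add: adm_def)
        have "(\<integral>\<^sup>+v. ennreal (f t v * exp (a * min (1/2) t1 * min t 1 * norm v powr \<beta>)) \<partial>lborel)
          = (\<integral>\<^sup>+v. F t v * ennreal (exp (a * min (1/2) t1 * min t 1 * hp.\<rho> v)) \<partial>lborel)"
          using that(2) f_nonneg[of t] by (intro nn_integral_cong) (simp add: F_def hp.\<rho>_def max_absorb2 ennreal_mult)
        also have "\<dots> \<le> ennreal (2 * mass)"
        proof (rule exponential_moment[OF M p0 C0 _ _ _ a_def Cb_def t1(1) t1(2)[unfolded S_def] that(2)])
          show "(\<integral>\<^sup>+\<sigma>. hp.k (u \<bullet> \<sigma>) * ennreal (hp.angular_factor (V \<bullet> \<sigma>) ^ p0) \<partial>sph) \<le> ennreal (hp.\<Lambda> / 128)"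
            if "norm u = 1" "norm V = 1" for u V :: 'a by (rule \<gamma>[OF that])
          show "esum 0 N x \<le> C0 + 2 * esum p0 N x" "esum 0 N x \<le> 1 + C0 * x + 2 * esum p0 N x"
            if "0 \<le> x" "p0 \<le> N" for x N
            by (rule low[OF that])+
        qed
        finally show ?thesis .
      qed
      then show ?thesis
        using M a t1 by (intro exI[of _ "2 * mass"] conjI exI[of _ "a * min (1/2) t1"]) auto
    qed
  qed
  then obtain C a where Ca: "0 < C" "0 < a" and bound: "\<forall>(f0 :: 'a \<Rightarrow> real) f. adm f0 f \<longrightarrow>
      (\<forall>t\<ge>0. (\<integral>\<^sup>+v. ennreal (f t v * exp (a * min t 1 * norm v powr \<beta>)) \<partial>lborel) \<le> ennreal C)"
    by (elim exE conjE) (rule that)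
  show ?thesis
  proof (rule exI[of _ C], rule conjI[OF Ca(1)], rule exI[of _ a], rule conjI[OF Ca(2)], intro allI impI)
    fix f0 :: "'a \<Rightarrow> real" and f and t :: real
    assume "\<forall>v. 0 \<le> f0 v" "integrable lborel (\<lambda>v. (1 + (norm v)\<^sup>2) * f0 v)"
      "(\<integral>v. f0 v \<partial>lborel) = mass" "(\<integral>v. (norm v)\<^sup>2 * f0 v \<partial>lborel) = energy"
      "boltzmann_solution (\<lambda>r z. r powr \<beta> * b z) f0 f" "energy_conserving f0 f" and t: "0 \<le> t"
    then have "boltzmann_flow_axioms b \<beta> f0 f mass energy"
      by (intro boltzmann_flow_axioms.intro) auto
    then have "adm f0 f"
      unfolding adm_def boltzmann_flow_def using hp.hard_potential_axioms by simp
    then show "(\<integral>\<^sup>+v. ennreal (f t v * exp (a * min t 1 * norm v powr \<beta>)) \<partial>lborel) \<le> ennreal C"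
      using bound t by simp
  qed
qed

end
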